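(* Let $R$ be a commutative unital ring, $\sigma:R\to R$ an essential unital ring endomorphism, $t\in R$, and let $A=A(R,\sigma,t)$ be the corresponding weak generalized Weyl algebra of rank one. Then every simple weight $A$-module is isomorphic either to a string module or to a band module.
   Context: $\sigma$ is not assumed to be an automorphism. $A=A(R,\sigma,t)$ is the unital ring generated over $R$ by elements $X,Y$ subject to the relations $YX=t$, $XY=\sigma(t)$, $Xr=\sigma(r)X$, $rY=Y\sigma(r)$ for all $r\in R$. Modules are left modules. $\mathrm{Max}(R)$ is the set of maximal ideals of $R$; $\Bbbk_{\mathbf m}:=R/\mathbf m$ for $\mathbf m\in\mathrm{Max}(R)$. For an $A$-module $M$ put $M_{\mathbf m}=\{v\in M:\mathbf m v=0\}$; $M$ is a weight module if $M=\bigoplus_{\mathbf m\in\mathrm{Max}(R)}M_{\mathbf m}$, and $\mathrm{supp}(M)=\{\mathbf m: M_{\mathbf m}\neq0\}$. The endomorphism $\sigma$ is essential if for every $\mathbf m\in\mathrm{Max}(R)$ the canonical inclusion $\sigma(R)/(\sigma(R)\cap\mathbf m)\hookrightarrow R/\mathbf m$ is surjective. String modules. Consider families $\underline{\mathbf m}=(\mathbf m_i)_{i\in I}$ of maximal ideals of $R$ with $\sigma(\mathbf m_i)\subset\mathbf m_{i+1}$ whenever $i,i+1\in I$, where one of the following holds: (1) $I=\mathbb Z$ (the set of these families is ${}_\infty Q_\infty$; double infinite string); (2) $I=\{0,1,2,\dots\}$ and $\sigma(t)\in\mathbf m_0$ (the set $Q_\infty$; right infinite string); (3) $I=\{0,-1,-2,\dots\}$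 and $t\in\mathbf m_0$ (the set ${}_\infty Q$; left infinite string); (4) $I=\{0,1,\dots,n\}$ for some integer $n\ge0$, $\sigma(t)\in\mathbf m_0$ and $t\in\mathbf m_n$ (the set $Q_n$; bounded string). The corresponding string module, denoted $N(\underline{\mathbf m})$, $N^{\uparrow}(\underline{\mathbf m})$, $N^{\downarrow}(\underline{\mathbf m})$, $N_n(\underline{\mathbf m})$ respectively, is $\bigoplus_{i\in I}\Bbbk_{\mathbf m_i}$ with the natural $R$-module structure. If $i,i+1\in I$, then $X$ maps $\Bbbk_{\mathbf m_i}$ to $\Bbbk_{\mathbf m_{i+1}}$ by $r+\mathbf m_i\mapsto\sigma(tr)+\mathbf m_{i+1}$; if $i\in I$ and $i+1\notin I$, then $X\Bbbk_{\mathbf m_i}=0$. If $i,i-1\in I$, then $Y$ maps $\Bbbk_{\mathbf m_i}$ to $\Bbbk_{\mathbf m_{i-1}}$ by $r+\mathbf m_i\mapsto s+\mathbf m_{i-1}$, where $s\in R$ is any element with $\sigma(s)\in r+\mathbf m_i$ (it exists since $\sigma$ is essential, and the result does not depend on its choice); if $i\in I$ and $i-1\notin I$, then $Y\Bbbk_{\mathbf m_i}=0$. Band modules. Let $\underline{\mathbf m}=(\mathbf m_i)_{i\in\mathbb Z}\in{}_\infty Q_\infty$ be periodic with minimal period $k\ge1$ (i.e. $k$ is the least positive integer with $\mathbf m_{i+k}=\mathbf m_i$ for all $i$). Put $\mathbf m=\mathbf m_0$, $\Bbbk=\Bbbk_{\mathbf m}$. For $i>0$ let $\tau_i:\Bbbk\to\Bbbk_{\mathbf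 m_i}$ be the isomorphism $r+\mathbf m\mapsto\sigma^i(r)+\mathbf m_i$, let $\tau_0=\mathrm{id}_{\Bbbk}$, and let $\overline\sigma=\tau_k$, an automorphism of $\Bbbk=\Bbbk_{\mathbf m_k}$. Let $\mathbf P=\Bbbk[\alpha,\alpha^{-1},\overline\sigma]$ be the skew Laurent polynomial ring with $\alpha c=\overline\sigma(c)\alpha$ for $c\in\Bbbk$. For an irreducible $f\in\mathbf P$ let $L_f=\mathbf P/\mathbf Pf$, a simple $\mathbf P$-module, finite dimensional over $\Bbbk$. The band modules (for all such $\underline{\mathbf m}$ and $f$) are the following modules $M^f$ and $N^f$. $M^f$ has support $\{\mathbf m_{-(k-1)},\dots,\mathbf m_{-1},\mathbf m_0\}$; for $0\le i\le k-1$, $M^f_{\mathbf m_{-i}}=L_f$ as an abelian group with $r\in R$ acting by $r\cdot v=(\sigma^i(r)+\mathbf m)v$; $Y:M^f_{\mathbf m_{-i}}\to M^f_{\mathbf m_{-i-1}}$ is the identity of $L_f$ for $0\le i\le k-2$; $Y:M^f_{\mathbf m_{-(k-1)}}\to M^f_{\mathbf m_0}$ is the action of $\alpha^{-1}$ on $L_f$; thus $Y$ is bijective and $X$ is defined by $X(Yv)=\sigma(t)v$. $N^f$ has support $\{\mathbf m_0,\mathbf m_1,\dots,\mathbf m_{k-1}\}$; for $0\le i\le k-1$, $N^f_{\mathbf m_i}=L_f$ as an abelian group with $R$ acting via $R\to\Bbbk_{\mathbf m_i}\xrightarrow{\tau_i^{-1}}\Bbbk$; $X:N^f_{\mathbf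 m_i}\to N^f_{\mathbf m_{i+1}}$ is the identity of $L_f$ for $0\le i\le k-2$; $X:N^f_{\mathbf m_{k-1}}\to N^f_{\mathbf m_0}$ is the action of $\alpha$ on $L_f$; thus $X$ is bijective and $Y$ is defined by $Y(Xv)=tv$. *)

theory Defs
  imports "HOL-Algebra.QuotRing" "HOL-Algebra.Module"
begin

section \<open>Left modules over a not necessarily commutative ring\<close>

text \<open>
  The library locale \<^locale>\<open>module\<close> requires a commutative ring of scalars.  As there, the
  fields \<^term>\<open>mult\<close> and \<^term>\<open>one\<close> of the record of a module carry no information.
\<close>

locale left_module = A?: ring A + M?: abelian_group M
  for A :: "('a, 'c) ring_scheme" (structure) and M :: "('a, 'm, 'd) module_scheme" (structure) +
  assumes smult_closed [simp, intro]:
      "\<lbrakk>a \<in> carrier A; x \<in> carrier M\<rbrakk> \<Longrightarrow> a \<odot>\<^bsub>M\<^esub> x \<in> carrier M"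
    and smult_l_distr:
      "\<lbrakk>a \<in> carrier A; b \<in> carrier A; x \<in> carrier M\<rbrakk> \<Longrightarrow>
        (a \<oplus> b) \<odot>\<^bsub>M\<^esub> x = a \<odot>\<^bsub>M\<^esub> x \<oplus>\<^bsub>M\<^esub> b \<odot>\<^bsub>M\<^esub> x"
    and smult_r_distr:
      "\<lbrakk>a \<in> carrier A; x \<in> carrier M; y \<in> carrier M\<rbrakk> \<Longrightarrow>
        a \<odot>\<^bsub>M\<^esub> (x \<oplus>\<^bsub>M\<^esub> y) = a \<odot>\<^bsub>M\<^esub> x \<oplus>\<^bsub>M\<^esub> a \<odot>\<^bsub>M\<^esub> y"
    and smult_assoc1:
      "\<lbrakk>a \<in> carrier A; b \<in> carrier A; x \<in> carrier M\<rbrakk> \<Longrightarrow>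
        (a \<otimes> b) \<odot>\<^bsub>M\<^esub> x = a \<odot>\<^bsub>M\<^esub> (b \<odot>\<^bsub>M\<^esub> x)"
    and smult_one [simp]: "x \<in> carrier M \<Longrightarrow> \<one> \<odot>\<^bsub>M\<^esub> x = x"

definition left_module_isomorphic ::
    "('a, 'c) ring_scheme \<Rightarrow> ('a, 'm, 'd) module_scheme \<Rightarrow> ('a, 'n, 'e) module_scheme \<Rightarrow> bool"
  where "left_module_isomorphic A M N \<longleftrightarrow>
    (\<exists>\<phi>. bij_betw \<phi> (carrier M) (carrier N) \<and>
      (\<forall>x \<in> carrier M. \<forall>y \<in> carrier M. \<phi> (x \<oplus>\<^bsub>M\<^esub> y) = \<phi> x \<oplus>\<^bsub>N\<^esub> \<phi> y) \<and>
      (\<forall>a \<in> carrier A. \<forall>x \<in> carrier M. \<phi> (a \<odot>\<^bsub>M\<^esub> x) = a \<odot>\<^bsub>N\<^esub> \<phi> x))"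

definition simple_left_module :: "('a, 'c) ring_scheme \<Rightarrow> ('a, 'm, 'd) module_scheme \<Rightarrow> bool"
  where "simple_left_module A M \<longleftrightarrow>
    left_module A M \<and> carrier M \<noteq> {\<zero>\<^bsub>M\<^esub>} \<and>
    (\<forall>H. submodule H A M \<longrightarrow> H = {\<zero>\<^bsub>M\<^esub>} \<or> H = carrier M)"


section \<open>The weak generalized Weyl algebra\<close>

text \<open>
  The ring generated over \<open>R\<close> by \<open>X\<close> and \<open>Y\<close> is presented by the ring expressions in \<open>X\<close>, \<open>Y\<close>
  and coefficients from \<open>R\<close>, modulo the least congruence that contains the ring axioms, makes
  the coefficients multiply and add as in \<open>R\<close>, and contains the four defining relations.
\<close>

datatype (coeffs: 'r) wgwa_term =
    Coeff 'r
  | GenX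
  | GenY
  | Add "'r wgwa_term" "'r wgwa_term"
  | Mul "'r wgwa_term" "'r wgwa_term"

definition wgwa_terms :: "('r, 'a) ring_scheme \<Rightarrow> 'r wgwa_term set"
  where "wgwa_terms R = {u. coeffs u \<subseteq> carrier R}"

inductive_set wgwa_rel ::
    "('r, 'a) ring_scheme \<Rightarrow> ('r \<Rightarrow> 'r) \<Rightarrow> 'r \<Rightarrow> ('r wgwa_term \<times> 'r wgwa_term) set"
  for R \<sigma> t where
  refl: "u \<in> wgwa_terms R \<Longrightarrow> (u, u) \<in> wgwa_rel R \<sigma> t"
| sym: "(u, v) \<in> wgwa_rel R \<sigma> t \<Longrightarrow> (v, u) \<in> wgwa_rel R \<sigma> t"
| trans: "\<lbrakk>(u, v) \<in> wgwa_rel R \<sigma> t; (v, w) \<in> wgwa_rel R \<sigma> t\<rbrakk> \<Longrightarrow> (u, w) \<in> wgwa_rel R \<sigma> t"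
| add_cong: "\<lbrakk>(u, u') \<in> wgwa_rel R \<sigma> t; (v, v') \<in> wgwa_rel R \<sigma> t\<rbrakk> \<Longrightarrow>
    (Add u v, Add u' v') \<in> wgwa_rel R \<sigma> t"
| mul_cong: "\<lbrakk>(u, u') \<in> wgwa_rel R \<sigma> t; (v, v') \<in> wgwa_rel R \<sigma> t\<rbrakk> \<Longrightarrow>
    (Mul u v, Mul u' v') \<in> wgwa_rel R \<sigma> t"
| add_assoc: "\<lbrakk>u \<in> wgwa_terms R; v \<in> wgwa_terms R; w \<in> wgwa_terms R\<rbrakk> \<Longrightarrow>
    (Add (Add u v) w, Add u (Add v w)) \<in> wgwa_rel R \<sigma> t"
| add_comm: "\<lbrakk>u \<in> wgwa_terms R; v \<in> wgwa_terms R\<rbrakk> \<Longrightarrow> (Add u v, Add v u) \<in> wgwa_rel R \<sigma> t"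
| add_zero: "u \<in> wgwa_terms R \<Longrightarrow> (Add (Coeff \<zero>\<^bsub>R\<^esub>) u, u) \<in> wgwa_rel R \<sigma> t"
| add_neg: "u \<in> wgwa_terms R \<Longrightarrow>
    (Add (Mul (Coeff (\<ominus>\<^bsub>R\<^esub> \<one>\<^bsub>R\<^esub>)) u) u, Coeff \<zero>\<^bsub>R\<^esub>) \<in> wgwa_rel R \<sigma> t"
| mul_assoc: "\<lbrakk>u \<in> wgwa_terms R; v \<in> wgwa_terms R; w \<in> wgwa_terms R\<rbrakk> \<Longrightarrow>
    (Mul (Mul u v) w, Mul u (Mul v w)) \<in> wgwa_rel R \<sigma> t"
| one_mul: "u \<in> wgwa_terms R \<Longrightarrow> (Mul (Coeff \<one>\<^bsub>R\<^esub>) u, u) \<in> wgwa_rel R \<sigma> t"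
| mul_one: "u \<in> wgwa_terms R \<Longrightarrow> (Mul u (Coeff \<one>\<^bsub>R\<^esub>), u) \<in> wgwa_rel R \<sigma> t"
| distrib_right: "\<lbrakk>u \<in> wgwa_terms R; v \<in> wgwa_terms R; w \<in> wgwa_terms R\<rbrakk> \<Longrightarrow>
    (Mul (Add u v) w, Add (Mul u w) (Mul v w)) \<in> wgwa_rel R \<sigma> t"
| distrib_left: "\<lbrakk>u \<in> wgwa_terms R; v \<in> wgwa_terms R; w \<in> wgwa_terms R\<rbrakk> \<Longrightarrow>
    (Mul w (Add u v), Add (Mul w u) (Mul w v)) \<in> wgwa_rel R \<sigma> t"
| coeff_add: "\<lbrakk>r \<in> carrier R; s \<in> carrier R\<rbrakk> \<Longrightarrow>
    (Add (Coeff r) (Coeff s), Coeff (r \<oplus>\<^bsub>R\<^esub> s)) \<in> wgwa_rel R \<sigma> t"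
| coeff_mul: "\<lbrakk>r \<in> carrier R; s \<in> carrier R\<rbrakk> \<Longrightarrow>
    (Mul (Coeff r) (Coeff s), Coeff (r \<otimes>\<^bsub>R\<^esub> s)) \<in> wgwa_rel R \<sigma> t"
| YX: "(Mul GenY GenX, Coeff t) \<in> wgwa_rel R \<sigma> t"
| XY: "(Mul GenX GenY, Coeff (\<sigma> t)) \<in> wgwa_rel R \<sigma> t"
| Xr: "r \<in> carrier R \<Longrightarrow> (Mul GenX (Coeff r), Mul (Coeff (\<sigma> r)) GenX) \<in> wgwa_rel R \<sigma> t"
| rY: "r \<in> carrier R \<Longrightarrow> (Mul (Coeff r) GenY, Mul GenY (Coeff (\<sigma> r))) \<in> wgwa_rel R \<sigma> t"

definition wgwa_class ::
    "('r, 'a) ring_scheme \<Rightarrow> ('r \<Rightarrow> 'r) \<Rightarrow> 'r \<Rightarrow> 'r wgwa_term \<Rightarrow> 'r wgwa_term set"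
  where "wgwa_class R \<sigma> t u = wgwa_rel R \<sigma> t `` {u}"

text \<open>
  Here and below, \<^term>\<open>the_elem (f ` C)\<close> is the common value of \<open>f\<close> on the representatives of a
  class \<open>C\<close>.
\<close>

definition wgwa :: "('r, 'a) ring_scheme \<Rightarrow> ('r \<Rightarrow> 'r) \<Rightarrow> 'r \<Rightarrow> 'r wgwa_term set ring"
  where "wgwa R \<sigma> t =
    \<lparr>carrier = wgwa_terms R // wgwa_rel R \<sigma> t,
     mult = (\<lambda>a b. the_elem ((\<lambda>(u, v). wgwa_class R \<sigma> t (Mul u v)) ` (a \<times> b))),
     one = wgwa_class R \<sigma> t (Coeff \<one>\<^bsub>R\<^esub>),
     zero = wgwa_class R \<sigma> t (Coeff \<zero>\<^bsub>R\<^esub>),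
     add = (\<lambda>a b. the_elem ((\<lambda>(u, v). wgwa_class R \<sigma> t (Add u v)) ` (a \<times> b)))\<rparr>"

definition wgwa_coeff ::
    "('r, 'a) ring_scheme \<Rightarrow> ('r \<Rightarrow> 'r) \<Rightarrow> 'r \<Rightarrow> 'r \<Rightarrow> 'r wgwa_term set"
  where "wgwa_coeff R \<sigma> t r = wgwa_class R \<sigma> t (Coeff r)"

text \<open>
  The module given by an abelian group \<open>C\<close>, an action \<open>\<rho>\<close> of \<open>R\<close> and the operators \<open>x\<close>, \<open>y\<close> by
  which \<open>X\<close>, \<open>Y\<close> act.
\<close>

primrec wgwa_eval ::
    "('v \<Rightarrow> 'v \<Rightarrow> 'v) \<Rightarrow> ('r \<Rightarrow> 'v \<Rightarrow> 'v) \<Rightarrow> ('v \<Rightarrow> 'v) \<Rightarrow> ('v \<Rightarrow> 'v) \<Rightarrow> 'r wgwa_term \<Rightarrow> 'v \<Rightarrow> 'v"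
  where
  "wgwa_eval pl \<rho> x y (Coeff r) = \<rho> r"
| "wgwa_eval pl \<rho> x y GenX = x"
| "wgwa_eval pl \<rho> x y GenY = y"
| "wgwa_eval pl \<rho> x y (Add u w) = (\<lambda>v. pl (wgwa_eval pl \<rho> x y u v) (wgwa_eval pl \<rho> x y w v))"
| "wgwa_eval pl \<rho> x y (Mul u w) = (\<lambda>v. wgwa_eval pl \<rho> x y u (wgwa_eval pl \<rho> x y w v))"

definition wgwa_module ::
    "'v set \<Rightarrow> 'v \<Rightarrow> ('v \<Rightarrow> 'v \<Rightarrow> 'v) \<Rightarrow> ('r \<Rightarrow> 'v \<Rightarrow> 'v) \<Rightarrow> ('v \<Rightarrow> 'v) \<Rightarrow> ('v \<Rightarrow> 'v) \<Rightarrow>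
      ('r wgwa_term set, 'v) module"
  where "wgwa_module C z pl \<rho> x y =
    \<lparr>carrier = C, mult = undefined, one = undefined, zero = z, add = pl,
     smult = (\<lambda>a v. the_elem ((\<lambda>u. wgwa_eval pl \<rho> x y u v) ` a))\<rparr>"


section \<open>Weight modules\<close>

definition max_ideals :: "('r, 'a) ring_scheme \<Rightarrow> 'r set set"
  where "max_ideals R = {I. maximalideal I R}"

definition weight_space ::
    "('r, 'a) ring_scheme \<Rightarrow> ('r \<Rightarrow> 'r) \<Rightarrow> 'r \<Rightarrow> ('r wgwa_term set, 'm, 'd) module_scheme \<Rightarrow>
      'r set \<Rightarrow> 'm set"
  where "weight_space R \<sigma> t M I =
    {v \<in> carrier M. \<forall>r \<in> I. wgwa_coeff R \<sigma> t r \<odot>\<^bsub>M\<^esub> v = \<zero>\<^bsub>M\<^esub>}"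

definition weight_module ::
    "('r, 'a) ring_scheme \<Rightarrow> ('r \<Rightarrow> 'r) \<Rightarrow> 'r \<Rightarrow> ('r wgwa_term set, 'm, 'd) module_scheme \<Rightarrow> bool"
  where "weight_module R \<sigma> t M \<longleftrightarrow>
    left_module (wgwa R \<sigma> t) M \<and>
    (\<forall>v \<in> carrier M. \<exists>!u. u \<in> (\<Pi>\<^sub>E I \<in> max_ideals R. weight_space R \<sigma> t M I) \<and>
      finite {I \<in> max_ideals R. u I \<noteq> \<zero>\<^bsub>M\<^esub>} \<and>
      v = finsum M u {I \<in> max_ideals R. u I \<noteq> \<zero>\<^bsub>M\<^esub>})"

text \<open>
  The map below is the canonical map from \<open>\<sigma>(R) / (\<sigma>(R) \<inter> I)\<close> to \<open>R / I\<close>.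
\<close>

definition essential_endo :: "('r, 'a) ring_scheme \<Rightarrow> ('r \<Rightarrow> 'r) \<Rightarrow> bool"
  where "essential_endo R \<sigma> \<longleftrightarrow>
    (\<forall>I \<in> max_ideals R.
      (\<lambda>C. I <+>\<^bsub>R\<^esub> C) `
        carrier ((R\<lparr>carrier := \<sigma> ` carrier R\<rparr>) Quot (\<sigma> ` carrier R \<inter> I)) = carrier (R Quot I))"


section \<open>String modules\<close>

definition string_family ::
    "('r, 'a) ring_scheme \<Rightarrow> ('r \<Rightarrow> 'r) \<Rightarrow> 'r \<Rightarrow> int set \<Rightarrow> (int \<Rightarrow> 'r set) \<Rightarrow> bool"
  where "string_family R \<sigma> t I m \<longleftrightarrow>
    (\<forall>i \<in> I. m i \<in> max_ideals R) \<and>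
    (\<forall>i. i \<in> I \<and> i + 1 \<in> I \<longrightarrow> \<sigma> ` m i \<subseteq> m (i + 1)) \<and>
    (I = UNIV \<or>
     I = {0..} \<and> \<sigma> t \<in> m 0 \<or>
     I = {..0} \<and> t \<in> m 0 \<or>
     (\<exists>n \<ge> 0. I = {0..n} \<and> \<sigma> t \<in> m 0 \<and> t \<in> m n))"

text \<open>The components of \<open>X\<close> and \<open>Y\<close> between neighbouring residue fields of a string module.\<close>

definition string_X ::
    "('r, 'a) ring_scheme \<Rightarrow> ('r \<Rightarrow> 'r) \<Rightarrow> 'r \<Rightarrow> 'r set \<Rightarrow> 'r set \<Rightarrow> 'r set"
  where "string_X R \<sigma> t J C = the_elem ((\<lambda>r. J +>\<^bsub>R\<^esub> \<sigma> (t \<otimes>\<^bsub>R\<^esub> r)) ` C)"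

definition string_Y :: "('r, 'a) ring_scheme \<Rightarrow> ('r \<Rightarrow> 'r) \<Rightarrow> 'r set \<Rightarrow> 'r set \<Rightarrow> 'r set"
  where "string_Y R \<sigma> J C = the_elem ((\<lambda>s. J +>\<^bsub>R\<^esub> s) ` {s \<in> carrier R. \<sigma> s \<in> C})"

definition string_module ::
    "('r, 'a) ring_scheme \<Rightarrow> ('r \<Rightarrow> 'r) \<Rightarrow> 'r \<Rightarrow> int set \<Rightarrow> (int \<Rightarrow> 'r set) \<Rightarrow>
      ('r wgwa_term set, int \<Rightarrow> 'r set) module"
  where "string_module R \<sigma> t I m =
    wgwa_module
      {v \<in> (\<Pi>\<^sub>E i \<in> I. carrier (R Quot m i)). finite {i \<in> I. v i \<noteq> \<zero>\<^bsub>R Quot m i\<^esub>}}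
      (\<lambda>i \<in> I. \<zero>\<^bsub>R Quot m i\<^esub>)
      (\<lambda>v w. \<lambda>i \<in> I. v i \<oplus>\<^bsub>R Quot m i\<^esub> w i)
      (\<lambda>r v. \<lambda>i \<in> I. (m i +>\<^bsub>R\<^esub> r) \<otimes>\<^bsub>R Quot m i\<^esub> v i)
      (\<lambda>v. \<lambda>i \<in> I. if i - 1 \<in> I then string_X R \<sigma> t (m i) (v (i - 1)) else \<zero>\<^bsub>R Quot m i\<^esub>)
      (\<lambda>v. \<lambda>i \<in> I. if i + 1 \<in> I then string_Y R \<sigma> (m i) (v (i + 1)) else \<zero>\<^bsub>R Quot m i\<^esub>)"


section \<open>Skew Laurent polynomials\<close>

definition int_iter :: "('k, 'a) ring_scheme \<Rightarrow> ('k \<Rightarrow> 'k) \<Rightarrow> int \<Rightarrow> 'k \<Rightarrow> 'k"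
  where "int_iter K \<phi> n =
    (if 0 \<le> n then \<phi> ^^ nat n else (inv_into (carrier K) \<phi>) ^^ nat (- n))"

text \<open>
  A function \<open>f\<close> of finite support represents the sum of the \<open>f(i) \<alpha>\<^sup>i\<close>, with coefficients on
  the left, so that \<open>(c \<alpha>\<^sup>i) (d \<alpha>\<^sup>j) = c \<phi>\<^sup>i(d) \<alpha>\<^bsup>i+j\<^esup>\<close>.
\<close>

definition skew_laurent :: "('k, 'a) ring_scheme \<Rightarrow> ('k \<Rightarrow> 'k) \<Rightarrow> (int \<Rightarrow> 'k) ring"
  where "skew_laurent K \<phi> =
    \<lparr>carrier = {f. (\<forall>i. f i \<in> carrier K) \<and> finite {i. f i \<noteq> \<zero>\<^bsub>K\<^esub>}},
     mult = (\<lambda>f g. \<lambda>n. finsum K (\<lambda>i. f i \<otimes>\<^bsub>K\<^esub> int_iter K \<phi> i (g (n - i))) {i. f i \<noteq> \<zero>\<^bsub>K\<^esub>}),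
     one = (\<lambda>i. if i = 0 then \<one>\<^bsub>K\<^esub> else \<zero>\<^bsub>K\<^esub>),
     zero = (\<lambda>i. \<zero>\<^bsub>K\<^esub>),
     add = (\<lambda>f g. \<lambda>i. f i \<oplus>\<^bsub>K\<^esub> g i)\<rparr>"

definition skew_monom :: "('k, 'a) ring_scheme \<Rightarrow> 'k \<Rightarrow> int \<Rightarrow> int \<Rightarrow> 'k"
  where "skew_monom K c n = (\<lambda>i. if i = n then c else \<zero>\<^bsub>K\<^esub>)"

text \<open>
  The library notion \<open>ring_irreducible\<close> is made for commutative rings.
\<close>

definition irreducible_element :: "('p, 'a) ring_scheme \<Rightarrow> 'p \<Rightarrow> bool"
  where "irreducible_element P f \<longleftrightarrow>
    f \<in> carrier P \<and> f \<noteq> \<zero>\<^bsub>P\<^esub> \<and> f \<notin> Units P \<and>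
    (\<forall>g \<in> carrier P. \<forall>h \<in> carrier P. f = g \<otimes>\<^bsub>P\<^esub> h \<longrightarrow> g \<in> Units P \<or> h \<in> Units P)"

definition left_multiples :: "('p, 'a) ring_scheme \<Rightarrow> 'p \<Rightarrow> 'p set"
  where "left_multiples P f = (\<lambda>g. g \<otimes>\<^bsub>P\<^esub> f) ` carrier P"

definition left_quotient :: "('p, 'a) ring_scheme \<Rightarrow> 'p \<Rightarrow> ('p, 'p set) module"
  where "left_quotient P f =
    \<lparr>carrier = a_rcosets\<^bsub>P\<^esub> (left_multiples P f), mult = undefined, one = undefined,
     zero = left_multiples P f, add = set_add P,
     smult = (\<lambda>p C. the_elem ((\<lambda>g. left_multiples P f +>\<^bsub>P\<^esub> (p \<otimes>\<^bsub>P\<^esub> g)) ` C))\<rparr>"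


section \<open>Band modules\<close>

definition periodic_family ::
    "('r, 'a) ring_scheme \<Rightarrow> ('r \<Rightarrow> 'r) \<Rightarrow> 'r \<Rightarrow> (int \<Rightarrow> 'r set) \<Rightarrow> nat \<Rightarrow> bool"
  where "periodic_family R \<sigma> t m k \<longleftrightarrow>
    string_family R \<sigma> t UNIV m \<and>
    0 < k \<and> (\<forall>i. m (i + int k) = m i) \<and>
    (\<forall>l. 0 < l \<and> (\<forall>i. m (i + int l) = m i) \<longrightarrow> k \<le> l)"

text \<open>The map \<open>\<tau>\<^sub>i\<close>; on \<open>R / m\<^sub>0\<close> the formula gives the identity for \<open>i = 0\<close>.\<close>

definition band_tau ::
    "('r, 'a) ring_scheme \<Rightarrow> ('r \<Rightarrow> 'r) \<Rightarrow> (int \<Rightarrow> 'r set) \<Rightarrow> nat \<Rightarrow> 'r set \<Rightarrow> 'r set"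
  where "band_tau R \<sigma> m i C = the_elem ((\<lambda>r. m (int i) +>\<^bsub>R\<^esub> (\<sigma> ^^ i) r) ` C)"

definition band_ring ::
    "('r, 'a) ring_scheme \<Rightarrow> ('r \<Rightarrow> 'r) \<Rightarrow> (int \<Rightarrow> 'r set) \<Rightarrow> nat \<Rightarrow> (int \<Rightarrow> 'r set) ring"
  where "band_ring R \<sigma> m k = skew_laurent (R Quot m 0) (band_tau R \<sigma> m k)"

definition band_L ::
    "('r, 'a) ring_scheme \<Rightarrow> ('r \<Rightarrow> 'r) \<Rightarrow> (int \<Rightarrow> 'r set) \<Rightarrow> nat \<Rightarrow> (int \<Rightarrow> 'r set) \<Rightarrow>
      (int \<Rightarrow> 'r set, (int \<Rightarrow> 'r set) set) module"
  where "band_L R \<sigma> m k f = left_quotient (band_ring R \<sigma> m k) f"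

definition cyclic_shift :: "nat \<Rightarrow> ('l \<Rightarrow> 'l) \<Rightarrow> (nat \<Rightarrow> 'l) \<Rightarrow> nat \<Rightarrow> 'l"
  where "cyclic_shift k a v = (\<lambda>i \<in> {..<k}. if i = 0 then a (v (k - 1)) else v (i - 1))"

text \<open>
  Component \<open>i < k\<close> of a vector lies in the weight space of \<open>m\<^bsub>-i\<^esub>\<close> for the first kind of band
  module, and in that of \<open>m\<^sub>i\<close> for the second kind.
\<close>

definition band_module_M ::
    "('r, 'a) ring_scheme \<Rightarrow> ('r \<Rightarrow> 'r) \<Rightarrow> 'r \<Rightarrow> (int \<Rightarrow> 'r set) \<Rightarrow> nat \<Rightarrow> (int \<Rightarrow> 'r set) \<Rightarrow>
      ('r wgwa_term set, nat \<Rightarrow> (int \<Rightarrow> 'r set) set) module"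
  where "band_module_M R \<sigma> t m k f =
    (let K = R Quot m 0; L = band_L R \<sigma> m k f;
         V = (\<Pi>\<^sub>E i \<in> {..<k}. carrier L);
         \<rho> = (\<lambda>r v. \<lambda>i \<in> {..<k}. skew_monom K (m 0 +>\<^bsub>R\<^esub> (\<sigma> ^^ i) r) 0 \<odot>\<^bsub>L\<^esub> v i);
         y = cyclic_shift k (\<lambda>c. skew_monom K \<one>\<^bsub>K\<^esub> (-1) \<odot>\<^bsub>L\<^esub> c);
         x = (\<lambda>w. \<rho> (\<sigma> t) (inv_into V y w))
     in wgwa_module V (\<lambda>i \<in> {..<k}. \<zero>\<^bsub>L\<^esub>) (\<lambda>v w. \<lambda>i \<in> {..<k}. v i \<oplus>\<^bsub>L\<^esub> w i) \<rho> x y)"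

definition band_module_N ::
    "('r, 'a) ring_scheme \<Rightarrow> ('r \<Rightarrow> 'r) \<Rightarrow> 'r \<Rightarrow> (int \<Rightarrow> 'r set) \<Rightarrow> nat \<Rightarrow> (int \<Rightarrow> 'r set) \<Rightarrow>
      ('r wgwa_term set, nat \<Rightarrow> (int \<Rightarrow> 'r set) set) module"
  where "band_module_N R \<sigma> t m k f =
    (let K = R Quot m 0; L = band_L R \<sigma> m k f;
         V = (\<Pi>\<^sub>E i \<in> {..<k}. carrier L);
         \<rho> = (\<lambda>r v. \<lambda>i \<in> {..<k}.
               skew_monom K (inv_into (carrier K) (band_tau R \<sigma> m i) (m (int i) +>\<^bsub>R\<^esub> r)) 0
                 \<odot>\<^bsub>L\<^esub> v i);
         x = cyclic_shift k (\<lambda>c. skew_monom K \<one>\<^bsub>K\<^esub> 1 \<odot>\<^bsub>L\<^esub> c);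
         y = (\<lambda>w. \<rho> t (inv_into V x w))
     in wgwa_module V (\<lambda>i \<in> {..<k}. \<zero>\<^bsub>L\<^esub>) (\<lambda>v w. \<lambda>i \<in> {..<k}. v i \<oplus>\<^bsub>L\<^esub> w i) \<rho> x y)"

end

theory Submission
  imports Defs
begin

text \<open>
  For a maximal ideal \<open>p\<close> the preimage \<open>pred p\<close> under \<open>\<sigma>\<close> is again maximal, because \<open>\<sigma>\<close>
  is essential; \<open>Y\<close> maps the weight space of \<open>p\<close> to that of \<open>pred p\<close>, and \<open>X\<close> maps it to the
  sum of the weight spaces of all \<open>q\<close> with \<open>pred q = p\<close>.  Let \<open>M\<close> be a simple weight module.

  If \<open>X u = 0\<close> for some weight vector \<open>u \<noteq> 0\<close>, then \<open>M\<close> is spanned by the \<open>R Y\<^sup>n u\<close>.  It is a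
  bounded string if some \<open>Y\<^sup>n u\<close> vanishes, a left infinite string if none vanishes and the weight
  of \<open>u\<close> is not periodic under \<open>pred\<close>, and otherwise \<open>Y\<close> is bijective and \<open>M\<close> is a band \<open>M\<^sup>f\<close>.

  Now let \<open>X\<close> be injective on weight spaces.  If a weight \<open>p\<close> of \<open>M\<close> is not periodic, then every
  vector of weight \<open>p\<close> is \<open>Y w\<close> for a weight vector \<open>w\<close>, again of nonperiodic weight.  Iterating
  this, and applying powers of \<open>Y\<close>, yields a right infinite or a double infinite string.  If all
  weights are periodic, they form a single cycle, \<open>X\<close> is bijective, and \<open>M\<close> is a band \<open>N\<^sup>f\<close>.

  In the band cases the weight space at one point of the cycle is a simple module over the skew
  Laurent polynomial ring \<open>P\<close>.  It is \<open>P / P f\<close> for an irreducible \<open>f\<close>, since by division with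
  remainder the annihilator of a vector is principal.
\<close>

section \<open>Integer iterates of a bijection\<close>

text \<open>The obstacle is that \<sigma> need not be surjective, so \<open>pred\<close> need not be
  injective. Several maximal ideals may lie above one p, and X may spread a weight vector over all
  of them, while Y always leads to a single weight. An orbit of \<open>pred\<close> that never
  returns to its start can still run into a cycle further down, so the weights along a string may
  repeat. Independence of the vectors of a string can therefore not be read off from their weights.
  It comes from an operator that kills all but one of finitely many vectors: a power of Y for
  bounded strings, a power of X for left infinite ones, and a power of X followed by a weight
  projection for the other two kinds.

  Simplicity of M is exploited through explicit spanning sets: a set of weight vectors that is
  stable under R, and whose images under X and Y are sums of its members, spans M, and a projection
  then reads off each weight space.\<close>

lemma int_iter_zero [simp]: "int_iter K \<phi> 0 a = a"
  by (simp add: int_iter_def)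

lemma int_iter_one [simp]: "int_iter K \<phi> 1 = \<phi>"
  by (simp add: int_iter_def)

lemma int_iter_minus_one: "int_iter K \<phi> (- 1) = inv_into (carrier K) \<phi>"
  by (simp add: int_iter_def)

context
  fixes K :: "('k, 'a) ring_scheme" and \<phi> :: "'k \<Rightarrow> 'k"
  assumes bij: "bij_betw \<phi> (carrier K) (carrier K)"
begin

lemma int_iter_step:
  assumes "a \<in> carrier K"
  shows "int_iter K \<phi> n a \<in> carrier K \<and> int_iter K \<phi> (n + 1) a = \<phi> (int_iter K \<phi> n a)"
proof -
  let ?\<psi> = "inv_into (carrier K) \<phi>"
  have pos: "(\<phi> ^^ j) a \<in> carrier K" for j
    by (induction j) (use assms bij in \<open>auto simp: bij_betw_def\<close>)
  have neg: "(?\<psi> ^^ j) a \<in> carrier K" for j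
    by (induction j) (use assms bij in \<open>auto simp: bij_betw_def inv_into_into\<close>)
  \<comment> \<open>The definition switches from powers of the inverse to powers of \<phi> between
    -1 and 0, so the step from n to n + 1 is checked separately on the two sides.\<close>
  consider (ge) "n \<ge> 0" | (lt) j where "n = - 1 - int j"
    by (cases n rule: int_cases) auto
  then show ?thesis
  proof cases
    case ge
    then show ?thesis
      using pos by (simp add: int_iter_def nat_add_distrib)
  next
    case lt
    have "nat (- n) = Suc j" "nat (- (n + 1)) = j" "\<not> 0 \<le> n"
      using lt by auto
    moreover have "\<phi> (?\<psi> ((?\<psi> ^^ j) a)) = (?\<psi> ^^ j) a"
      using bij neg by (simp add: bij_betw_inv_into_right)
    ultimately show ?thesis
      using neg[of "Suc j"] by (cases "0 \<le> n + 1") (auto simp: int_iter_def lt)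
  qed
qed

lemma int_iter_closed [simp]: "a \<in> carrier K \<Longrightarrow> int_iter K \<phi> n a \<in> carrier K"
  using int_iter_step by blast

lemma int_iter_add:
  assumes "a \<in> carrier K"
  shows "int_iter K \<phi> (m + n) a = int_iter K \<phi> m (int_iter K \<phi> n a)"
proof (induction m rule: int_induct[where k = 0])
  case (step1 i)
  then show ?case
    using int_iter_step[of a "i + n"] int_iter_step[of "int_iter K \<phi> n a" i] assms
    by (simp add: algebra_simps)
next
  case (step2 i)
  \<comment> \<open>\<open>int_iter_step\<close> only raises the exponent; the downward step
    therefore compares images under \<phi> and cancels \<phi> by injectivity.\<close>
  have "\<phi> (int_iter K \<phi> (i - 1 + n) a) = \<phi> (int_iter K \<phi> (i - 1) (int_iter K \<phi> n a))"
    using step2 int_iter_step[of a "i - 1 + n"] int_iter_step[of "int_iter K \<phi> n a" "i - 1"] assms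
    by (simp add: algebra_simps)
  then show ?case
    using bij assms by (metis bij_betw_def inj_onD int_iter_closed)
qed (simp add: assms)

lemma int_iter_cancel [simp]:
  assumes "a \<in> carrier K"
  shows "int_iter K \<phi> n (int_iter K \<phi> (- n) a) = a" "int_iter K \<phi> (- n) (int_iter K \<phi> n a) = a"
  using int_iter_add[OF assms, of n "- n"] int_iter_add[OF assms, of "- n" n] by simp_all

text \<open>Stated for an arbitrary operation \<open>pl\<close> so that it covers both operations of
  the field and the addition of a module.\<close>

lemma int_iter_hom:
  assumes closed: "\<And>a b. a \<in> carrier K \<Longrightarrow> b \<in> carrier K \<Longrightarrow> pl a b \<in> carrier K"
    and hom: "\<And>a b. a \<in> carrier K \<Longrightarrow> b \<in> carrier K \<Longrightarrow> \<phi> (pl a b) = pl (\<phi> a) (\<phi> b)"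
    and ab: "a \<in> carrier K" "b \<in> carrier K"
  shows "int_iter K \<phi> n (pl a b) = pl (int_iter K \<phi> n a) (int_iter K \<phi> n b)"
proof (induction n rule: int_induct[where k = 0])
  case (step1 i)
  then show ?case
    using int_iter_step[of _ i] ab closed hom by simp
next
  case (step2 i)
  have "\<phi> (int_iter K \<phi> (i - 1) (pl a b)) = \<phi> (pl (int_iter K \<phi> (i - 1) a) (int_iter K \<phi> (i - 1) b))"
    using step2 int_iter_step[of _ "i - 1"] ab closed hom by simp
  then show ?case
    using bij ab closed by (metis bij_betw_def inj_onD int_iter_closed)
qed simp

end


section \<open>The skew Laurent polynomial ring\<close>

lemma (in abelian_monoid) finsum_single:
  assumes "finite A" "a \<in> A" "f \<in> A \<rightarrow> carrier G" "\<And>i. i \<in> A \<Longrightarrow> i \<noteq> a \<Longrightarrow> f i = \<zero>"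
  shows "finsum G f A = f a"
proof -
  have "finsum G f A = finsum G f {a}"
    by (rule add.finprod_mono_neutral_cong_right) (use assms in auto)
  then show ?thesis
    using assms by (auto simp: Pi_iff)
qed

lemma (in abelian_monoid) finsum_superset:
  assumes "finite B" "A \<subseteq> B" "f \<in> B \<rightarrow> carrier G" "\<And>i. i \<in> B - A \<Longrightarrow> f i = \<zero>"
  shows "finsum G f A = finsum G f B"
  by (rule add.finprod_mono_neutral_cong_left) (use assms in auto)

text \<open>Infinite A is included: both sums are then zero by convention, and \<open>h\<close>
  preserves zero.\<close>

lemma (in abelian_monoid) finsum_additive:
  assumes G': "abelian_monoid G'"
    and "h \<in> carrier G \<rightarrow> carrier G'" "h \<zero> = \<zero>\<^bsub>G'\<^esub>"
    and "\<And>x y. x \<in> carrier G \<Longrightarrow> y \<in> carrier G \<Longrightarrow> h (x \<oplus> y) = h x \<oplus>\<^bsub>G'\<^esub> h y"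
    and "f \<in> A \<rightarrow> carrier G"
  shows "h (finsum G f A) = finsum G' (\<lambda>i. h (f i)) A"
proof -
  interpret G': abelian_monoid G' by fact
  show ?thesis
    using assms(5)
  proof (induction A rule: infinite_finite_induct)
    case (insert x F)
    then have "(\<lambda>i. h (f i)) \<in> F \<rightarrow> carrier G'"
      using assms(2) by (auto simp: Pi_iff)
    with insert show ?case
      using assms(2,4) by (auto simp: Pi_iff)
  qed (simp_all add: assms(3))
qed

text \<open>Despite the name, K is a commutative field; what is skew is the polynomial ring P
  twisted by its automorphism \<phi>.\<close>

locale skew_field = K?: field K for K :: "('k, 'a) ring_scheme" (structure) +
  fixes \<phi> :: "'k \<Rightarrow> 'k"
  assumes \<phi>_hom: "\<phi> \<in> ring_hom K K"
    and \<phi>_bij: "bij_betw \<phi> (carrier K) (carrier K)"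
begin

abbreviation "P \<equiv> skew_laurent K \<phi>"
abbreviation "pw \<equiv> int_iter K \<phi>"
abbreviation supp :: "(int \<Rightarrow> 'k) \<Rightarrow> int set" where "supp f \<equiv> {i. f i \<noteq> \<zero>}"

lemmas pw_closed [simp] = int_iter_closed[OF \<phi>_bij]
lemmas pw_pw = int_iter_add[OF \<phi>_bij]
lemmas pw_cancel [simp] = int_iter_cancel[OF \<phi>_bij]

lemma pw_plus: "a \<in> carrier K \<Longrightarrow> b \<in> carrier K \<Longrightarrow> pw n (a \<oplus> b) = pw n a \<oplus> pw n b"
  by (rule int_iter_hom[OF \<phi>_bij]) (auto simp: ring_hom_add[OF \<phi>_hom])

lemma pw_times: "a \<in> carrier K \<Longrightarrow> b \<in> carrier K \<Longrightarrow> pw n (a \<otimes> b) = pw n a \<otimes> pw n b"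
  by (rule int_iter_hom[OF \<phi>_bij]) (auto simp: ring_hom_mult[OF \<phi>_hom])

lemma pw_zero [simp]: "pw n \<zero> = \<zero>"
  by (metis pw_plus l_zero local.add.r_cancel_one' pw_closed zero_closed)

lemma pw_eq_zero_iff [simp]: "a \<in> carrier K \<Longrightarrow> pw n a = \<zero> \<longleftrightarrow> a = \<zero>"
  by (metis pw_cancel(2) pw_zero)

lemma pw_one [simp]: "pw n \<one> = \<one>"
proof -
  have "pw n \<one> \<otimes> pw n \<one> = \<one> \<otimes> pw n \<one>"
    using pw_times[of \<one> \<one> n] by simp
  then show ?thesis
    by (subst (asm) m_rcancel) auto
qed

lemma P_carrier: "f \<in> carrier P \<longleftrightarrow> (\<forall>i. f i \<in> carrier K) \<and> finite (supp f)"
  by (simp add: skew_laurent_def)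

lemma P_add: "(f \<oplus>\<^bsub>P\<^esub> g) i = f i \<oplus> g i"
  and P_zero: "\<zero>\<^bsub>P\<^esub> i = \<zero>"
  and P_one: "\<one>\<^bsub>P\<^esub> = skew_monom K \<one> 0"
  by (simp_all add: skew_laurent_def skew_monom_def)

lemma P_memI: "(\<And>i. f i \<in> carrier K) \<Longrightarrow> finite (supp f) \<Longrightarrow> f \<in> carrier P"
  by (simp add: P_carrier)

lemma coeff_closed [simp]: "f \<in> carrier P \<Longrightarrow> f i \<in> carrier K"
  and finite_supp [simp]: "f \<in> carrier P \<Longrightarrow> finite (supp f)"
  by (simp_all only: P_carrier)

lemma P_zero_iff: "f = \<zero>\<^bsub>P\<^esub> \<longleftrightarrow> supp f = {}"
  by (auto simp: P_zero fun_eq_iff)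

text \<open>Letting the sum run over any finite set containing the support puts several products
  over one common index set, as distributivity requires.\<close>

lemma P_mult:
  assumes "f \<in> carrier P" "g \<in> carrier P" "finite A" "supp f \<subseteq> A"
  shows "(f \<otimes>\<^bsub>P\<^esub> g) n = (\<Oplus>i\<in>A. f i \<otimes> pw i (g (n - i)))"
proof -
  have "(f \<otimes>\<^bsub>P\<^esub> g) n = (\<Oplus>i\<in>supp f. f i \<otimes> pw i (g (n - i)))"
    by (simp add: skew_laurent_def del: coeff_closed finite_supp)
  also have "\<dots> = (\<Oplus>i\<in>A. f i \<otimes> pw i (g (n - i)))"
    by (rule finsum_superset) (use assms in auto)
  finally show ?thesis .
qed

lemma P_add_closed:
  assumes "f \<in> carrier P" "g \<in> carrier P"
  shows "f \<oplus>\<^bsub>P\<^esub> g \<in> carrier P"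
proof -
  have "supp (f \<oplus>\<^bsub>P\<^esub> g) \<subseteq> supp f \<union> supp g"
    using assms by (auto simp: P_add)
  then have "finite (supp (f \<oplus>\<^bsub>P\<^esub> g))"
    by (rule finite_subset) (use assms in simp)
  then show ?thesis
    by (rule P_memI[rotated]) (use assms in \<open>simp add: P_add\<close>)
qed

lemma P_mult_closed:
  assumes "f \<in> carrier P" "g \<in> carrier P"
  shows "f \<otimes>\<^bsub>P\<^esub> g \<in> carrier P"
proof -
  have closed: "(f \<otimes>\<^bsub>P\<^esub> g) n \<in> carrier K" for n
    using assms by (subst P_mult[OF assms, of "supp f"]) (auto intro!: finsum_closed)
  have "n \<in> (\<lambda>(i, j). i + j) ` (supp f \<times> supp g)" if "(f \<otimes>\<^bsub>P\<^esub> g) n \<noteq> \<zero>" for n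
  proof -
    have "\<exists>i \<in> supp f. g (n - i) \<noteq> \<zero>"
    proof (rule ccontr)
      assume "\<not> ?thesis"
      then have "(f \<otimes>\<^bsub>P\<^esub> g) n = \<zero>"
        using assms P_mult[OF assms, of "supp f" n] by (auto intro!: add.finprod_one_eqI)
      then show False
        using that by simp
    qed
    then obtain i where "i \<in> supp f" "g (n - i) \<noteq> \<zero>" by blast
    then show ?thesis
      by (intro image_eqI[of _ _ "(i, n - i)"]) auto
  qed
  then have "supp (f \<otimes>\<^bsub>P\<^esub> g) \<subseteq> (\<lambda>(i, j). i + j) ` (supp f \<times> supp g)"
    by blast
  then have "finite (supp (f \<otimes>\<^bsub>P\<^esub> g))"
    by (rule finite_subset) (use assms in simp)
  then show ?thesis
    using closed by (rule P_memI[rotated])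
qed

lemma monom_closed [simp]: "c \<in> carrier K \<Longrightarrow> skew_monom K c d \<in> carrier P"
  by (rule P_memI) (auto simp: skew_monom_def intro: finite_subset[of _ "{d}"])

lemma monom_mult:
  assumes "c \<in> carrier K" "g \<in> carrier P"
  shows "(skew_monom K c d \<otimes>\<^bsub>P\<^esub> g) n = c \<otimes> pw d (g (n - d))"
  using assms
  by (subst P_mult[OF monom_closed, of _ _ "{d}"]) (auto simp: skew_monom_def)

text \<open>Splitting off one coefficient shrinks the support. Identities that are additive in the
  left factor thereby reduce to monomials.\<close>

lemma P_induct [consumes 1, case_names zero add]:
  assumes "f \<in> carrier P"
    and "Q \<zero>\<^bsub>P\<^esub>"
    and "\<And>c d g. \<lbrakk>c \<in> carrier K; g \<in> carrier P; Q g\<rbrakk> \<Longrightarrow> Q (skew_monom K c d \<oplus>\<^bsub>P\<^esub> g)"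
  shows "Q f"
  using assms(1)
proof (induction "card (supp f)" arbitrary: f rule: less_induct)
  case less
  show ?case
  proof (cases "f = \<zero>\<^bsub>P\<^esub>")
    case False
    then obtain d where d: "d \<in> supp f"
      using P_zero_iff by blast
    let ?g = "f(d := \<zero>)"
    have supp: "supp ?g = supp f - {d}"
      by auto
    have g: "?g \<in> carrier P"
      by (rule P_memI, simp add: less.prems) (use less.prems in \<open>simp add: supp del: fun_upd_apply\<close>)
    have "card (supp ?g) < card (supp f)"
      unfolding supp using d less.prems by (intro card_Diff1_less) auto
    then have "Q (skew_monom K (f d) d \<oplus>\<^bsub>P\<^esub> ?g)"
      using less g by (intro assms(3)) auto
    also have "skew_monom K (f d) d \<oplus>\<^bsub>P\<^esub> ?g = f"
      using less.prems by (auto simp: fun_eq_iff P_add skew_monom_def)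
    finally show ?thesis .
  qed (use assms(2) in simp)
qed

lemma P_l_distr:
  assumes "f \<in> carrier P" "g \<in> carrier P" "h \<in> carrier P"
  shows "(f \<oplus>\<^bsub>P\<^esub> g) \<otimes>\<^bsub>P\<^esub> h = f \<otimes>\<^bsub>P\<^esub> h \<oplus>\<^bsub>P\<^esub> g \<otimes>\<^bsub>P\<^esub> h"
proof
  fix n
  let ?A = "supp f \<union> supp g"
  have A: "finite ?A" "supp (f \<oplus>\<^bsub>P\<^esub> g) \<subseteq> ?A"
    using assms by (auto simp: P_add)
  have "((f \<oplus>\<^bsub>P\<^esub> g) \<otimes>\<^bsub>P\<^esub> h) n =
      (\<Oplus>i\<in>?A. f i \<otimes> pw i (h (n - i)) \<oplus> g i \<otimes> pw i (h (n - i)))"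
    using assms A
    by (subst P_mult[OF P_add_closed, of _ _ _ ?A]) (auto simp: P_add l_distr intro!: finsum_cong')
  also have "\<dots> = (f \<otimes>\<^bsub>P\<^esub> h \<oplus>\<^bsub>P\<^esub> g \<otimes>\<^bsub>P\<^esub> h) n"
    unfolding P_add using assms A
    by (subst (1 2) P_mult[of _ _ ?A]) (auto intro!: finsum_addf)
  finally show "((f \<oplus>\<^bsub>P\<^esub> g) \<otimes>\<^bsub>P\<^esub> h) n = (f \<otimes>\<^bsub>P\<^esub> h \<oplus>\<^bsub>P\<^esub> g \<otimes>\<^bsub>P\<^esub> h) n" .
qed

lemma P_r_distr:
  assumes "f \<in> carrier P" "g \<in> carrier P" "h \<in> carrier P"
  shows "h \<otimes>\<^bsub>P\<^esub> (f \<oplus>\<^bsub>P\<^esub> g) = h \<otimes>\<^bsub>P\<^esub> f \<oplus>\<^bsub>P\<^esub> h \<otimes>\<^bsub>P\<^esub> g"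
proof
  fix n
  have "(h \<otimes>\<^bsub>P\<^esub> (f \<oplus>\<^bsub>P\<^esub> g)) n =
      (\<Oplus>i\<in>supp h. h i \<otimes> pw i (f (n - i)) \<oplus> h i \<otimes> pw i (g (n - i)))"
    using assms
    by (subst P_mult[OF _ P_add_closed, of _ _ _ "supp h"])
      (auto simp: P_add pw_plus r_distr intro!: finsum_cong')
  also have "\<dots> = (h \<otimes>\<^bsub>P\<^esub> f \<oplus>\<^bsub>P\<^esub> h \<otimes>\<^bsub>P\<^esub> g) n"
    unfolding P_add using assms
    by (subst (1 2) P_mult[of _ _ "supp h"]) (auto intro!: finsum_addf)
  finally show "(h \<otimes>\<^bsub>P\<^esub> (f \<oplus>\<^bsub>P\<^esub> g)) n = (h \<otimes>\<^bsub>P\<^esub> f \<oplus>\<^bsub>P\<^esub> h \<otimes>\<^bsub>P\<^esub> g) n" .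
qed

lemma pw_finsum:
  assumes "f \<in> A \<rightarrow> carrier K"
  shows "pw d (finsum K f A) = (\<Oplus>i\<in>A. pw d (f i))"
  by (rule finsum_additive[OF K.abelian_monoid_axioms]) (use assms in \<open>auto simp: pw_plus\<close>)

text \<open>This is where the twist enters associativity: \<open>pw d\<close> is multiplicative and
  \<open>pw (d + i)\<close> is \<open>pw d\<close> after \<open>pw i\<close>, so \<open>pw d\<close>
  can be pulled out of the whole convolution.\<close>

lemma monom_mult_assoc:
  assumes "c \<in> carrier K" "g \<in> carrier P" "h \<in> carrier P"
  shows "(skew_monom K c d \<otimes>\<^bsub>P\<^esub> g) \<otimes>\<^bsub>P\<^esub> h = skew_monom K c d \<otimes>\<^bsub>P\<^esub> (g \<otimes>\<^bsub>P\<^esub> h)"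
proof
  fix n
  let ?A = "(+) d ` supp g"
  have mg: "skew_monom K c d \<otimes>\<^bsub>P\<^esub> g \<in> carrier P"
    using assms by (simp add: P_mult_closed)
  have A: "finite ?A" "supp (skew_monom K c d \<otimes>\<^bsub>P\<^esub> g) \<subseteq> ?A"
  proof -
    show "supp (skew_monom K c d \<otimes>\<^bsub>P\<^esub> g) \<subseteq> ?A"
    proof
      fix i assume "i \<in> supp (skew_monom K c d \<otimes>\<^bsub>P\<^esub> g)"
      then have "g (i - d) \<noteq> \<zero>"
        using assms by (auto simp: monom_mult)
      then show "i \<in> ?A"
        by (intro image_eqI[of _ _ "i - d"]) auto
    qed
  qed (use assms in simp)
  have "((skew_monom K c d \<otimes>\<^bsub>P\<^esub> g) \<otimes>\<^bsub>P\<^esub> h) n =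
      (\<Oplus>i\<in>?A. c \<otimes> pw d (g (i - d)) \<otimes> pw i (h (n - i)))"
    using assms mg A by (subst P_mult[of _ _ ?A]) (auto simp: monom_mult)
  also have "\<dots> = (\<Oplus>i\<in>supp g. c \<otimes> pw d (g i) \<otimes> pw (d + i) (h (n - (d + i))))"
    using assms by (subst finsum_reindex) auto
  also have "\<dots> = (\<Oplus>i\<in>supp g. c \<otimes> pw d (g i \<otimes> pw i (h (n - d - i))))"
    using assms by (intro finsum_cong') (auto simp: pw_times pw_pw m_assoc diff_diff_eq)
  also have "\<dots> = c \<otimes> pw d (\<Oplus>i\<in>supp g. g i \<otimes> pw i (h (n - d - i)))"
    using assms by (subst pw_finsum) (auto simp: finsum_rdistr)
  also have "\<dots> = (skew_monom K c d \<otimes>\<^bsub>P\<^esub> (g \<otimes>\<^bsub>P\<^esub> h)) n"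
    using assms by (simp add: monom_mult P_mult_closed P_mult[of g h "supp g"])
  finally show "((skew_monom K c d \<otimes>\<^bsub>P\<^esub> g) \<otimes>\<^bsub>P\<^esub> h) n =
      (skew_monom K c d \<otimes>\<^bsub>P\<^esub> (g \<otimes>\<^bsub>P\<^esub> h)) n" .
qed

lemma P_zero_closed: "\<zero>\<^bsub>P\<^esub> \<in> carrier P"
  by (rule P_memI) (auto simp: P_zero)

lemma P_zero_mult: "g \<in> carrier P \<Longrightarrow> \<zero>\<^bsub>P\<^esub> \<otimes>\<^bsub>P\<^esub> g = \<zero>\<^bsub>P\<^esub>"
  by (auto simp: fun_eq_iff P_zero P_mult[of _ _ "{}"] P_zero_closed)

lemma P_assoc:
  assumes "f \<in> carrier P" "g \<in> carrier P" "h \<in> carrier P"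
  shows "(f \<otimes>\<^bsub>P\<^esub> g) \<otimes>\<^bsub>P\<^esub> h = f \<otimes>\<^bsub>P\<^esub> (g \<otimes>\<^bsub>P\<^esub> h)"
  using assms(1)
proof (induction f rule: P_induct)
  case zero
  show ?case
    using assms by (simp add: P_zero_mult P_mult_closed)
next
  case (add c d f)
  then show ?case
    using assms by (simp add: P_l_distr P_mult_closed monom_mult_assoc)
qed

lemma ring_P: "ring P"
proof (rule ringI)
  show "abelian_group P"
  proof (rule abelian_groupI)
    fix f assume f: "f \<in> carrier P"
    then have supp: "supp (\<lambda>i. \<ominus> f i) = supp f"
      using local.minus_equality by fastforce
    have "(\<lambda>i. \<ominus> f i) \<in> carrier P"
      by (rule P_memI) (use f in \<open>simp_all add: supp\<close>)
    moreover have "(\<lambda>i. \<ominus> f i) \<oplus>\<^bsub>P\<^esub> f = \<zero>\<^bsub>P\<^esub>"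
      using f by (auto simp: fun_eq_iff P_add P_zero l_neg)
    ultimately show "\<exists>g\<in>carrier P. g \<oplus>\<^bsub>P\<^esub> f = \<zero>\<^bsub>P\<^esub>" by blast
  qed (auto simp: P_add_closed P_zero_closed fun_eq_iff P_add P_zero a_assoc a_comm a_lcomm)
  show "Group.monoid P"
  proof (rule monoidI)
    fix f assume f: "f \<in> carrier P"
    then show "\<one>\<^bsub>P\<^esub> \<otimes>\<^bsub>P\<^esub> f = f"
      by (auto simp: fun_eq_iff P_one monom_mult)
    show "f \<otimes>\<^bsub>P\<^esub> \<one>\<^bsub>P\<^esub> = f"
    proof
      fix n
      \<comment> \<open>The index n is inserted because f may vanish there, while
        \<open>finsum_single\<close> wants the one surviving index to belong to the set.\<close>
      have "(f \<otimes>\<^bsub>P\<^esub> skew_monom K \<one> 0) n =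
          (\<Oplus>i\<in>insert n (supp f). f i \<otimes> pw i (skew_monom K \<one> 0 (n - i)))"
        using f by (intro P_mult) auto
      also have "\<dots> = f n \<otimes> pw n (skew_monom K \<one> 0 (n - n))"
        using f by (intro finsum_single) (auto simp: skew_monom_def)
      finally have "(f \<otimes>\<^bsub>P\<^esub> \<one>\<^bsub>P\<^esub>) n = f n \<otimes> pw n (skew_monom K \<one> 0 (n - n))"
        by (simp add: P_one)
      then show "(f \<otimes>\<^bsub>P\<^esub> \<one>\<^bsub>P\<^esub>) n = f n"
        using f by (simp add: skew_monom_def)
    qed
  qed (auto simp: P_mult_closed P_assoc P_one)
qed (auto simp: P_l_distr P_r_distr)

sublocale P: ring P by (rule ring_P)

section \<open>Degrees and units of the skew Laurent ring\<close>

definition hi :: "(int \<Rightarrow> 'k) \<Rightarrow> int" where "hi f = Max (supp f)"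
definition lo :: "(int \<Rightarrow> 'k) \<Rightarrow> int" where "lo f = Min (supp f)"

lemma supp_bounds:
  assumes "f \<in> carrier P" "f i \<noteq> \<zero>"
  shows "lo f \<le> i" "i \<le> hi f"
  using assms by (auto simp: lo_def hi_def)

text \<open>For the zero polynomial \<open>hi\<close> and \<open>lo\<close> are the unspecified
  values \<open>Max {}\<close> and \<open>Min {}\<close>, which is why nonzero hypotheses accompany
  them throughout.\<close>

lemma
  assumes "f \<in> carrier P" "f \<noteq> \<zero>\<^bsub>P\<^esub>"
  shows coeff_hi: "f (hi f) \<noteq> \<zero>" and coeff_lo: "f (lo f) \<noteq> \<zero>"
proof -
  have "supp f \<noteq> {}" using assms P_zero_iff by blast
  then show "f (hi f) \<noteq> \<zero>" "f (lo f) \<noteq> \<zero>"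
    using Max_in[of "supp f"] Min_in[of "supp f"] assms by (auto simp: hi_def lo_def)
qed

lemma lo_le_hi: "f \<in> carrier P \<Longrightarrow> f \<noteq> \<zero>\<^bsub>P\<^esub> \<Longrightarrow> lo f \<le> hi f"
  using coeff_hi supp_bounds(1) by blast

context
  fixes f g
  assumes fg: "f \<in> carrier P" "f \<noteq> \<zero>\<^bsub>P\<^esub>" "g \<in> carrier P" "g \<noteq> \<zero>\<^bsub>P\<^esub>"
begin

lemma mult_coeff_hi: "(f \<otimes>\<^bsub>P\<^esub> g) (hi f + hi g) = f (hi f) \<otimes> pw (hi f) (g (hi g))"
proof -
  have "f i \<otimes> pw i (g (hi f + hi g - i)) = \<zero>" if "i \<in> supp f" "i \<noteq> hi f" for i
    using supp_bounds(2)[of f i] supp_bounds(2)[of g "hi f + hi g - i"] that fg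
    by (cases "g (hi f + hi g - i) = \<zero>") auto
  then have "(\<Oplus>i\<in>supp f. f i \<otimes> pw i (g (hi f + hi g - i))) =
      f (hi f) \<otimes> pw (hi f) (g (hi f + hi g - hi f))"
    using fg coeff_hi[of f] by (intro finsum_single) auto
  moreover have "(f \<otimes>\<^bsub>P\<^esub> g) (hi f + hi g) = (\<Oplus>i\<in>supp f. f i \<otimes> pw i (g (hi f + hi g - i)))"
    using fg by (intro P_mult) auto
  ultimately show ?thesis
    by simp
qed

lemma mult_coeff_lo: "(f \<otimes>\<^bsub>P\<^esub> g) (lo f + lo g) = f (lo f) \<otimes> pw (lo f) (g (lo g))"
proof -
  have "f i \<otimes> pw i (g (lo f + lo g - i)) = \<zero>" if "i \<in> supp f" "i \<noteq> lo f" for i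
    using supp_bounds(1)[of f i] supp_bounds(1)[of g "lo f + lo g - i"] that fg
    by (cases "g (lo f + lo g - i) = \<zero>") auto
  then have "(\<Oplus>i\<in>supp f. f i \<otimes> pw i (g (lo f + lo g - i))) =
      f (lo f) \<otimes> pw (lo f) (g (lo f + lo g - lo f))"
    using fg coeff_lo[of f] by (intro finsum_single) auto
  moreover have "(f \<otimes>\<^bsub>P\<^esub> g) (lo f + lo g) = (\<Oplus>i\<in>supp f. f i \<otimes> pw i (g (lo f + lo g - i)))"
    using fg by (intro P_mult) auto
  ultimately show ?thesis
    by simp
qed

text \<open>Each extreme coefficient of a product is a single product of two nonzero field elements,
  one of them moved by an automorphism. Hence P has no zero divisors, and the width
  \<open>hi f - lo f\<close> is additive.\<close>

lemma mult_coeff_nonzero: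
  "(f \<otimes>\<^bsub>P\<^esub> g) (hi f + hi g) \<noteq> \<zero>" "(f \<otimes>\<^bsub>P\<^esub> g) (lo f + lo g) \<noteq> \<zero>"
  using fg coeff_hi coeff_lo by (auto simp: mult_coeff_hi mult_coeff_lo integral_iff)

lemma mult_nonzero: "f \<otimes>\<^bsub>P\<^esub> g \<noteq> \<zero>\<^bsub>P\<^esub>"
  using mult_coeff_nonzero P_zero_iff by blast

lemma mult_coeff_bounds:
  assumes "(f \<otimes>\<^bsub>P\<^esub> g) n \<noteq> \<zero>"
  shows "lo f + lo g \<le> n" "n \<le> hi f + hi g"
proof -
  have "\<exists>i \<in> supp f. g (n - i) \<noteq> \<zero>"
  proof (rule ccontr)
    assume "\<not> ?thesis"
    then have "(f \<otimes>\<^bsub>P\<^esub> g) n = \<zero>"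
      using fg by (subst P_mult[of _ _ "supp f"]) (auto intro!: add.finprod_one_eqI)
    then show False
      using assms by simp
  qed
  then obtain i where "f i \<noteq> \<zero>" "g (n - i) \<noteq> \<zero>" by blast
  then show "lo f + lo g \<le> n" "n \<le> hi f + hi g"
    using supp_bounds[of f i] supp_bounds[of g "n - i"] fg by auto
qed

lemma hi_mult: "hi (f \<otimes>\<^bsub>P\<^esub> g) = hi f + hi g"
  and lo_mult: "lo (f \<otimes>\<^bsub>P\<^esub> g) = lo f + lo g"
proof -
  have c: "f \<otimes>\<^bsub>P\<^esub> g \<in> carrier P" using fg by simp
  show "hi (f \<otimes>\<^bsub>P\<^esub> g) = hi f + hi g"
    using mult_coeff_bounds(2) mult_coeff_nonzero(1) coeff_hi[OF c mult_nonzero] supp_bounds(2)[OF c]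
    by (meson order.antisym)
  show "lo (f \<otimes>\<^bsub>P\<^esub> g) = lo f + lo g"
    using mult_coeff_bounds(1) mult_coeff_nonzero(2) coeff_lo[OF c mult_nonzero] supp_bounds(1)[OF c]
    by (meson order.antisym)
qed

end

lemma hi_eq_lo_unit:
  assumes "f \<in> carrier P" "f \<noteq> \<zero>\<^bsub>P\<^esub>" "hi f = lo f"
  shows "f \<in> Units P"
proof -
  let ?d = "hi f" and ?c = "f (hi f)"
  have f: "f = skew_monom K ?c ?d"
    using supp_bounds[of f] assms by (fastforce simp: fun_eq_iff skew_monom_def)
  have c: "?c \<in> carrier K" "?c \<in> Units K"
    using assms coeff_hi[OF assms(1,2)] field_Units by auto
  \<comment> \<open>The inverse of c \<alpha>^d is \<alpha>^(-d) c^(-1); moving the coefficient to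
    the left applies \<open>pw (- d)\<close> to it.\<close>
  define g where "g = skew_monom K (pw (- ?d) (inv ?c)) (- ?d)"
  have g: "g \<in> carrier P"
    using c by (simp add: g_def)
  have "f \<otimes>\<^bsub>P\<^esub> g = \<one>\<^bsub>P\<^esub>"
  proof
    fix n
    show "(f \<otimes>\<^bsub>P\<^esub> g) n = \<one>\<^bsub>P\<^esub> n"
      using c by (subst f) (auto simp: monom_mult[OF c(1) g] P_one, auto simp: g_def skew_monom_def)
  qed
  moreover have "g \<otimes>\<^bsub>P\<^esub> f = \<one>\<^bsub>P\<^esub>"
  proof
    fix n
    have "(g \<otimes>\<^bsub>P\<^esub> f) n = pw (- ?d) (inv ?c) \<otimes> pw (- ?d) (f (n + ?d))"
      using c assms by (simp add: g_def monom_mult)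
    also have "\<dots> = pw (- ?d) (inv ?c \<otimes> f (n + ?d))"
      using c assms by (simp add: pw_times)
    also have "\<dots> = \<one>\<^bsub>P\<^esub> n"
      using c by (subst (2) f) (auto simp: P_one skew_monom_def)
    finally show "(g \<otimes>\<^bsub>P\<^esub> f) n = \<one>\<^bsub>P\<^esub> n" .
  qed
  ultimately show ?thesis
    using assms g by (auto simp: Units_def)
qed

lemma nonzero_if_left_inverse:
  assumes "f \<in> carrier P" "g \<in> carrier P" "f \<otimes>\<^bsub>P\<^esub> g = \<one>\<^bsub>P\<^esub>"
  shows "f \<noteq> \<zero>\<^bsub>P\<^esub>" "g \<noteq> \<zero>\<^bsub>P\<^esub>"
proof -
  have "\<one>\<^bsub>P\<^esub> \<noteq> \<zero>\<^bsub>P\<^esub>"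
    by (auto simp: P_one P_zero_iff skew_monom_def)
  then show "f \<noteq> \<zero>\<^bsub>P\<^esub>" "g \<noteq> \<zero>\<^bsub>P\<^esub>"
    using assms by auto
qed

lemma hi_lo_one: "hi \<one>\<^bsub>P\<^esub> = 0" "lo \<one>\<^bsub>P\<^esub> = 0"
proof -
  have "supp \<one>\<^bsub>P\<^esub> = {0}"
    by (auto simp: P_one skew_monom_def)
  then show "hi \<one>\<^bsub>P\<^esub> = 0" "lo \<one>\<^bsub>P\<^esub> = 0"
    by (simp_all add: hi_def lo_def)
qed

text \<open>Widths add up to the width 0 of the unit element and are nonnegative, so g has width 0
  and is a monomial. The irreducibility proof below produces only a left inverse, and this upgrades
  it.\<close>

lemma left_inverse_unit:
  assumes "f \<in> carrier P" "g \<in> carrier P" "f \<otimes>\<^bsub>P\<^esub> g = \<one>\<^bsub>P\<^esub>"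
  shows "g \<in> Units P"
proof (rule hi_eq_lo_unit)
  note nz = nonzero_if_left_inverse[OF assms]
  then show "hi g = lo g"
    using hi_mult[of f g] lo_mult[of f g] hi_lo_one lo_le_hi[of f] lo_le_hi[of g] assms by simp
qed (use assms nonzero_if_left_inverse[OF assms] in auto)

end


section \<open>Simple modules over the skew Laurent polynomial ring\<close>

text \<open>A simple left P-module given by its raw data: the action of K and the semilinear
  bijection \<Phi> by which \<alpha> acts. Since \<alpha> is invertible in P, submodules have to be
  stable under all integer powers of \<Phi>.\<close>

locale skew_rep = skew_field K \<phi> + V?: abelian_group V
  for K :: "('k, 'a) ring_scheme" (structure) and \<phi> and V :: "('v, 'b) ring_scheme" +
  fixes act :: "'k \<Rightarrow> 'v \<Rightarrow> 'v" and \<Phi> :: "'v \<Rightarrow> 'v"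
  assumes act_closed [simp]: "\<lbrakk>c \<in> carrier K; v \<in> carrier V\<rbrakk> \<Longrightarrow> act c v \<in> carrier V"
    and act_l_distr: "\<lbrakk>c \<in> carrier K; d \<in> carrier K; v \<in> carrier V\<rbrakk> \<Longrightarrow>
      act (c \<oplus> d) v = act c v \<oplus>\<^bsub>V\<^esub> act d v"
    and act_r_distr: "\<lbrakk>c \<in> carrier K; v \<in> carrier V; w \<in> carrier V\<rbrakk> \<Longrightarrow>
      act c (v \<oplus>\<^bsub>V\<^esub> w) = act c v \<oplus>\<^bsub>V\<^esub> act c w"
    and act_assoc: "\<lbrakk>c \<in> carrier K; d \<in> carrier K; v \<in> carrier V\<rbrakk> \<Longrightarrow>
      act (c \<otimes> d) v = act c (act d v)"
    and act_one [simp]: "v \<in> carrier V \<Longrightarrow> act \<one> v = v"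
    and \<Phi>_bij: "bij_betw \<Phi> (carrier V) (carrier V)"
    and \<Phi>_add: "\<lbrakk>v \<in> carrier V; w \<in> carrier V\<rbrakk> \<Longrightarrow> \<Phi> (v \<oplus>\<^bsub>V\<^esub> w) = \<Phi> v \<oplus>\<^bsub>V\<^esub> \<Phi> w"
    and \<Phi>_act: "\<lbrakk>c \<in> carrier K; v \<in> carrier V\<rbrakk> \<Longrightarrow> \<Phi> (act c v) = act (\<phi> c) (\<Phi> v)"
    and nontrivial: "carrier V \<noteq> {\<zero>\<^bsub>V\<^esub>}"
    and simple: "\<lbrakk>additive_subgroup H V; \<And>c v. c \<in> carrier K \<Longrightarrow> v \<in> H \<Longrightarrow> act c v \<in> H;
        \<And>v i. v \<in> H \<Longrightarrow> int_iter V \<Phi> i v \<in> H; H \<noteq> {\<zero>\<^bsub>V\<^esub>}\<rbrakk> \<Longrightarrow> H = carrier V"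
begin

abbreviation "vw \<equiv> int_iter V \<Phi>"

lemmas vw_closed [simp] = int_iter_closed[OF \<Phi>_bij]
lemmas vw_vw = int_iter_add[OF \<Phi>_bij]

lemma vw_plus: "v \<in> carrier V \<Longrightarrow> w \<in> carrier V \<Longrightarrow> vw n (v \<oplus>\<^bsub>V\<^esub> w) = vw n v \<oplus>\<^bsub>V\<^esub> vw n w"
  by (rule int_iter_hom[OF \<Phi>_bij]) (auto simp: \<Phi>_add)

lemma additive_zero:
  assumes "h \<in> carrier V \<rightarrow> carrier V"
    and "\<And>v w. \<lbrakk>v \<in> carrier V; w \<in> carrier V\<rbrakk> \<Longrightarrow> h (v \<oplus>\<^bsub>V\<^esub> w) = h v \<oplus>\<^bsub>V\<^esub> h w"
  shows "h \<zero>\<^bsub>V\<^esub> = \<zero>\<^bsub>V\<^esub>"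
  using assms(2)[of "\<zero>\<^bsub>V\<^esub>" "\<zero>\<^bsub>V\<^esub>"] assms(1)
  by (metis V.add.l_cancel_one V.l_zero V.zero_closed funcset_mem)

lemma vw_zero [simp]: "vw n \<zero>\<^bsub>V\<^esub> = \<zero>\<^bsub>V\<^esub>"
  by (rule additive_zero) (auto simp: vw_plus)

lemma act_r_zero [simp]: "c \<in> carrier K \<Longrightarrow> act c \<zero>\<^bsub>V\<^esub> = \<zero>\<^bsub>V\<^esub>"
  by (rule additive_zero) (auto simp: act_r_distr)

lemma act_l_zero [simp]:
  assumes v: "v \<in> carrier V"
  shows "act \<zero> v = \<zero>\<^bsub>V\<^esub>"
proof -
  have "act \<zero> v \<oplus>\<^bsub>V\<^esub> act \<zero> v = act \<zero> v"
    using act_l_distr[of \<zero> \<zero> v] v by simp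
  then show ?thesis
    using v by (metis K.zero_closed V.add.l_cancel_one act_closed)
qed

lemma vw_act:
  assumes "c \<in> carrier K" "v \<in> carrier V"
  shows "vw n (act c v) = act (pw n c) (vw n v)"
proof (induction n rule: int_induct[where k = 0])
  case (step1 i)
  then show ?case
    using int_iter_step[OF \<Phi>_bij, of _ i] int_iter_step[OF \<phi>_bij, of _ i] assms \<Phi>_act by simp
next
  case (step2 i)
  have "\<Phi> (vw (i - 1) (act c v)) = \<Phi> (act (pw (i - 1) c) (vw (i - 1) v))"
    using step2 int_iter_step[OF \<Phi>_bij, of _ "i - 1"] int_iter_step[OF \<phi>_bij, of _ "i - 1"]
      assms \<Phi>_act by simp
  then show ?case
    using \<Phi>_bij assms by (metis bij_betw_def inj_onD act_closed pw_closed vw_closed)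
qed simp

section \<open>The action of Laurent polynomials and cyclicity\<close>

definition ev :: "(int \<Rightarrow> 'k) \<Rightarrow> 'v \<Rightarrow> 'v"
  where "ev p v = (\<Oplus>\<^bsub>V\<^esub>i\<in>supp p. act (p i) (vw i v))"

lemma ev_superset:
  assumes "p \<in> carrier P" "v \<in> carrier V" "finite A" "supp p \<subseteq> A"
  shows "ev p v = (\<Oplus>\<^bsub>V\<^esub>i\<in>A. act (p i) (vw i v))"
  unfolding ev_def using assms by (intro V.finsum_superset) auto

lemma ev_closed [simp]: "p \<in> carrier P \<Longrightarrow> v \<in> carrier V \<Longrightarrow> ev p v \<in> carrier V"
  unfolding ev_def by (intro V.finsum_closed) auto

lemma ev_plus:
  assumes "p \<in> carrier P" "q \<in> carrier P" "v \<in> carrier V"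
  shows "ev (p \<oplus>\<^bsub>P\<^esub> q) v = ev p v \<oplus>\<^bsub>V\<^esub> ev q v"
proof -
  let ?A = "supp p \<union> supp q"
  have "ev (p \<oplus>\<^bsub>P\<^esub> q) v = (\<Oplus>\<^bsub>V\<^esub>i\<in>?A. act ((p \<oplus>\<^bsub>P\<^esub> q) i) (vw i v))"
    using assms by (intro ev_superset) (auto simp: P_add)
  also have "\<dots> = (\<Oplus>\<^bsub>V\<^esub>i\<in>?A. act (p i) (vw i v) \<oplus>\<^bsub>V\<^esub> act (q i) (vw i v))"
    using assms by (intro V.finsum_cong') (auto simp: P_add act_l_distr)
  also have "\<dots> = (\<Oplus>\<^bsub>V\<^esub>i\<in>?A. act (p i) (vw i v)) \<oplus>\<^bsub>V\<^esub> (\<Oplus>\<^bsub>V\<^esub>i\<in>?A. act (q i) (vw i v))"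
    using assms by (intro V.finsum_addf) auto
  also have "\<dots> = ev p v \<oplus>\<^bsub>V\<^esub> ev q v"
    using assms ev_superset[of p v ?A] ev_superset[of q v ?A] by simp
  finally show ?thesis .
qed

lemma ev_zero [simp]: "ev \<zero>\<^bsub>P\<^esub> v = \<zero>\<^bsub>V\<^esub>"
  by (simp add: ev_def P_zero)

lemma ev_zero_right [simp]: "p \<in> carrier P \<Longrightarrow> ev p \<zero>\<^bsub>V\<^esub> = \<zero>\<^bsub>V\<^esub>"
  unfolding ev_def by (rule V.add.finprod_one_eqI) simp

text \<open>By semilinearity the twisted coefficient \<open>pw d (p i)\<close> is what p i becomes
  when \<Phi>^d passes over it. Multiplicativity of \<open>ev\<close> follows from this case by
  \<open>P_induct\<close>.\<close>

lemma ev_monom_mult: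
  assumes "c \<in> carrier K" "p \<in> carrier P" "v \<in> carrier V"
  shows "ev (skew_monom K c d \<otimes>\<^bsub>P\<^esub> p) v = act c (vw d (ev p v))"
proof -
  let ?A = "(+) d ` supp p"
  have A: "supp (skew_monom K c d \<otimes>\<^bsub>P\<^esub> p) \<subseteq> ?A"
  proof
    fix i assume "i \<in> supp (skew_monom K c d \<otimes>\<^bsub>P\<^esub> p)"
    then have "p (i - d) \<noteq> \<zero>"
      using assms by (auto simp: monom_mult)
    then show "i \<in> ?A"
      by (intro image_eqI[of _ _ "i - d"]) auto
  qed
  have "ev (skew_monom K c d \<otimes>\<^bsub>P\<^esub> p) v = (\<Oplus>\<^bsub>V\<^esub>i\<in>?A. act (c \<otimes> pw d (p (i - d))) (vw i v))"
    using assms A by (subst ev_superset[of _ _ ?A]) (auto simp: monom_mult)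
  also have "\<dots> = (\<Oplus>\<^bsub>V\<^esub>i\<in>supp p. act (c \<otimes> pw d (p i)) (vw (d + i) v))"
    using assms by (subst V.finsum_reindex) auto
  also have "\<dots> = (\<Oplus>\<^bsub>V\<^esub>i\<in>supp p. act c (vw d (act (p i) (vw i v))))"
    using assms by (intro V.finsum_cong') (auto simp: act_assoc vw_act vw_vw)
  also have "\<dots> = act c (vw d (ev p v))"
    unfolding ev_def using assms
    by (intro V.finsum_additive[symmetric, OF V.abelian_monoid_axioms, of "\<lambda>x. act c (vw d x)"])
      (auto simp: vw_plus act_r_distr)
  finally show ?thesis .
qed

lemma ev_monom:
  assumes "c \<in> carrier K" "v \<in> carrier V"
  shows "ev (skew_monom K c d) v = act c (vw d v)"
proof -
  have "ev (skew_monom K c d) v = (\<Oplus>\<^bsub>V\<^esub>i\<in>{d}. act (skew_monom K c d i) (vw i v))"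
    using assms by (intro ev_superset[OF monom_closed]) (auto simp: skew_monom_def)
  then show ?thesis
    using assms by (simp add: skew_monom_def)
qed

lemma ev_one [simp]: "v \<in> carrier V \<Longrightarrow> ev \<one>\<^bsub>P\<^esub> v = v"
  by (simp add: P_one ev_monom)

lemma ev_mult:
  assumes "p \<in> carrier P" "q \<in> carrier P" "v \<in> carrier V"
  shows "ev (p \<otimes>\<^bsub>P\<^esub> q) v = ev p (ev q v)"
  using assms(1)
proof (induction p rule: P_induct)
  case (add c d p)
  then show ?case
    using assms by (simp add: P_l_distr ev_plus ev_monom_mult ev_monom)
qed (simp add: assms)

text \<open>The orbit P v is a nonzero submodule, as it contains 1 v = v, so simplicity makes it all
  of V.\<close>

lemma ev_surj:
  assumes "v \<in> carrier V" "v \<noteq> \<zero>\<^bsub>V\<^esub>" "w \<in> carrier V"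
  shows "\<exists>p \<in> carrier P. ev p v = w"
proof -
  let ?H = "(\<lambda>p. ev p v) ` carrier P"
  have sub: "additive_subgroup ?H V"
  proof (intro additive_subgroup.intro V.add.subgroupI)
    fix a assume "a \<in> ?H"
    then obtain p where p: "p \<in> carrier P" "a = ev p v" by blast
    then have "ev (\<ominus>\<^bsub>P\<^esub> p) v \<oplus>\<^bsub>V\<^esub> ev p v = \<zero>\<^bsub>V\<^esub>"
      using assms by (simp add: P.l_neg flip: ev_plus)
    then have "ev (\<ominus>\<^bsub>P\<^esub> p) v = \<ominus>\<^bsub>V\<^esub> a"
      using p assms by (simp add: V.minus_equality)
    then show "\<ominus>\<^bsub>V\<^esub> a \<in> ?H"
      using p by (metis P.a_inv_closed imageI)
  next
    fix a b assume "a \<in> ?H" "b \<in> ?H"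
    then show "a \<oplus>\<^bsub>V\<^esub> b \<in> ?H"
      using assms by (auto simp flip: ev_plus)
  qed (use assms in auto)
  have act: "act c x \<in> ?H" if c: "c \<in> carrier K" and "x \<in> ?H" for c x
  proof -
    obtain p where "p \<in> carrier P" "x = ev p v" using \<open>x \<in> ?H\<close> by blast
    then have "skew_monom K c 0 \<otimes>\<^bsub>P\<^esub> p \<in> carrier P" "act c x = ev (skew_monom K c 0 \<otimes>\<^bsub>P\<^esub> p) v"
      using c assms by (simp_all add: ev_mult ev_monom)
    then show ?thesis by blast
  qed
  have vw: "vw i x \<in> ?H" if "x \<in> ?H" for i x
  proof -
    obtain p where "p \<in> carrier P" "x = ev p v" using \<open>x \<in> ?H\<close> by blast
    then have "skew_monom K \<one> i \<otimes>\<^bsub>P\<^esub> p \<in> carrier P" "vw i x = ev (skew_monom K \<one> i \<otimes>\<^bsub>P\<^esub> p) v"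
      using assms by (simp_all add: ev_mult ev_monom)
    then show ?thesis by blast
  qed
  have "ev \<one>\<^bsub>P\<^esub> v \<in> ?H"
    by blast
  then have "?H \<noteq> {\<zero>\<^bsub>V\<^esub>}"
    using assms by auto
  then have "?H = carrier V"
    using simple[OF sub act vw] by blast
  with assms(3) have "w \<in> ?H"
    by simp
  then show ?thesis
    by auto
qed

section \<open>Annihilators and irreducible generators\<close>

definition ann :: "'v \<Rightarrow> (int \<Rightarrow> 'k) set"
  where "ann v = {p \<in> carrier P. ev p v = \<zero>\<^bsub>V\<^esub>}"

lemma ev_minus:
  assumes "p \<in> carrier P" "v \<in> carrier V"
  shows "ev (\<ominus>\<^bsub>P\<^esub> p) v = \<ominus>\<^bsub>V\<^esub> ev p v"
proof -
  have "ev (\<ominus>\<^bsub>P\<^esub> p) v \<oplus>\<^bsub>V\<^esub> ev p v = \<zero>\<^bsub>V\<^esub>"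
    using assms by (simp add: P.l_neg flip: ev_plus)
  then show ?thesis
    using assms by (simp add: V.minus_equality)
qed

lemma ann_subgroup: "v \<in> carrier V \<Longrightarrow> abelian_subgroup (ann v) P"
  by (intro abelian_subgroupI3 additive_subgroup.intro P.add.subgroupI P.abelian_group_axioms)
    (auto simp: ann_def ev_plus ev_minus simp flip: a_inv_def)

text \<open>If \<open>v\<close> had no annihilator, then \<open>V\<close> would be free on \<open>v\<close>, but \<open>(1 + \<alpha>)v\<close> generates a proper
  submodule of the free module.\<close>

lemma ann_nonzero:
  assumes v: "v \<in> carrier V"
  obtains p where "p \<in> ann v" "p \<noteq> \<zero>\<^bsub>P\<^esub>"
proof (cases "v = \<zero>\<^bsub>V\<^esub>")
  case True
  have "\<one>\<^bsub>P\<^esub> \<noteq> \<zero>\<^bsub>P\<^esub>"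
    using nonzero_if_left_inverse[of "\<one>\<^bsub>P\<^esub>" "\<one>\<^bsub>P\<^esub>"] by simp
  then show ?thesis
    using True by (intro that[of "\<one>\<^bsub>P\<^esub>"]) (auto simp: ann_def)
next
  case False
  define h where "h = skew_monom K \<one> 0 \<oplus>\<^bsub>P\<^esub> skew_monom K \<one> 1"
  have h: "h \<in> carrier P"
    by (simp add: h_def)
  have supp_h: "supp h = {0, 1}"
    by (auto simp: h_def P_add skew_monom_def)
  then have h_nz: "h \<noteq> \<zero>\<^bsub>P\<^esub>"
    using P_zero_iff by blast
  show ?thesis
  proof (cases "ev h v = \<zero>\<^bsub>V\<^esub>")
    case True
    then show ?thesis
      using h h_nz by (intro that[of h]) (auto simp: ann_def)
  next
    case False
    then obtain q where q: "q \<in> carrier P" "ev q (ev h v) = v"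
      using ev_surj[of "ev h v" v] h v by auto
    \<comment> \<open>Widths are additive and h has width 1, so h has no left inverse. As q h fixes
      v, the difference q h - 1 is then a nonzero element of the annihilator.\<close>
    have "q \<otimes>\<^bsub>P\<^esub> h \<noteq> \<one>\<^bsub>P\<^esub>"
    proof
      assume qh: "q \<otimes>\<^bsub>P\<^esub> h = \<one>\<^bsub>P\<^esub>"
      note nz = nonzero_if_left_inverse[OF q(1) h qh]
      have "hi h = 1" "lo h = 0"
        unfolding hi_def lo_def supp_h by simp_all
      then show False
        using hi_mult[of q h] lo_mult[of q h] hi_lo_one lo_le_hi[of q] q(1) h nz qh by simp
    qed
    moreover have "q \<otimes>\<^bsub>P\<^esub> h \<ominus>\<^bsub>P\<^esub> \<one>\<^bsub>P\<^esub> \<in> ann v"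
      using q h v by (simp add: ann_def a_minus_def ev_plus ev_minus ev_mult V.r_neg)
    moreover have "q \<otimes>\<^bsub>P\<^esub> h = (q \<otimes>\<^bsub>P\<^esub> h \<ominus>\<^bsub>P\<^esub> \<one>\<^bsub>P\<^esub>) \<oplus>\<^bsub>P\<^esub> \<one>\<^bsub>P\<^esub>"
      using q h by (simp add: a_minus_def P.a_assoc P.l_neg)
    ultimately show ?thesis
      by (intro that[of "q \<otimes>\<^bsub>P\<^esub> h \<ominus>\<^bsub>P\<^esub> \<one>\<^bsub>P\<^esub>"]) auto
  qed
qed

text \<open>Division with remainder.\<close>

lemma ann_principal:
  assumes v: "v \<in> carrier V"
  obtains f where "f \<in> carrier P" "f \<noteq> \<zero>\<^bsub>P\<^esub>" "ann v = left_multiples P f"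
proof -
  define A where "A = {p \<in> ann v. p \<noteq> \<zero>\<^bsub>P\<^esub>}"
  \<comment> \<open>The width serves as Euclidean norm: it does not change under multiplication by
    monomials, the units of P.\<close>
  define wd where "wd p = nat (hi p - lo p)" for p
  have "\<exists>p. p \<in> A"
    using ann_nonzero[OF v] unfolding A_def by blast
  then obtain f where f: "f \<in> A" "\<And>p. p \<in> A \<Longrightarrow> wd f \<le> wd p"
    using ex_has_least_nat[of "\<lambda>p. p \<in> A" _ wd] by blast
  then have fP: "f \<in> carrier P" "f \<noteq> \<zero>\<^bsub>P\<^esub>" "ev f v = \<zero>\<^bsub>V\<^esub>"
    by (auto simp: A_def ann_def)
  have "p \<in> left_multiples P f" if "p \<in> ann v" for p
    using that
  \<comment> \<open>A nonzero monomial has width 0, so the measure reserves the value 0 for the zero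
    polynomial and starts at 1 for all others.\<close>
  proof (induction "if p = \<zero>\<^bsub>P\<^esub> then 0 else Suc (wd p)" arbitrary: p rule: less_induct)
    case less
    show ?case
    proof (cases "p = \<zero>\<^bsub>P\<^esub>")
      case True
      then have "p = \<zero>\<^bsub>P\<^esub> \<otimes>\<^bsub>P\<^esub> f"
        using fP by simp
      then show ?thesis
        unfolding left_multiples_def by blast
    next
      case False
      have pP: "p \<in> carrier P" "ev p v = \<zero>\<^bsub>V\<^esub>"
        using less.prems by (auto simp: ann_def)
      \<comment> \<open>By minimality of f, p is at least as wide. A multiple of f aligned with p at
        the top therefore does not reach below \<open>lo p\<close>.\<close>
      have wd: "hi f - lo f \<le> hi p - lo p"
        using f(2)[of p] less.prems False lo_le_hi[of p] lo_le_hi[of f] fP pP by (auto simp: A_def wd_def)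
      define d where "d = hi p - hi f"
      have fh: "f (hi f) \<noteq> \<zero>" "f (hi f) \<in> carrier K"
        using coeff_hi[OF fP(1,2)] fP by auto
      then have unit: "pw d (f (hi f)) \<in> Units K"
        using field_Units by auto
      \<comment> \<open>Chosen so that c \<alpha>^d f has top coefficient - p (hi p), which cancels
        the top of p in q.\<close>
      define c where "c = \<ominus> (p (hi p) \<otimes> inv (pw d (f (hi f))))"
      define m where "m = skew_monom K c d"
      have c: "c \<in> carrier K"
        using unit pP by (simp add: c_def)
      then have m: "m \<in> carrier P"
        by (simp add: m_def)
      define q where "q = p \<oplus>\<^bsub>P\<^esub> m \<otimes>\<^bsub>P\<^esub> f"
      have q: "q \<in> carrier P" "q \<in> ann v"
        using pP m fP v by (auto simp: q_def ann_def ev_plus ev_mult m_def ev_monom c)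
      have q_coeff: "q n = p n \<oplus> c \<otimes> pw d (f (n - d))" for n
        using c fP by (simp add: q_def P_add m_def monom_mult)
      have "c \<otimes> pw d (f (hi f)) = \<ominus> p (hi p)"
        using unit pP fh by (simp add: c_def l_minus m_assoc)
      then have "q (hi p) = \<zero>"
        using pP by (simp add: q_coeff d_def K.r_neg)
      moreover have "lo p \<le> n \<and> n \<le> hi p" if "q n \<noteq> \<zero>" for n
      proof -
        have "p n \<noteq> \<zero> \<or> f (n - d) \<noteq> \<zero>"
          using that c pP fP by (auto simp: q_coeff)
        then show ?thesis
          using supp_bounds[OF pP(1), of n] supp_bounds[OF fP(1), of "n - d"] wd
          by (auto simp: d_def)
      qed
      ultimately have "q = \<zero>\<^bsub>P\<^esub> \<or> lo p \<le> lo q \<and> hi q < hi p"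
        using coeff_hi[OF q(1)] coeff_lo[OF q(1)] by (metis order_le_less)
      then have "(if q = \<zero>\<^bsub>P\<^esub> then 0 else Suc (wd q)) < (if p = \<zero>\<^bsub>P\<^esub> then 0 else Suc (wd p))"
        using False lo_le_hi[of q] q by (auto simp: wd_def)
      from less.hyps[OF this q(2)] obtain g where g: "g \<in> carrier P" "q = g \<otimes>\<^bsub>P\<^esub> f"
        by (auto simp: left_multiples_def)
      have "p = q \<ominus>\<^bsub>P\<^esub> m \<otimes>\<^bsub>P\<^esub> f"
        unfolding q_def using pP m fP by (simp add: a_minus_def P.a_assoc P.r_neg)
      also have "\<dots> = (g \<ominus>\<^bsub>P\<^esub> m) \<otimes>\<^bsub>P\<^esub> f"
        using g m fP by (simp add: a_minus_def P.l_distr P.l_minus)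
      finally show ?thesis
        using g m unfolding left_multiples_def by (auto intro!: image_eqI[of _ _ "g \<ominus>\<^bsub>P\<^esub> m"])
    qed
  qed
  moreover have "left_multiples P f \<subseteq> ann v"
    using fP v by (auto simp: left_multiples_def ann_def ev_mult)
  ultimately show ?thesis
    using fP by (intro that[of f]) auto
qed

text \<open>Let f = g h. If h kills v, then h is a multiple of f, and comparing widths shows that g
  is a monomial. If not, some q brings h v back to v; then 1 - q h lies in P f, which is contained
  in P h, so h has a left inverse.\<close>

lemma generator_irreducible:
  assumes v: "v \<in> carrier V" "v \<noteq> \<zero>\<^bsub>V\<^esub>"
    and f: "f \<in> carrier P" "f \<noteq> \<zero>\<^bsub>P\<^esub>" "ann v = left_multiples P f"
  shows "irreducible_element P f"
proof -
  have fv: "ev f v = \<zero>\<^bsub>V\<^esub>"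
  proof -
    have "\<one>\<^bsub>P\<^esub> \<otimes>\<^bsub>P\<^esub> f \<in> left_multiples P f"
      unfolding left_multiples_def by blast
    then show ?thesis
      using f by (auto simp: ann_def)
  qed
  have "f \<notin> Units P"
  proof
    assume "f \<in> Units P"
    then obtain x where x: "x \<in> carrier P" "x \<otimes>\<^bsub>P\<^esub> f = \<one>\<^bsub>P\<^esub>"
      by (auto simp: Units_def)
    then have "ev \<one>\<^bsub>P\<^esub> v = ev x (ev f v)"
      using f v by (simp flip: ev_mult)
    then show False
      using fv v x by simp
  qed
  moreover have "g \<in> Units P \<or> h \<in> Units P"
    if gh: "g \<in> carrier P" "h \<in> carrier P" "f = g \<otimes>\<^bsub>P\<^esub> h" for g h
  proof (cases "ev h v = \<zero>\<^bsub>V\<^esub>")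
    case True
    then have "h \<in> left_multiples P f"
      using f gh by (auto simp: ann_def)
    then obtain u where u: "u \<in> carrier P" "h = u \<otimes>\<^bsub>P\<^esub> f"
      by (auto simp: left_multiples_def)
    have nz: "g \<noteq> \<zero>\<^bsub>P\<^esub>" "h \<noteq> \<zero>\<^bsub>P\<^esub>"
      using f(2) gh by (metis P.l_null, metis P.r_null)
    have "u \<noteq> \<zero>\<^bsub>P\<^esub>"
      using nz(2) u f(1) by (metis P.l_null)
    note hl = hi_mult[OF u(1) this f(1,2), folded u(2)] lo_mult[OF u(1) this f(1,2), folded u(2)]
      hi_mult[OF gh(1) nz(1) gh(2) nz(2), folded gh(3)]
      lo_mult[OF gh(1) nz(1) gh(2) nz(2), folded gh(3)]
    then have "hi g = lo g"
      using lo_le_hi[OF u(1) \<open>u \<noteq> \<zero>\<^bsub>P\<^esub>\<close>] lo_le_hi[OF gh(1) nz(1)] by simp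
    then show ?thesis
      using hi_eq_lo_unit gh nz by blast
  next
    case False
    then obtain q where q: "q \<in> carrier P" "ev q (ev h v) = v"
      using ev_surj[of "ev h v" v] gh v by auto
    then have "\<one>\<^bsub>P\<^esub> \<ominus>\<^bsub>P\<^esub> q \<otimes>\<^bsub>P\<^esub> h \<in> ann v"
      using gh(1,2) v by (simp add: ann_def a_minus_def ev_plus ev_minus ev_mult V.r_neg)
    then have "\<one>\<^bsub>P\<^esub> \<ominus>\<^bsub>P\<^esub> q \<otimes>\<^bsub>P\<^esub> h \<in> left_multiples P f"
      by (simp only: f(3))
    then obtain u where u: "u \<in> carrier P" "\<one>\<^bsub>P\<^esub> \<ominus>\<^bsub>P\<^esub> q \<otimes>\<^bsub>P\<^esub> h = u \<otimes>\<^bsub>P\<^esub> f"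
      by (auto simp: left_multiples_def)
    have "\<one>\<^bsub>P\<^esub> = (\<one>\<^bsub>P\<^esub> \<ominus>\<^bsub>P\<^esub> q \<otimes>\<^bsub>P\<^esub> h) \<oplus>\<^bsub>P\<^esub> q \<otimes>\<^bsub>P\<^esub> h"
      using q gh by (simp add: a_minus_def P.a_assoc P.l_neg)
    also have "\<dots> = (u \<otimes>\<^bsub>P\<^esub> g \<oplus>\<^bsub>P\<^esub> q) \<otimes>\<^bsub>P\<^esub> h"
      unfolding u(2) using gh u q by (simp add: P.l_distr P.m_assoc)
    finally show ?thesis
      using left_inverse_unit[of "u \<otimes>\<^bsub>P\<^esub> g \<oplus>\<^bsub>P\<^esub> q" h] gh u q by auto
  qed
  ultimately show ?thesis
    using f by (auto simp: irreducible_element_def)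
qed

text \<open>\<theta> sends the class of p to p v. Scalar multiplication is recorded for monomials,
  the scalars by which band modules are built: constants, \<alpha> and its inverse.\<close>

lemma left_quotient_iso:
  assumes v: "v \<in> carrier V" "v \<noteq> \<zero>\<^bsub>V\<^esub>"
    and f: "f \<in> carrier P" "ann v = left_multiples P f"
  defines "L \<equiv> left_quotient P f" and "\<theta> \<equiv> \<lambda>C. the_elem ((\<lambda>p. ev p v) ` C)"
  shows "bij_betw \<theta> (carrier L) (carrier V)"
    and "\<zero>\<^bsub>L\<^esub> \<in> carrier L" "\<theta> \<zero>\<^bsub>L\<^esub> = \<zero>\<^bsub>V\<^esub>"
    and "\<And>C D. \<lbrakk>C \<in> carrier L; D \<in> carrier L\<rbrakk> \<Longrightarrow> C \<oplus>\<^bsub>L\<^esub> D \<in> carrier L"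
    and "\<And>C D. \<lbrakk>C \<in> carrier L; D \<in> carrier L\<rbrakk> \<Longrightarrow> \<theta> (C \<oplus>\<^bsub>L\<^esub> D) = \<theta> C \<oplus>\<^bsub>V\<^esub> \<theta> D"
    and "\<And>c d C. \<lbrakk>c \<in> carrier K; C \<in> carrier L\<rbrakk> \<Longrightarrow> skew_monom K c d \<odot>\<^bsub>L\<^esub> C \<in> carrier L"
    and "\<And>c d C. \<lbrakk>c \<in> carrier K; C \<in> carrier L\<rbrakk> \<Longrightarrow>
      \<theta> (skew_monom K c d \<odot>\<^bsub>L\<^esub> C) = act c (vw d (\<theta> C))"
proof -
  interpret J: abelian_subgroup "left_multiples P f" P
    using ann_subgroup[OF v(1)] f by simp
  let ?cos = "\<lambda>p. left_multiples P f +>\<^bsub>P\<^esub> p"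
  have L: "C \<in> carrier L \<longleftrightarrow> (\<exists>p \<in> carrier P. C = ?cos p)" for C
    by (auto simp: L_def left_quotient_def A_RCOSETS_defs a_r_coset_def)
  \<comment> \<open>The cosets of P f are the fibres of p \<mapsto> p v, because P f is the
    annihilator of v. This one fact yields that \<theta> is well defined and injective and that
    products do not depend on representatives.\<close>
  have mem: "q \<in> ?cos p \<longleftrightarrow> q \<in> carrier P \<and> ev q v = ev p v" if "p \<in> carrier P" for p q
  proof
    assume "q \<in> ?cos p"
    then obtain h where h: "h \<in> ann v" "q = h \<oplus>\<^bsub>P\<^esub> p"
      unfolding f(2)[symmetric] by (auto simp: a_r_coset_def r_coset_def)
    then show "q \<in> carrier P \<and> ev q v = ev p v"
      using that v by (auto simp: ann_def ev_plus)
  next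
    assume q: "q \<in> carrier P \<and> ev q v = ev p v"
    then have "q \<ominus>\<^bsub>P\<^esub> p \<in> ann v"
      using that v by (simp add: ann_def a_minus_def ev_plus ev_minus V.r_neg)
    then show "q \<in> ?cos p"
      using q that by (simp add: f(2) J.a_rcos_module a_minus_def)
  qed
  have cos_eq: "?cos p = ?cos q \<longleftrightarrow> ev p v = ev q v" if "p \<in> carrier P" "q \<in> carrier P" for p q
  proof
    assume "?cos p = ?cos q"
    then show "ev p v = ev q v"
      using mem[OF that(2), of q] mem[OF that(1), of q] that by simp
  next
    assume "ev p v = ev q v"
    then show "?cos p = ?cos q"
      using mem[OF that(1)] mem[OF that(2)] unfolding set_eq_iff by simp
  qed
  have \<theta>: "\<theta> (?cos p) = ev p v" if "p \<in> carrier P" for p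
  proof -
    have "(\<lambda>p. ev p v) ` ?cos p = {ev p v}"
      using that mem by auto
    then show ?thesis
      by (simp add: \<theta>_def)
  qed
  show "bij_betw \<theta> (carrier L) (carrier V)"
  proof (rule bij_betw_imageI)
    show "inj_on \<theta> (carrier L)"
    proof (rule inj_onI)
      fix C D assume "C \<in> carrier L" "D \<in> carrier L" "\<theta> C = \<theta> D"
      moreover from this obtain p q
        where "p \<in> carrier P" "C = ?cos p" "q \<in> carrier P" "D = ?cos q"
        unfolding L by blast
      ultimately show "C = D"
        by (simp add: \<theta> cos_eq)
    qed
    show "\<theta> ` carrier L = carrier V"
    proof safe
      fix w assume "w \<in> carrier V"
      then obtain p where "p \<in> carrier P" "ev p v = w"
        using ev_surj v by blast
      then show "w \<in> \<theta> ` carrier L"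
        using \<theta> L by (metis imageI)
    qed (use v in \<open>auto simp: L \<theta>\<close>)
  qed
  have zero: "\<zero>\<^bsub>L\<^esub> = ?cos \<zero>\<^bsub>P\<^esub>"
    using J.a_subset by (simp add: L_def left_quotient_def)
  show "\<zero>\<^bsub>L\<^esub> \<in> carrier L"
    unfolding L zero by blast
  show "\<theta> \<zero>\<^bsub>L\<^esub> = \<zero>\<^bsub>V\<^esub>"
    unfolding zero by (simp add: \<theta>)
  have plus: "?cos p \<oplus>\<^bsub>L\<^esub> ?cos q = ?cos (p \<oplus>\<^bsub>P\<^esub> q)" if "p \<in> carrier P" "q \<in> carrier P" for p q
    using that by (simp add: L_def left_quotient_def J.a_rcos_sum)
  show "C \<oplus>\<^bsub>L\<^esub> D \<in> carrier L" "\<theta> (C \<oplus>\<^bsub>L\<^esub> D) = \<theta> C \<oplus>\<^bsub>V\<^esub> \<theta> D"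
    if CD: "C \<in> carrier L" "D \<in> carrier L" for C D
  proof -
    obtain p q where "p \<in> carrier P" "q \<in> carrier P" "C = ?cos p" "D = ?cos q"
      using CD unfolding L by blast
    then show "C \<oplus>\<^bsub>L\<^esub> D \<in> carrier L" "\<theta> (C \<oplus>\<^bsub>L\<^esub> D) = \<theta> C \<oplus>\<^bsub>V\<^esub> \<theta> D"
      using v by (simp_all add: plus \<theta> ev_plus) (auto simp: L)
  qed
  have smult: "skew_monom K c d \<odot>\<^bsub>L\<^esub> ?cos p = ?cos (skew_monom K c d \<otimes>\<^bsub>P\<^esub> p)"
    if c: "c \<in> carrier K" and p: "p \<in> carrier P" for c d p
  proof -
    have "(\<lambda>q. ?cos (skew_monom K c d \<otimes>\<^bsub>P\<^esub> q)) ` ?cos p = {?cos (skew_monom K c d \<otimes>\<^bsub>P\<^esub> p)}"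
    proof -
      have "p \<in> ?cos p"
        using p mem by blast
      moreover have "?cos (skew_monom K c d \<otimes>\<^bsub>P\<^esub> q) = ?cos (skew_monom K c d \<otimes>\<^bsub>P\<^esub> p)" if "q \<in> ?cos p" for q
        using that mem[OF p, of q] c p v by (subst cos_eq) (auto simp: ev_monom_mult)
      ultimately show ?thesis
        by (metis (no_types, lifting) empty_iff image_cong image_constant_conv)
    qed
    then show ?thesis
      by (simp add: L_def left_quotient_def)
  qed
  show "skew_monom K c d \<odot>\<^bsub>L\<^esub> C \<in> carrier L"
    "\<theta> (skew_monom K c d \<odot>\<^bsub>L\<^esub> C) = act c (vw d (\<theta> C))"
    if cC: "c \<in> carrier K" "C \<in> carrier L" for c d C
  proof -
    obtain p where "p \<in> carrier P" "C = ?cos p"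
      using cC unfolding L by blast
    then show "skew_monom K c d \<odot>\<^bsub>L\<^esub> C \<in> carrier L"
      "\<theta> (skew_monom K c d \<odot>\<^bsub>L\<^esub> C) = act c (vw d (\<theta> C))"
      using cC v by (simp_all add: smult \<theta> ev_monom_mult) (auto simp: L)
  qed
qed

end

section \<open>Modules over the weak generalized Weyl algebra\<close>

lemma the_elem_image_const:
  assumes "a \<in> A" "\<And>x. x \<in> A \<Longrightarrow> f x = c"
  shows "the_elem (f ` A) = c"
proof -
  have "f ` A = {c}" using assms by auto
  then show ?thesis by simp
qed

locale wgwa_base = R?: cring R for R :: "('r, 'a) ring_scheme" (structure) +
  fixes \<sigma> :: "'r \<Rightarrow> 'r" and t :: 'r
  assumes \<sigma>_hom: "\<sigma> \<in> ring_hom R R" and t_closed [simp]: "t \<in> carrier R"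
begin

abbreviation "A \<equiv> wgwa R \<sigma> t"
abbreviation "cls \<equiv> wgwa_class R \<sigma> t"

lemma \<sigma>_closed [simp]: "r \<in> carrier R \<Longrightarrow> \<sigma> r \<in> carrier R"
  using \<sigma>_hom by (rule ring_hom_closed)

lemma \<sigma>_mult: "r \<in> carrier R \<Longrightarrow> s \<in> carrier R \<Longrightarrow> \<sigma> (r \<otimes> s) = \<sigma> r \<otimes> \<sigma> s"
  using \<sigma>_hom by (rule ring_hom_mult)

lemma \<sigma>_add: "r \<in> carrier R \<Longrightarrow> s \<in> carrier R \<Longrightarrow> \<sigma> (r \<oplus> s) = \<sigma> r \<oplus> \<sigma> s"
  using \<sigma>_hom by (rule ring_hom_add)

lemma \<sigma>_one [simp]: "\<sigma> \<one> = \<one>"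
  using \<sigma>_hom by (rule ring_hom_one)

lemma \<sigma>_zero [simp]: "\<sigma> \<zero> = \<zero>"
  by (rule ring_hom_zero[OF \<sigma>_hom]) (rule R.ring_axioms)+

lemma \<sigma>_pow_closed [simp]: "r \<in> carrier R \<Longrightarrow> (\<sigma> ^^ n) r \<in> carrier R"
  by (induction n) auto

lemma \<sigma>_pow_mult:
  "r \<in> carrier R \<Longrightarrow> s \<in> carrier R \<Longrightarrow> (\<sigma> ^^ n) (r \<otimes> s) = (\<sigma> ^^ n) r \<otimes> (\<sigma> ^^ n) s"
  by (induction n) (auto simp: \<sigma>_mult)

lemma \<sigma>_pow_add:
  "r \<in> carrier R \<Longrightarrow> s \<in> carrier R \<Longrightarrow> (\<sigma> ^^ n) (r \<oplus> s) = (\<sigma> ^^ n) r \<oplus> (\<sigma> ^^ n) s"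
  by (induction n) (auto simp: \<sigma>_add)

lemma terms_simps [simp]:
  "Coeff r \<in> wgwa_terms R \<longleftrightarrow> r \<in> carrier R" "GenX \<in> wgwa_terms R" "GenY \<in> wgwa_terms R"
  "Add u v \<in> wgwa_terms R \<longleftrightarrow> u \<in> wgwa_terms R \<and> v \<in> wgwa_terms R"
  "Mul u v \<in> wgwa_terms R \<longleftrightarrow> u \<in> wgwa_terms R \<and> v \<in> wgwa_terms R"
  by (auto simp: wgwa_terms_def)

lemma rel_terms: "(u, v) \<in> wgwa_rel R \<sigma> t \<Longrightarrow> u \<in> wgwa_terms R \<and> v \<in> wgwa_terms R"
  by (induction rule: wgwa_rel.induct) auto

lemma equiv_rel: "equiv (wgwa_terms R) (wgwa_rel R \<sigma> t)"
proof (intro equivI refl_onI symI transI)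
  show "wgwa_rel R \<sigma> t \<subseteq> wgwa_terms R \<times> wgwa_terms R"
    using rel_terms by auto
qed (auto intro: wgwa_rel.refl wgwa_rel.sym wgwa_rel.trans)

lemma cls_eq: "(u, v) \<in> wgwa_rel R \<sigma> t \<Longrightarrow> cls u = cls v"
  unfolding wgwa_class_def using equiv_rel by (rule equiv_class_eq)

lemma carrier_A: "a \<in> carrier A \<longleftrightarrow> (\<exists>u \<in> wgwa_terms R. a = cls u)"
  by (auto simp: wgwa_def quotient_def wgwa_class_def)

lemma cls_closed [simp]: "u \<in> wgwa_terms R \<Longrightarrow> cls u \<in> carrier A"
  using carrier_A by blast

lemma mem_cls: "u \<in> wgwa_terms R \<Longrightarrow> u \<in> cls u"
  using wgwa_rel.refl by (auto simp: wgwa_class_def)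

lemma cls_add:
  assumes "u \<in> wgwa_terms R" "v \<in> wgwa_terms R"
  shows "cls u \<oplus>\<^bsub>A\<^esub> cls v = cls (Add u v)"
  unfolding wgwa_def ring_record_simps
proof (rule the_elem_image_const)
  show "(u, v) \<in> cls u \<times> cls v"
    using assms by (simp add: mem_cls)
next
  fix p assume "p \<in> cls u \<times> cls v"
  then obtain u' v' where p: "p = (u', v')" "(u, u') \<in> wgwa_rel R \<sigma> t" "(v, v') \<in> wgwa_rel R \<sigma> t"
    by (auto simp: wgwa_class_def)
  then show "(case p of (u, v) \<Rightarrow> cls (Add u v)) = cls (Add u v)"
    by (simp add: cls_eq[OF wgwa_rel.add_cong[OF p(2,3)]])
qed

lemma cls_mult:
  assumes "u \<in> wgwa_terms R" "v \<in> wgwa_terms R"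
  shows "cls u \<otimes>\<^bsub>A\<^esub> cls v = cls (Mul u v)"
  unfolding wgwa_def monoid.simps
proof (rule the_elem_image_const)
  show "(u, v) \<in> cls u \<times> cls v"
    using assms by (simp add: mem_cls)
next
  fix p assume "p \<in> cls u \<times> cls v"
  then obtain u' v' where p: "p = (u', v')" "(u, u') \<in> wgwa_rel R \<sigma> t" "(v, v') \<in> wgwa_rel R \<sigma> t"
    by (auto simp: wgwa_class_def)
  then show "(case p of (u, v) \<Rightarrow> cls (Mul u v)) = cls (Mul u v)"
    by (simp add: cls_eq[OF wgwa_rel.mul_cong[OF p(2,3)]])
qed

end

locale wgwa_left_module = wgwa_base R \<sigma> t + M?: left_module "wgwa R \<sigma> t" M
  for R :: "('r, 'a) ring_scheme" (structure) and \<sigma> t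
    and M :: "('r wgwa_term set, 'm, 'b) module_scheme"
begin

text \<open>Terms act directly on M, so each rule of \<open>wgwa_rel\<close> becomes an identity of
  operators without computing in the quotient ring.\<close>

definition tact :: "'r wgwa_term \<Rightarrow> 'm \<Rightarrow> 'm" where "tact u v = cls u \<odot>\<^bsub>M\<^esub> v"
abbreviation ract :: "'r \<Rightarrow> 'm \<Rightarrow> 'm" (infixr \<open>\<star>\<close> 75) where "r \<star> v \<equiv> tact (Coeff r) v"
abbreviation "X \<equiv> tact GenX"
abbreviation "Y \<equiv> tact GenY"
abbreviation "addM \<equiv> add M"
notation addM (infixl \<open>+\<^sub>M\<close> 65)
abbreviation "zeroM \<equiv> zero M"
notation zeroM (\<open>0\<^sub>M\<close>)

lemma tact_closed [simp]: "u \<in> wgwa_terms R \<Longrightarrow> v \<in> carrier M \<Longrightarrow> tact u v \<in> carrier M"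
  by (simp add: tact_def)

lemma tact_plus: "u \<in> wgwa_terms R \<Longrightarrow> v \<in> carrier M \<Longrightarrow> w \<in> carrier M \<Longrightarrow>
    tact u (v +\<^sub>M w) = tact u v +\<^sub>M tact u w"
  by (simp add: tact_def M.smult_r_distr)

lemma tact_Add: "u \<in> wgwa_terms R \<Longrightarrow> w \<in> wgwa_terms R \<Longrightarrow> v \<in> carrier M \<Longrightarrow>
    tact (Add u w) v = tact u v +\<^sub>M tact w v"
  by (simp add: tact_def M.smult_l_distr flip: cls_add)

lemma tact_Mul: "u \<in> wgwa_terms R \<Longrightarrow> w \<in> wgwa_terms R \<Longrightarrow> v \<in> carrier M \<Longrightarrow>
    tact (Mul u w) v = tact u (tact w v)"
  by (simp add: tact_def M.smult_assoc1 flip: cls_mult)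

lemma tact_eq: "(u, w) \<in> wgwa_rel R \<sigma> t \<Longrightarrow> tact u v = tact w v"
  by (simp add: tact_def cls_eq)

lemma tact_zero [simp]: "u \<in> wgwa_terms R \<Longrightarrow> tact u 0\<^sub>M = 0\<^sub>M"
  using tact_plus[of u "0\<^sub>M" "0\<^sub>M"] by (simp add: M.add.l_cancel_one)

lemma ract_one [simp]: "v \<in> carrier M \<Longrightarrow> \<one> \<star> v = v"
proof -
  have "cls (Coeff \<one>) = \<one>\<^bsub>A\<^esub>" by (simp add: wgwa_def)
  then show "v \<in> carrier M \<Longrightarrow> \<one> \<star> v = v" by (simp add: tact_def)
qed

lemma ract_add: "r \<in> carrier R \<Longrightarrow> s \<in> carrier R \<Longrightarrow> v \<in> carrier M \<Longrightarrow>
    (r \<oplus> s) \<star> v = r \<star> v +\<^sub>M s \<star> v"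
  by (simp add: tact_eq[OF wgwa_rel.coeff_add, symmetric] tact_Add)

lemma ract_mult: "r \<in> carrier R \<Longrightarrow> s \<in> carrier R \<Longrightarrow> v \<in> carrier M \<Longrightarrow>
    (r \<otimes> s) \<star> v = r \<star> s \<star> v"
  by (simp add: tact_eq[OF wgwa_rel.coeff_mul, symmetric] tact_Mul)

lemma ract_zero [simp]: "v \<in> carrier M \<Longrightarrow> \<zero> \<star> v = 0\<^sub>M"
  using ract_add[of \<zero> \<zero> v] by (simp add: M.add.l_cancel_one)

lemma ract_minus:
  assumes "r \<in> carrier R" "v \<in> carrier M"
  shows "(\<ominus> r) \<star> v = \<ominus>\<^bsub>M\<^esub> (r \<star> v)"
proof -
  have "(\<ominus> r) \<star> v +\<^sub>M r \<star> v = 0\<^sub>M"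
    using assms by (simp add: R.l_neg flip: ract_add)
  then show ?thesis
    using assms by (simp add: M.minus_equality)
qed

lemma YX: "v \<in> carrier M \<Longrightarrow> Y (X v) = t \<star> v"
  by (simp add: tact_eq[OF wgwa_rel.YX, symmetric] tact_Mul)

lemma XY: "v \<in> carrier M \<Longrightarrow> X (Y v) = \<sigma> t \<star> v"
  by (simp add: tact_eq[OF wgwa_rel.XY, symmetric] tact_Mul)

lemma Xr: "r \<in> carrier R \<Longrightarrow> v \<in> carrier M \<Longrightarrow> X (r \<star> v) = \<sigma> r \<star> X v"
  using tact_eq[OF wgwa_rel.Xr[of r R \<sigma> t], of v] by (simp add: tact_Mul)

lemma rY: "r \<in> carrier R \<Longrightarrow> v \<in> carrier M \<Longrightarrow> r \<star> Y v = Y (\<sigma> r \<star> v)"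
  using tact_eq[OF wgwa_rel.rY[of r R \<sigma> t], of v] by (simp add: tact_Mul)

text \<open>No check is needed that the module on the right is one: its operations are transported
  along \<open>\<psi>\<close>, and in particular \<^const>\<open>wgwa_eval\<close> is constant on classes.\<close>

lemma wgwa_module_iso:
  assumes bij: "bij_betw \<psi> C (carrier M)"
    and pl: "\<And>v w. \<lbrakk>v \<in> C; w \<in> C\<rbrakk> \<Longrightarrow> pl v w \<in> C \<and> \<psi> (pl v w) = \<psi> v +\<^sub>M \<psi> w"
    and \<rho>: "\<And>r v. \<lbrakk>r \<in> carrier R; v \<in> C\<rbrakk> \<Longrightarrow> \<rho> r v \<in> C \<and> \<psi> (\<rho> r v) = r \<star> \<psi> v"
    and x: "\<And>v. v \<in> C \<Longrightarrow> x v \<in> C \<and> \<psi> (x v) = X (\<psi> v)"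
    and y: "\<And>v. v \<in> C \<Longrightarrow> y v \<in> C \<and> \<psi> (y v) = Y (\<psi> v)"
  shows "left_module_isomorphic A M (wgwa_module C z pl \<rho> x y)"
proof -
  let ?N = "wgwa_module C z pl \<rho> x y"
  have mem: "\<psi> v \<in> carrier M" if "v \<in> C" for v
    using bij that by (auto simp: bij_betw_def)
  have eval: "wgwa_eval pl \<rho> x y u v \<in> C \<and> \<psi> (wgwa_eval pl \<rho> x y u v) = tact u (\<psi> v)"
    if "u \<in> wgwa_terms R" "v \<in> C" for u v
    using that
  proof (induction u arbitrary: v)
    case (Add u w)
    then show ?case using pl mem by (simp add: tact_Add)
  next
    case (Mul u w)
    then show ?case using mem by (simp add: tact_Mul)
  qed (use \<rho> x y in auto)
  have smult: "cls u \<odot>\<^bsub>?N\<^esub> v \<in> C \<and> \<psi> (cls u \<odot>\<^bsub>?N\<^esub> v) = cls u \<odot>\<^bsub>M\<^esub> \<psi> v"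
    if u: "u \<in> wgwa_terms R" and v: "v \<in> C" for u v
  proof -
    \<comment> \<open>Two representatives of a class act equally on M, hence their values have the
      same image under \<psi>, which is injective on C.\<close>
    have "wgwa_eval pl \<rho> x y u' v = wgwa_eval pl \<rho> x y u v" if "u' \<in> cls u" for u'
    proof -
      have rel: "(u, u') \<in> wgwa_rel R \<sigma> t"
        using that by (simp add: wgwa_class_def)
      then have "\<psi> (wgwa_eval pl \<rho> x y u' v) = \<psi> (wgwa_eval pl \<rho> x y u v)"
        using eval u v rel_terms[OF rel] tact_eq[OF rel] by simp
      then show ?thesis
        using bij eval u v rel_terms[OF rel] by (meson bij_betw_def inj_onD)
    qed
    then have "cls u \<odot>\<^bsub>?N\<^esub> v = wgwa_eval pl \<rho> x y u v"
      unfolding wgwa_module_def module.simps by (rule the_elem_image_const[OF mem_cls[OF u]])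
    then show ?thesis
      using eval[OF u v] by (simp add: tact_def)
  qed
  define \<phi> where "\<phi> = inv_into C \<psi>"
  have \<phi>: "bij_betw \<phi> (carrier M) C"
    unfolding \<phi>_def using bij by (rule bij_betw_inv_into)
  have \<phi>_eq: "\<phi> v = w" if "w \<in> C" "\<psi> w = v" for v w
    using that bij by (auto simp: \<phi>_def bij_betw_def)
  have \<psi>\<phi>: "\<phi> v \<in> C" "\<psi> (\<phi> v) = v" if "v \<in> carrier M" for v
    using that bij \<phi> by (auto simp: \<phi>_def bij_betw_inv_into_right bij_betw_def inv_into_into)
  have "\<phi> (v +\<^sub>M w) = pl (\<phi> v) (\<phi> w)" if "v \<in> carrier M" "w \<in> carrier M" for v w
    using that pl \<psi>\<phi> by (intro \<phi>_eq) auto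
  moreover have "\<phi> (a \<odot>\<^bsub>M\<^esub> v) = a \<odot>\<^bsub>?N\<^esub> \<phi> v" if a: "a \<in> carrier A" and v: "v \<in> carrier M" for a v
  proof -
    obtain u where "u \<in> wgwa_terms R" "a = cls u"
      using a carrier_A by blast
    then show ?thesis
      using smult \<psi>\<phi>[OF v] by (intro \<phi>_eq) auto
  qed
  ultimately show ?thesis
    unfolding left_module_isomorphic_def using \<phi>
    by (intro exI[of _ \<phi>]) (simp add: wgwa_module_def)
qed

lemma submoduleI':
  assumes "H \<subseteq> carrier M" "0\<^sub>M \<in> H" "\<And>v w. \<lbrakk>v \<in> H; w \<in> H\<rbrakk> \<Longrightarrow> v +\<^sub>M w \<in> H"
    and "\<And>r v. \<lbrakk>r \<in> carrier R; v \<in> H\<rbrakk> \<Longrightarrow> r \<star> v \<in> H"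
    and "\<And>v. v \<in> H \<Longrightarrow> X v \<in> H" "\<And>v. v \<in> H \<Longrightarrow> Y v \<in> H"
  shows "submodule H A M"
proof -
  have tact: "tact u v \<in> H" if "u \<in> wgwa_terms R" "v \<in> H" for u v
    using that
  proof (induction u arbitrary: v)
    case (Add u w)
    then show ?case using assms(1,3) by (subst tact_Add) auto
  next
    case (Mul u w)
    then show ?case using assms(1) by (subst tact_Mul) auto
  qed (use assms in auto)
  have "\<ominus>\<^bsub>M\<^esub> v \<in> H" if "v \<in> H" for v
    using assms(1) assms(4)[of "\<ominus> \<one>" v] that by (auto simp: ract_minus)
  then have "subgroup H (add_monoid M)"
    using assms(1,2,3) by (intro M.add.subgroupI) auto
  moreover have "a \<odot>\<^bsub>M\<^esub> v \<in> H" if a: "a \<in> carrier A" and v: "v \<in> H" for a v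
  proof -
    obtain u where "u \<in> wgwa_terms R" "a = cls u"
      using a carrier_A by blast
    then show ?thesis
      using tact[of u v] v by (simp add: tact_def)
  qed
  ultimately show ?thesis
    by (simp add: submodule_def submodule_axioms_def)
qed

end

section \<open>Maximal ideals and essential endomorphisms\<close>

locale wgwa_essential = wgwa_base +
  assumes essential: "essential_endo R \<sigma>"
begin

abbreviation "Max_R \<equiv> max_ideals R"

definition pred :: "'a set \<Rightarrow> 'a set" where "pred p = {r \<in> carrier R. \<sigma> r \<in> p}"

lemma max_maximalideal: "p \<in> Max_R \<Longrightarrow> maximalideal p R"
  by (simp add: max_ideals_def)

lemma max_ideal: "p \<in> Max_R \<Longrightarrow> ideal p R"
  by (simp add: max_maximalideal maximalideal.axioms(1))

lemma max_subset: "p \<in> Max_R \<Longrightarrow> r \<in> p \<Longrightarrow> r \<in> carrier R"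
  using max_ideal ideal.Icarr by fast

lemma max_zero: "p \<in> Max_R \<Longrightarrow> \<zero> \<in> p"
  by (meson additive_subgroup.zero_closed ideal.axioms(1) max_ideal)

lemma max_add: "p \<in> Max_R \<Longrightarrow> r \<in> p \<Longrightarrow> s \<in> p \<Longrightarrow> r \<oplus> s \<in> p"
  by (meson additive_subgroup.a_closed ideal.axioms(1) max_ideal)

lemma max_minus: "p \<in> Max_R \<Longrightarrow> r \<in> p \<Longrightarrow> \<ominus> r \<in> p"
  by (meson additive_subgroup.a_inv_closed ideal.axioms(1) max_ideal R.abelian_group_axioms)

lemma max_mult: "p \<in> Max_R \<Longrightarrow> r \<in> p \<Longrightarrow> s \<in> carrier R \<Longrightarrow> s \<otimes> r \<in> p"
  by (simp add: ideal.I_l_closed max_ideal)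

lemma max_mult': "p \<in> Max_R \<Longrightarrow> r \<in> p \<Longrightarrow> s \<in> carrier R \<Longrightarrow> r \<otimes> s \<in> p"
  by (simp add: ideal.I_r_closed max_ideal)

lemma max_one: "p \<in> Max_R \<Longrightarrow> \<one> \<notin> p"
  using ideal.one_imp_carrier max_ideal max_maximalideal maximalideal.I_notcarr by metis

lemma max_inverse:
  assumes p: "p \<in> Max_R" and r: "r \<in> carrier R" "r \<notin> p"
  shows "\<exists>s \<in> carrier R. s \<otimes> r \<ominus> \<one> \<in> p"
proof -
  interpret p: ideal p R using p by (rule max_ideal)
  interpret fld: field "R Quot p"
    using maximalideal.quotient_is_field[OF max_maximalideal[OF p] R.is_cring] .
  have quot: "C \<in> carrier (R Quot p) \<longleftrightarrow> (\<exists>s \<in> carrier R. C = p +> s)" for C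
    by (auto simp: FactRing_def A_RCOSETS_defs a_r_coset_def)
  have "p +> r \<noteq> \<zero>\<^bsub>R Quot p\<^esub>"
    using r p.a_rcos_self by (force simp: FactRing_def)
  then have "p +> r \<in> Units (R Quot p)"
    using r quot fld.field_Units by blast
  then obtain C where "C \<in> carrier (R Quot p)" "C \<otimes>\<^bsub>R Quot p\<^esub> (p +> r) = \<one>\<^bsub>R Quot p\<^esub>"
    by (auto simp: Units_def)
  then obtain s where s: "s \<in> carrier R" "p +> (s \<otimes> r) = p +> \<one>"
    using r quot p.rcoset_mult_add by (auto simp: FactRing_def)
  then have "s \<otimes> r \<ominus> \<one> \<in> p"
    using r p.a_rcos_module_minus[OF R.ring_axioms, of \<one> "s \<otimes> r"] p.a_rcos_self[of "s \<otimes> r"] by simp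
  then show ?thesis
    using s by blast
qed

lemma max_prime: "p \<in> Max_R \<Longrightarrow> r \<in> carrier R \<Longrightarrow> s \<in> carrier R \<Longrightarrow> r \<otimes> s \<in> p \<Longrightarrow> r \<in> p \<or> s \<in> p"
  using primeideal.I_prime[OF R.maximalideal_prime[OF max_maximalideal]] by simp

lemma max_eqI:
  assumes "p \<in> Max_R" "q \<in> Max_R" "p \<subseteq> q"
  shows "p = q"
  using maximalideal.I_maximal[OF max_maximalideal[OF assms(1)] max_ideal[OF assms(2)] assms(3)]
    max_subset[OF assms(2)] max_one[OF assms(2)] by blast

lemma cong_mem_iff:
  assumes "p \<in> Max_R" "r \<in> carrier R" "s \<in> carrier R" "r \<ominus> s \<in> p"
  shows "r \<in> p \<longleftrightarrow> s \<in> p"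
proof
  assume "s \<in> p"
  then have "(r \<ominus> s) \<oplus> s \<in> p" using assms max_add by blast
  then show "r \<in> p" using assms by (simp add: a_minus_def R.a_assoc R.l_neg)
next
  assume "r \<in> p"
  then have "\<ominus> (r \<ominus> s) \<oplus> r \<in> p" using assms max_add max_minus by blast
  moreover have "\<ominus> (r \<ominus> s) \<oplus> r = s" using assms(2,3) by algebra
  ultimately show "s \<in> p" by simp
qed

text \<open>The elementwise form through which essentiality is used from here on: every residue
  class modulo p meets the image of \<sigma>.\<close>

lemma ess_lift:
  assumes p: "p \<in> Max_R" and r: "r \<in> carrier R"
  shows "\<exists>s \<in> carrier R. r \<ominus> \<sigma> s \<in> p"
proof -
  interpret p: ideal p R using p by (rule max_ideal)
  let ?S = "R\<lparr>carrier := \<sigma> ` carrier R\<rparr>"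
  let ?q = "\<sigma> ` carrier R \<inter> p"
  have "p +> r \<in> carrier (R Quot p)"
    using r by (auto simp: FactRing_def A_RCOSETS_defs a_r_coset_def)
  then have "p +> r \<in> (\<lambda>C. p <+> C) ` carrier (?S Quot ?q)"
    using essential p unfolding essential_endo_def by blast
  then obtain s where s: "s \<in> carrier R" "p +> r = p <+> (?q +>\<^bsub>?S\<^esub> \<sigma> s)"
    by (auto simp: FactRing_def A_RCOSETS_defs a_r_coset_def)
  have "\<sigma> s \<in> ?q +>\<^bsub>?S\<^esub> \<sigma> s"
    using s p.zero_closed by (force simp: a_r_coset_def r_coset_def intro: image_eqI[of _ _ \<zero>])
  moreover have "\<sigma> s = \<zero> \<oplus> \<sigma> s"
    using s by simp
  ultimately have "\<sigma> s \<in> p +> r"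
    unfolding s(2) set_add_defs using p.zero_closed by auto
  then have "\<sigma> s \<ominus> r \<in> p"
    using r s p.a_rcos_module_minus[OF R.ring_axioms, of r "\<sigma> s"] by simp
  then have "\<ominus> (\<sigma> s \<ominus> r) \<in> p"
    using p max_minus by blast
  moreover have "\<ominus> (\<sigma> s \<ominus> r) = r \<ominus> \<sigma> s"
    using r s by (simp add: a_minus_def R.minus_add R.a_comm)
  ultimately show ?thesis
    using s by auto
qed

lemma mem_pred: "r \<in> pred p \<longleftrightarrow> r \<in> carrier R \<and> \<sigma> r \<in> p"
  by (simp add: pred_def)

lemma \<sigma>_minus: "r \<in> carrier R \<Longrightarrow> \<sigma> (\<ominus> r) = \<ominus> \<sigma> r"
  by (metis R.add.inv_closed R.l_neg R.minus_equality \<sigma>_add \<sigma>_closed \<sigma>_zero)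

text \<open>\<sigma> induces an embedding of R / pred p into R / p, and essentiality makes it onto,
  so R / pred p is a field. In elements: for a in J outside pred p, an inverse of \<sigma> a modulo
  p can be taken of the form \<sigma> s; then s a - 1 lies in pred p, and J contains 1.\<close>

lemma pred_max:
  assumes p: "p \<in> Max_R"
  shows "pred p \<in> Max_R"
proof -
  have idl: "ideal (pred p) R"
  proof (rule idealI[OF R.ring_axioms])
    show "subgroup (pred p) (add_monoid R)"
      using p by (intro R.add.subgroupI)
        (auto simp: pred_def \<sigma>_add \<sigma>_minus max_add max_zero max_minus intro: exI[of _ \<zero>])
  qed (auto simp: pred_def \<sigma>_mult p max_mult max_mult')
  have "maximalideal (pred p) R"
  proof (rule maximalidealI[OF idl])
    show "carrier R \<noteq> pred p"
    proof
      assume "carrier R = pred p"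
      then have "\<one> \<in> pred p" using R.one_closed by simp
      then show False using max_one[OF p] by (simp add: mem_pred)
    qed
  next
    fix J assume J: "ideal J R" "pred p \<subseteq> J" "J \<subseteq> carrier R"
    interpret J: ideal J R by fact
    show "J = pred p \<or> J = carrier R"
    proof (rule disjCI)
      assume "J \<noteq> carrier R"
      then have one: "\<one> \<notin> J"
        using J.one_imp_carrier by blast
      have "a \<in> pred p" if a: "a \<in> J" for a
      proof (rule ccontr)
        assume "a \<notin> pred p"
        then have "\<sigma> a \<notin> p" "a \<in> carrier R"
          using a J by (auto simp: pred_def)
        then obtain b where b: "b \<in> carrier R" "b \<otimes> \<sigma> a \<ominus> \<one> \<in> p"
          using max_inverse[OF p \<sigma>_closed] by blast
        obtain s where s: "s \<in> carrier R" "b \<ominus> \<sigma> s \<in> p"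
          using ess_lift[OF p b(1)] by blast
        have "(b \<otimes> \<sigma> a \<ominus> \<one>) \<ominus> (b \<ominus> \<sigma> s) \<otimes> \<sigma> a \<in> p"
          using p b s \<open>a \<in> carrier R\<close> by (simp add: a_minus_def max_add max_minus max_mult')
        moreover have "(b \<otimes> \<sigma> a \<ominus> \<one>) \<ominus> (b \<ominus> \<sigma> s) \<otimes> \<sigma> a = \<sigma> s \<otimes> \<sigma> a \<ominus> \<one>"
          using b(1) s(1) \<open>a \<in> carrier R\<close> \<sigma>_closed R.one_closed by algebra
        ultimately have "s \<otimes> a \<ominus> \<one> \<in> pred p"
          using s \<open>a \<in> carrier R\<close> by (simp add: mem_pred a_minus_def \<sigma>_add \<sigma>_mult \<sigma>_minus)
        then have "s \<otimes> a \<ominus> (s \<otimes> a \<ominus> \<one>) \<in> J"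
          using J a s by (simp add: a_minus_def J.I_l_closed subset_iff)
        moreover have "s \<otimes> a \<ominus> (s \<otimes> a \<ominus> \<one>) = \<one>"
          using s(1) \<open>a \<in> carrier R\<close> R.one_closed by algebra
        ultimately show False
          using one by simp
      qed
      then show "J = pred p"
        using J by blast
    qed
  qed
  then show ?thesis
    by (simp add: max_ideals_def)
qed

lemma pred_pow_max: "p \<in> Max_R \<Longrightarrow> (pred ^^ n) p \<in> Max_R"
  by (induction n) (auto simp: pred_max)

lemma mem_pred_pow: "r \<in> carrier R \<Longrightarrow> r \<in> (pred ^^ n) p \<longleftrightarrow> (\<sigma> ^^ n) r \<in> p"
  by (induction n arbitrary: r) (auto simp: mem_pred simp flip: funpow_swap1)

text \<open>One \<sigma> is lifted modulo p; the remaining n have to be lifted modulo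
  \<open>pred p\<close>, hence the induction over all p.\<close>

lemma ess_lift_pow:
  assumes "p \<in> Max_R" "r \<in> carrier R"
  shows "\<exists>s \<in> carrier R. r \<ominus> (\<sigma> ^^ n) s \<in> p"
  using assms
proof (induction n arbitrary: p r)
  case 0
  then show ?case
    by (intro bexI[of _ r]) (auto simp: a_minus_def R.r_neg max_zero)
next
  case (Suc n)
  obtain s where s: "s \<in> carrier R" "r \<ominus> \<sigma> s \<in> p"
    using ess_lift Suc.prems by blast
  obtain s' where s': "s' \<in> carrier R" "s \<ominus> (\<sigma> ^^ n) s' \<in> pred p"
    using Suc.IH[OF pred_max[OF Suc.prems(1)] s(1)] by blast
  have "\<sigma> s \<ominus> \<sigma> ((\<sigma> ^^ n) s') \<in> p"
    using s' s by (simp add: mem_pred a_minus_def \<sigma>_add \<sigma>_minus)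
  then have "(r \<ominus> \<sigma> s) \<oplus> (\<sigma> s \<ominus> \<sigma> ((\<sigma> ^^ n) s')) \<in> p"
    using s max_add Suc.prems by blast
  moreover have "(r \<ominus> \<sigma> s) \<oplus> (\<sigma> s \<ominus> \<sigma> ((\<sigma> ^^ n) s')) = r \<ominus> (\<sigma> ^^ Suc n) s'"
    using s(1) s'(1) Suc.prems(2) \<sigma>_closed \<sigma>_pow_closed by (simp, algebra)
  ultimately show ?case
    using s' by auto
qed

text \<open>An inclusion of maximal ideals is an equality. The condition on string families thus
  says that each member determines all the lower ones.\<close>

lemma pred_subset_iff:
  assumes "p \<in> Max_R" "q \<in> Max_R"
  shows "\<sigma> ` p \<subseteq> q \<longleftrightarrow> p = pred q"
proof
  assume "\<sigma> ` p \<subseteq> q"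
  then have "p \<subseteq> pred q"
    using assms max_subset by (auto simp: mem_pred)
  then show "p = pred q"
    using assms max_eqI pred_max by blast
qed (auto simp: pred_def)

end

section \<open>Weight spaces and projections\<close>

locale wgwa_simple_weight = wgwa_essential R \<sigma> t + wgwa_left_module R \<sigma> t M
  for R :: "('r, 'a) ring_scheme" (structure) and \<sigma> t
    and M :: "('r wgwa_term set, 'm, 'b) module_scheme" +
  assumes weight: "weight_module R \<sigma> t M"
    and simple: "simple_left_module (wgwa R \<sigma> t) M"
begin

abbreviation "W \<equiv> weight_space R \<sigma> t M"

lemma mem_W: "v \<in> W p \<longleftrightarrow> v \<in> carrier M \<and> (\<forall>r \<in> p. r \<star> v = 0\<^sub>M)"
  by (simp add: weight_space_def wgwa_coeff_def tact_def)

lemma W_carrier: "v \<in> W p \<Longrightarrow> v \<in> carrier M"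
  by (simp add: mem_W)

lemma W_zero [simp]: "p \<in> Max_R \<Longrightarrow> 0\<^sub>M \<in> W p"
  using max_subset by (auto simp: mem_W)

lemma W_add: "p \<in> Max_R \<Longrightarrow> v \<in> W p \<Longrightarrow> w \<in> W p \<Longrightarrow> v +\<^sub>M w \<in> W p"
  using max_subset by (auto simp: mem_W tact_plus)

lemma W_ract: "p \<in> Max_R \<Longrightarrow> v \<in> W p \<Longrightarrow> r \<in> carrier R \<Longrightarrow> r \<star> v \<in> W p"
  using max_subset max_mult' by (auto simp: mem_W simp flip: ract_mult)

lemma ract_cong:
  assumes "p \<in> Max_R" "v \<in> W p" "r \<in> carrier R" "s \<in> carrier R" "r \<ominus> s \<in> p"
  shows "r \<star> v = s \<star> v"
proof -
  have "(r \<ominus> s) \<star> v +\<^sub>M s \<star> v = r \<star> v"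
    using assms W_carrier[OF assms(2)] by (simp add: R.a_assoc R.l_neg a_minus_def flip: ract_add)
  then show ?thesis
    using assms W_carrier[OF assms(2)] by (simp add: mem_W)
qed

text \<open>R acts on a weight space through the field R / p, where a nonzero scalar is
  invertible.\<close>

lemma ract_eq_zero_iff:
  assumes "p \<in> Max_R" "v \<in> W p" "r \<in> carrier R"
  shows "r \<star> v = 0\<^sub>M \<longleftrightarrow> r \<in> p \<or> v = 0\<^sub>M"
proof
  assume rv: "r \<star> v = 0\<^sub>M"
  have "v = 0\<^sub>M" if rp: "r \<notin> p"
  proof -
    obtain s where s: "s \<in> carrier R" "s \<otimes> r \<ominus> \<one> \<in> p"
      using max_inverse[OF assms(1,3) rp] by blast
    then have "s \<star> r \<star> v = v"
      using ract_cong[OF assms(1,2), of "s \<otimes> r" \<one>] assms W_carrier[OF assms(2)] by (simp add: ract_mult)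
    then show "v = 0\<^sub>M"
      using rv s by simp
  qed
  then show "r \<in> p \<or> v = 0\<^sub>M"
    by blast
qed (use assms in \<open>auto simp: mem_W\<close>)

lemma ract_invertible:
  assumes "p \<in> Max_R" "v \<in> W p" "r \<in> carrier R" "r \<notin> p"
  shows "\<exists>s \<in> carrier R. s \<star> r \<star> v = v \<and> r \<star> s \<star> v = v"
proof -
  obtain s where s: "s \<in> carrier R" "s \<otimes> r \<ominus> \<one> \<in> p"
    using max_inverse[OF assms(1,3,4)] by blast
  then have "(s \<otimes> r) \<star> v = v"
    using ract_cong[OF assms(1,2), of "s \<otimes> r" \<one>] assms W_carrier[OF assms(2)] by simp
  then show ?thesis
    using s assms W_carrier[OF assms(2)] by (intro bexI[of _ s]) (auto simp: R.m_comm simp flip: ract_mult)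
qed

lemma W_unique:
  assumes "p \<in> Max_R" "q \<in> Max_R" "v \<in> W p" "v \<in> W q" "v \<noteq> 0\<^sub>M"
  shows "p = q"
proof (rule max_eqI)
  show "p \<subseteq> q"
    using assms ract_eq_zero_iff[of q v] max_subset by (auto simp: mem_W)
qed (use assms in auto)

section \<open>Weight components\<close>

definition dec :: "'m \<Rightarrow> ('r set \<Rightarrow> 'm) \<Rightarrow> bool"
  where "dec v u \<longleftrightarrow> u \<in> (\<Pi>\<^sub>E I \<in> Max_R. W I) \<and> finite {I \<in> Max_R. u I \<noteq> 0\<^sub>M} \<and>
      v = finsum M u {I \<in> Max_R. u I \<noteq> 0\<^sub>M}"

definition pr :: "'r set \<Rightarrow> 'm \<Rightarrow> 'm" where "pr p v = (THE u. dec v u) p"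

lemma dec_ex1: "v \<in> carrier M \<Longrightarrow> \<exists>!u. dec v u"
  using weight unfolding weight_module_def dec_def by blast

lemma pr_eq: "dec v u \<Longrightarrow> v \<in> carrier M \<Longrightarrow> pr p v = u p"
  unfolding pr_def using dec_ex1 the1_equality by metis

lemma dec_pr: "v \<in> carrier M \<Longrightarrow> dec v (\<lambda>p. pr p v)"
  unfolding pr_def using dec_ex1[THEN theI'] by simp

text \<open>\<open>weight_module\<close> sums over the exact support of a decomposition. Allowing
  any finite superset makes the uniqueness of decompositions applicable to sums, whose support may
  shrink by cancellation.\<close>

lemma decI:
  assumes "u \<in> (\<Pi>\<^sub>E I \<in> Max_R. W I)" "finite B" "B \<subseteq> Max_R" "\<And>I. I \<in> Max_R - B \<Longrightarrow> u I = 0\<^sub>M"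
    "v = finsum M u B"
  shows "dec v u"
proof -
  have sub: "{I \<in> Max_R. u I \<noteq> 0\<^sub>M} \<subseteq> B"
    using assms(4) by blast
  moreover have "u \<in> B \<rightarrow> carrier M"
    using assms(1,3) W_carrier by (auto simp: PiE_iff)
  ultimately have "finsum M u {I \<in> Max_R. u I \<noteq> 0\<^sub>M} = finsum M u B"
    using assms(2,3) by (intro M.finsum_superset) auto
  then show ?thesis
    using assms(1,2,5) finite_subset[OF sub] by (simp add: dec_def)
qed

lemma finsum_dec:
  assumes "dec v u" "finite B" "B \<subseteq> Max_R" "{I \<in> Max_R. u I \<noteq> 0\<^sub>M} \<subseteq> B"
  shows "v = finsum M u B"
proof -
  have "u \<in> B \<rightarrow> carrier M"
    using assms(1,3) W_carrier by (auto simp: dec_def PiE_iff)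
  then have "finsum M u {I \<in> Max_R. u I \<noteq> 0\<^sub>M} = finsum M u B"
    using assms(2,3,4) by (intro M.finsum_superset) auto
  then show ?thesis
    using assms(1) by (simp add: dec_def)
qed

lemma pr_W: "v \<in> carrier M \<Longrightarrow> p \<in> Max_R \<Longrightarrow> pr p v \<in> W p"
  using dec_pr by (auto simp: dec_def PiE_iff)

lemma pr_closed [simp]: "v \<in> carrier M \<Longrightarrow> p \<in> Max_R \<Longrightarrow> pr p v \<in> carrier M"
  using pr_W W_carrier by blast

lemma pr_add:
  assumes "v \<in> carrier M" "w \<in> carrier M" "p \<in> Max_R"
  shows "pr p (v +\<^sub>M w) = pr p v +\<^sub>M pr p w"
proof -
  let ?u = "\<lambda>I \<in> Max_R. pr I v +\<^sub>M pr I w"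
  define B where "B = {I \<in> Max_R. pr I v \<noteq> 0\<^sub>M} \<union> {I \<in> Max_R. pr I w \<noteq> 0\<^sub>M}"
  have B: "finite B" "B \<subseteq> Max_R"
    using dec_pr[OF assms(1)] dec_pr[OF assms(2)] by (auto simp: B_def dec_def)
  have "dec (v +\<^sub>M w) ?u"
  proof (rule decI[OF _ B])
    show "?u \<in> (\<Pi>\<^sub>E I \<in> Max_R. W I)"
      using assms pr_W W_add by auto
    have "finsum M ?u B = finsum M (\<lambda>I. pr I v +\<^sub>M pr I w) B"
      using B assms by (intro M.finsum_cong') auto
    also have "\<dots> = finsum M (\<lambda>I. pr I v) B +\<^sub>M finsum M (\<lambda>I. pr I w) B"
      using B assms by (intro M.finsum_addf) auto
    also have "\<dots> = v +\<^sub>M w"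
      using finsum_dec[OF dec_pr[OF assms(1)] B] finsum_dec[OF dec_pr[OF assms(2)] B]
      by (simp add: B_def)
    finally show "v +\<^sub>M w = finsum M ?u B" ..
  qed (auto simp: B_def)
  then show ?thesis
    using assms by (simp add: pr_eq)
qed

lemma pr_of_W:
  assumes "p \<in> Max_R" "q \<in> Max_R" "v \<in> W p"
  shows "pr q v = (if q = p then v else 0\<^sub>M)"
proof -
  have "dec v (\<lambda>I \<in> Max_R. if I = p then v else 0\<^sub>M)"
    by (rule decI[of _ "{p}"]) (use assms W_carrier in auto)
  then show ?thesis
    using pr_eq[of v _ q] assms W_carrier by auto
qed

lemma pr_zero [simp]: "p \<in> Max_R \<Longrightarrow> pr p 0\<^sub>M = 0\<^sub>M"
  by (subst pr_of_W[of p]) auto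

lemma pr_ract:
  assumes "v \<in> carrier M" "r \<in> carrier R" "p \<in> Max_R"
  shows "pr p (r \<star> v) = r \<star> pr p v"
proof -
  let ?u = "\<lambda>I \<in> Max_R. r \<star> pr I v"
  define B where "B = {I \<in> Max_R. pr I v \<noteq> 0\<^sub>M}"
  have B: "finite B" "B \<subseteq> Max_R"
    using dec_pr[OF assms(1)] by (auto simp: B_def dec_def)
  have "dec (r \<star> v) ?u"
  proof (rule decI[OF _ B])
    show "?u \<in> (\<Pi>\<^sub>E I \<in> Max_R. W I)"
      using assms pr_W W_ract by auto
    have "r \<star> v = r \<star> finsum M (\<lambda>I. pr I v) B"
      using finsum_dec[OF dec_pr[OF assms(1)] B] by (simp add: B_def)
    also have "\<dots> = finsum M (\<lambda>I. r \<star> pr I v) B"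
      using B assms by (intro M.finsum_additive[OF M.abelian_monoid_axioms]) (auto simp: tact_plus)
    also have "\<dots> = finsum M ?u B"
      using B assms by (intro M.finsum_cong') auto
    finally show "r \<star> v = finsum M ?u B" .
  qed (use assms in \<open>auto simp: B_def\<close>)
  then show ?thesis
    using assms by (simp add: pr_eq)
qed


subsection \<open>Additive spans\<close>

text \<open>Sums without scalars or negatives suffice: where a submodule is wanted, G is closed
  under R, and R contains -1.\<close>

inductive_set spn :: "'m set \<Rightarrow> 'm set" for G where
  zero: "0\<^sub>M \<in> spn G"
| add: "g \<in> G \<Longrightarrow> v \<in> spn G \<Longrightarrow> g +\<^sub>M v \<in> spn G"

lemma spn_carrier:
  assumes "G \<subseteq> carrier M" "v \<in> spn G"
  shows "v \<in> carrier M"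
  using assms(2) by induction (use assms(1) in auto)

lemma spn_base: "G \<subseteq> carrier M \<Longrightarrow> g \<in> G \<Longrightarrow> g \<in> spn G"
  using spn.add[OF _ spn.zero, of g G] by auto

lemma spn_plus:
  assumes "G \<subseteq> carrier M" "v \<in> spn G" "w \<in> spn G"
  shows "v +\<^sub>M w \<in> spn G"
  using assms(2)
proof induction
  case zero
  then show ?case using assms spn_carrier by simp
next
  case (add g v)
  then have "g +\<^sub>M v +\<^sub>M w = g +\<^sub>M (v +\<^sub>M w)"
    using assms spn_carrier by (intro M.a_assoc) auto
  then show ?case
    using add spn.add by simp
qed

lemma spn_finsum:
  assumes "G \<subseteq> carrier M" "\<And>i. i \<in> B \<Longrightarrow> f i \<in> spn G"
  shows "finsum M f B \<in> spn G"
  using assms(2)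
proof (induction B rule: infinite_finite_induct)
  case (insert x F)
  then have "f \<in> F \<rightarrow> carrier M" "f x \<in> carrier M"
    using spn_carrier[OF assms(1)] by auto
  then show ?case
    using insert assms spn_plus by simp
qed (auto intro: spn.zero)

lemma spn_least:
  assumes "v \<in> spn G" "G \<subseteq> H" "0\<^sub>M \<in> H" "\<And>v w. v \<in> H \<Longrightarrow> w \<in> H \<Longrightarrow> v +\<^sub>M w \<in> H"
  shows "v \<in> H"
  using assms(1) by induction (use assms in auto)

lemma mem_spn_weights:
  assumes "v \<in> carrier M" "G \<subseteq> carrier M" "\<And>p. p \<in> Max_R \<Longrightarrow> pr p v \<noteq> 0\<^sub>M \<Longrightarrow> pr p v \<in> spn G"
  shows "v \<in> spn G"
proof -
  have "v = finsum M (\<lambda>I. pr I v) {I \<in> Max_R. pr I v \<noteq> 0\<^sub>M}"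
    using dec_pr[OF assms(1)] by (simp add: dec_def)
  also have "\<dots> \<in> spn G"
    using assms by (intro spn_finsum) auto
  finally show ?thesis .
qed

lemma eq_zero_weights:
  assumes "v \<in> carrier M" "\<And>p. p \<in> Max_R \<Longrightarrow> pr p v = 0\<^sub>M"
  shows "v = 0\<^sub>M"
  using mem_spn_weights[of v "{}"] assms by (auto elim: spn.cases)

text \<open>Every application of simplicity to a submodule of M goes through this criterion, which
  asks for X and Y on the spanning set alone.\<close>

lemma spn_submodule:
  assumes G: "G \<subseteq> carrier M" and g: "g \<in> G" "g \<noteq> 0\<^sub>M"
    and ract: "\<And>r g. r \<in> carrier R \<Longrightarrow> g \<in> G \<Longrightarrow> r \<star> g \<in> G"
    and X: "\<And>g. g \<in> G \<Longrightarrow> X g \<in> spn G" and Y: "\<And>g. g \<in> G \<Longrightarrow> Y g \<in> spn G"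
  shows "spn G = carrier M"
proof -
  have tact: "tact u v \<in> spn G"
    if u: "u \<in> wgwa_terms R" "\<And>g. g \<in> G \<Longrightarrow> tact u g \<in> spn G" and "v \<in> spn G" for u v
    using \<open>v \<in> spn G\<close>
  proof induction
    case zero
    then show ?case using u by (simp add: spn.zero)
  next
    case (add g v)
    then show ?case using u G spn_carrier spn_plus by (simp add: tact_plus subset_iff)
  qed
  have "submodule (spn G) A M"
  proof (rule submoduleI')
    show "r \<star> v \<in> spn G" if "r \<in> carrier R" "v \<in> spn G" for r v
      using that tact[of "Coeff r" v] ract spn_base[OF G] by simp
  qed (use G spn_carrier spn_plus X Y tact in \<open>auto intro: spn.zero\<close>)
  moreover have "spn G \<noteq> {0\<^sub>M}"
    using spn_base[OF G g(1)] g(2) by auto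
  ultimately show ?thesis
    using simple unfolding simple_left_module_def by blast
qed

text \<open>The projection to q fixes v and kills each generator of another weight, so v is a sum of
  generators of weight q. H can be any additively closed set, for example the image of another
  weight space or just zero.\<close>

lemma spn_weight:
  assumes G: "G \<subseteq> carrier M" "spn G = carrier M"
    and "\<And>g. g \<in> G \<Longrightarrow> \<exists>p \<in> Max_R. g \<in> W p"
    and q: "q \<in> Max_R" and H: "0\<^sub>M \<in> H" "\<And>v w. v \<in> H \<Longrightarrow> w \<in> H \<Longrightarrow> v +\<^sub>M w \<in> H"
    and GH: "\<And>g. g \<in> G \<Longrightarrow> g \<in> W q \<Longrightarrow> g \<noteq> 0\<^sub>M \<Longrightarrow> g \<in> H"
    and v: "v \<in> W q"
  shows "v \<in> H"
proof -
  have "pr q v \<in> H" if "v \<in> spn G" for v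
    using that
  proof induction
    case (add g v)
    obtain p where "p \<in> Max_R" "g \<in> W p"
      using add assms(3) by blast
    then have "pr q g \<in> H"
      using q H(1) GH[OF add(1)] pr_of_W[of p q g] by (cases "g = 0\<^sub>M") auto
    moreover have "g \<in> carrier M" "v \<in> carrier M"
      using G(1) add(1) spn_carrier[OF G(1) add(2)] by auto
    ultimately show ?case
      using H(2) q add(3) by (simp add: pr_add)
  qed (use q H in simp)
  then show ?thesis
    using pr_of_W[OF q q v] W_carrier[OF v] G(2) by metis
qed


subsection \<open>The action of the generators on weight spaces\<close>

lemma Y_W: "p \<in> Max_R \<Longrightarrow> v \<in> W p \<Longrightarrow> Y v \<in> W (pred p)"
  by (simp add: mem_W mem_pred rY)

lemma Y_pow_W: "p \<in> Max_R \<Longrightarrow> v \<in> W p \<Longrightarrow> (Y ^^ n) v \<in> W ((pred ^^ n) p)"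
  by (induction n) (auto intro: Y_W pred_pow_max)

text \<open>For r in p the scalar \<sigma> r kills X v and hence its component at q, so p lies in
  pred q and equals it by maximality. Different q may occur for one v.\<close>

lemma X_weight:
  assumes "p \<in> Max_R" "q \<in> Max_R" "v \<in> W p" "pr q (X v) \<noteq> 0\<^sub>M"
  shows "p = pred q"
proof -
  note v = W_carrier[OF assms(3)]
  have "\<sigma> r \<in> q" if "r \<in> p" for r
  proof -
    have r: "r \<in> carrier R" using max_subset assms that by blast
    have "\<sigma> r \<star> pr q (X v) = 0\<^sub>M"
      using assms r v that by (simp add: mem_W flip: pr_ract Xr)
    then show ?thesis
      using ract_eq_zero_iff[OF assms(2) pr_W] assms r v by simp
  qed
  then show ?thesis
    using assms pred_subset_iff by blast
qed

lemma Y_pow_closed [simp]: "v \<in> carrier M \<Longrightarrow> (Y ^^ n) v \<in> carrier M"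
  by (induction n) auto

lemma X_pow_closed [simp]: "v \<in> carrier M \<Longrightarrow> (X ^^ n) v \<in> carrier M"
  by (induction n) auto

lemma Y_pow_plus: "v \<in> carrier M \<Longrightarrow> w \<in> carrier M \<Longrightarrow> (Y ^^ n) (v +\<^sub>M w) = (Y ^^ n) v +\<^sub>M (Y ^^ n) w"
  by (induction n) (auto simp: tact_plus)

lemma X_pow_plus: "v \<in> carrier M \<Longrightarrow> w \<in> carrier M \<Longrightarrow> (X ^^ n) (v +\<^sub>M w) = (X ^^ n) v +\<^sub>M (X ^^ n) w"
  by (induction n) (auto simp: tact_plus)

lemma Y_pow_zero [simp]: "(Y ^^ n) 0\<^sub>M = 0\<^sub>M"
  by (induction n) auto

lemma X_pow_zero [simp]: "(X ^^ n) 0\<^sub>M = 0\<^sub>M"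
  by (induction n) auto

lemma r_Y_pow: "r \<in> carrier R \<Longrightarrow> v \<in> carrier M \<Longrightarrow> r \<star> (Y ^^ n) v = (Y ^^ n) ((\<sigma> ^^ n) r \<star> v)"
  by (induction n arbitrary: r) (auto simp: rY funpow_swap1[of \<sigma>])

lemma X_pow_r: "r \<in> carrier R \<Longrightarrow> v \<in> carrier M \<Longrightarrow> (X ^^ n) (r \<star> v) = (\<sigma> ^^ n) r \<star> (X ^^ n) v"
  by (induction n) (auto simp: Xr)

text \<open>Moving a scalar leftwards past Y needs a preimage under \<sigma>, which essentiality
  provides only modulo p. The equivalence records that nonzero residues stay nonzero.\<close>

lemma Y_pow_r:
  assumes p: "p \<in> Max_R" and v: "v \<in> W p" and r: "r \<in> carrier R"
  shows "\<exists>s \<in> carrier R. (s \<in> (pred ^^ n) p \<longleftrightarrow> r \<in> p) \<and> (Y ^^ n) (r \<star> v) = s \<star> (Y ^^ n) v"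
proof -
  obtain s where s: "s \<in> carrier R" "r \<ominus> (\<sigma> ^^ n) s \<in> p"
    using ess_lift_pow[OF p r] by blast
  then have "r \<star> v = (\<sigma> ^^ n) s \<star> v" "r \<in> p \<longleftrightarrow> (\<sigma> ^^ n) s \<in> p"
    using p v r by (auto intro: ract_cong simp: cong_mem_iff[of p r])
  then show ?thesis
    using s v W_carrier by (intro bexI[of _ s]) (auto simp: mem_pred_pow r_Y_pow)
qed

lemma nontrivial_weight: obtains p v where "p \<in> Max_R" "v \<in> W p" "v \<noteq> 0\<^sub>M"
proof -
  have "carrier M \<noteq> {0\<^sub>M}"
    using simple by (simp add: simple_left_module_def)
  then obtain v where v: "v \<in> carrier M" "v \<noteq> 0\<^sub>M"
    by (metis M.zero_closed is_singletonI' is_singleton_the_elem singletonD empty_iff)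
  then obtain p where "p \<in> Max_R" "pr p v \<noteq> 0\<^sub>M"
    using eq_zero_weights by blast
  then show ?thesis
    using v pr_W that by blast
qed

end

section \<open>Recognizing string modules\<close>

context wgwa_essential
begin

lemma quot_zero: "\<zero>\<^bsub>R Quot p\<^esub> = p"
  by (simp add: FactRing_def)

lemma quot_carrier: "C \<in> carrier (R Quot p) \<longleftrightarrow> (\<exists>r \<in> carrier R. C = p +> r)"
  by (auto simp: FactRing_def A_RCOSETS_defs a_r_coset_def)

lemma coset_closed [simp]: "r \<in> carrier R \<Longrightarrow> p +> r \<in> carrier (R Quot p)"
  using quot_carrier by blast

context
  fixes p assumes p: "p \<in> Max_R"
begin

interpretation p: ideal p R using p by (rule max_ideal)

lemma quot_add: "r \<in> carrier R \<Longrightarrow> s \<in> carrier R \<Longrightarrow> (p +> r) \<oplus>\<^bsub>R Quot p\<^esub> (p +> s) = p +> (r \<oplus> s)"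
  by (simp add: FactRing_def p.a_rcos_sum)

lemma quot_mult: "r \<in> carrier R \<Longrightarrow> s \<in> carrier R \<Longrightarrow> (p +> r) \<otimes>\<^bsub>R Quot p\<^esub> (p +> s) = p +> (r \<otimes> s)"
  by (simp add: FactRing_def p.rcoset_mult_add)

lemma mem_coset: "r \<in> carrier R \<Longrightarrow> s \<in> p +> r \<longleftrightarrow> s \<in> carrier R \<and> s \<ominus> r \<in> p"
  using p.a_rcos_module_minus[OF R.ring_axioms] p.a_elemrcos_carrier by blast

lemma coset_zero [simp]: "p +> \<zero> = p"
  using p.a_subset by simp

lemma coset_eq_iff:
  assumes "r \<in> carrier R" "s \<in> carrier R"
  shows "p +> r = p +> s \<longleftrightarrow> r \<ominus> s \<in> p"
proof
  assume "p +> r = p +> s"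
  then show "r \<ominus> s \<in> p"
    using mem_coset[OF assms(2), of r] mem_coset[OF assms(1), of r] assms p max_zero
    by (simp add: a_minus_def R.r_neg)
next
  assume "r \<ominus> s \<in> p"
  then show "p +> r = p +> s"
    using mem_coset[OF assms(2), of r] assms p.a_repr_independence' by simp
qed

end

lemma max_mem_quot [simp]: "p \<in> Max_R \<Longrightarrow> p \<in> carrier (R Quot p)"
  using coset_closed[of \<zero> p] by simp

lemma coset_eq_self_iff: "p \<in> Max_R \<Longrightarrow> r \<in> carrier R \<Longrightarrow> p +> r = p \<longleftrightarrow> r \<in> p"
  using coset_eq_iff[of p r \<zero>] by (simp add: a_minus_def)

end

context wgwa_simple_weight
begin

definition kact :: "'r set \<Rightarrow> 'm \<Rightarrow> 'm" where "kact C v = the_elem ((\<lambda>r. r \<star> v) ` C)"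

lemma kact_coset:
  assumes "p \<in> Max_R" "v \<in> W p" "r \<in> carrier R"
  shows "kact (p +> r) v = r \<star> v"
  unfolding kact_def
proof (rule the_elem_image_const)
  show "r \<in> p +> r"
    using assms mem_coset max_zero by (simp add: a_minus_def R.r_neg)
  show "s \<star> v = r \<star> v" if "s \<in> p +> r" for s
    using that assms mem_coset by (auto intro: ract_cong)
qed

lemma finsum_ract_eq_zeroD:
  assumes J: "finite J" "D \<in> J \<rightarrow> carrier M" "finsum M D J = 0\<^sub>M"
    and T: "T \<in> carrier M \<rightarrow> carrier M"
      "\<And>v w. v \<in> carrier M \<Longrightarrow> w \<in> carrier M \<Longrightarrow> T (v +\<^sub>M w) = T v +\<^sub>M T w"
    and b: "b \<in> J" "\<And>i. i \<in> J \<Longrightarrow> i \<noteq> b \<Longrightarrow> T (D i) = 0\<^sub>M"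
  shows "T (D b) = 0\<^sub>M"
proof -
  have T0: "T 0\<^sub>M = 0\<^sub>M"
    using T(2)[of "0\<^sub>M" "0\<^sub>M"] T(1) M.add.l_cancel_one'[of "T 0\<^sub>M" "T 0\<^sub>M"] by auto
  have "T (D b) = finsum M (\<lambda>i. T (D i)) J"
    using J T b by (intro M.finsum_single[symmetric]) auto
  also have "\<dots> = T (finsum M D J)"
    using J T T0 by (intro M.finsum_additive[symmetric, OF M.abelian_monoid_axioms]) auto
  finally show ?thesis
    using J T0 by simp
qed

text \<open>If every finite \<open>J\<close> has such a \<open>T\<close>, then the family \<open>v\<close> is independent, whether or not its weights
  are distinct.\<close>

definition separates :: "(int \<Rightarrow> 'm) \<Rightarrow> int set \<Rightarrow> int \<Rightarrow> ('m \<Rightarrow> 'm) \<Rightarrow> bool"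
  where "separates v J b T \<longleftrightarrow> T \<in> carrier M \<rightarrow> carrier M \<and>
    (\<forall>x \<in> carrier M. \<forall>y \<in> carrier M. T (x +\<^sub>M y) = T x +\<^sub>M T y) \<and>
    (\<forall>r \<in> carrier R. (\<forall>i \<in> J - {b}. T (r \<star> v i) = 0\<^sub>M) \<and> (T (r \<star> v b) = 0\<^sub>M \<longrightarrow> r \<star> v b = 0\<^sub>M))"

section \<open>The string module carried by a chain of weight vectors\<close>

context
  fixes I :: "int set" and m :: "int \<Rightarrow> 'r set" and v :: "int \<Rightarrow> 'm"
  assumes fam: "string_family R \<sigma> t I m"
    and v_W: "\<And>i. i \<in> I \<Longrightarrow> v i \<in> W (m i)"
    and v_nonzero: "\<And>i. i \<in> I \<Longrightarrow> v i \<noteq> 0\<^sub>M"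
    and Y_v: "\<And>i. i \<in> I \<Longrightarrow> Y (v i) = (if i - 1 \<in> I then v (i - 1) else 0\<^sub>M)"
    and X_v: "\<And>i. i \<in> I \<Longrightarrow> i + 1 \<notin> I \<Longrightarrow> X (v i) = 0\<^sub>M"
    and independent: "\<And>J. \<lbrakk>finite J; J \<noteq> {}; J \<subseteq> I\<rbrakk> \<Longrightarrow> \<exists>b \<in> J. \<exists>T. separates v J b T"
begin

definition string_carrier :: "(int \<Rightarrow> 'r set) set"
  where "string_carrier =
    {f \<in> (\<Pi>\<^sub>E i \<in> I. carrier (R Quot m i)). finite {i \<in> I. f i \<noteq> \<zero>\<^bsub>R Quot m i\<^esub>}}"

text \<open>The value 0 outside I lets the shift condition in \<open>string_sum_shift\<close> range
  over all integers, including the ends of the string.\<close>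

definition string_term :: "(int \<Rightarrow> 'r set) \<Rightarrow> int \<Rightarrow> 'm"
  where "string_term f i = (if i \<in> I then kact (f i) (v i) else 0\<^sub>M)"

text \<open>The isomorphism to be constructed, from the string module to M. The coset m i is the
  zero of R / m i, so the index set is the support of f.\<close>

definition string_sum :: "(int \<Rightarrow> 'r set) \<Rightarrow> 'm"
  where "string_sum f = finsum M (string_term f) {i \<in> I. f i \<noteq> m i}"

lemma string_max: "i \<in> I \<Longrightarrow> m i \<in> Max_R"
  using fam by (simp add: string_family_def)

lemma string_pred: "i \<in> I \<Longrightarrow> i + 1 \<in> I \<Longrightarrow> m i = pred (m (i + 1))"
  using fam pred_subset_iff[of "m i" "m (i + 1)"] by (simp add: string_family_def)

lemma v_carrier: "i \<in> I \<Longrightarrow> v i \<in> carrier M"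
  using v_W W_carrier by blast

text \<open>Inside the string the action of X is forced by that of Y, because v i = Y v (i + 1) and
  X Y = \<sigma> t.\<close>

lemma X_v': "i \<in> I \<Longrightarrow> i + 1 \<in> I \<Longrightarrow> X (v i) = \<sigma> t \<star> v (i + 1)"
  using Y_v[of "i + 1"] XY[of "v (i + 1)"] v_carrier by simp

lemma string_rep:
  assumes "f \<in> string_carrier"
  obtains \<rho> where "\<And>i. i \<in> I \<Longrightarrow> \<rho> i \<in> carrier R" "\<And>i. i \<in> I \<Longrightarrow> f i = m i +> \<rho> i"
    "\<And>i. i \<in> I \<Longrightarrow> string_term f i = \<rho> i \<star> v i"
proof -
  have "\<forall>i \<in> I. \<exists>r. r \<in> carrier R \<and> f i = m i +> r"
    using assms quot_carrier by (auto simp: string_carrier_def PiE_iff)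
  from bchoice[OF this] obtain \<rho> where "\<forall>i \<in> I. \<rho> i \<in> carrier R \<and> f i = m i +> \<rho> i"
    by blast
  then show ?thesis
    using string_max v_W by (intro that[of \<rho>]) (auto simp: string_term_def kact_coset)
qed

lemma string_term_closed [simp]:
  assumes "f \<in> string_carrier"
  shows "string_term f i \<in> carrier M"
proof (cases "i \<in> I")
  case True
  then show ?thesis
    using string_rep[OF assms] v_W W_carrier by (metis tact_closed terms_simps(1))
qed (simp add: string_term_def)

lemma string_sum_superset:
  assumes f: "f \<in> string_carrier" and "finite B" "\<And>i. i \<in> I \<Longrightarrow> f i \<noteq> m i \<Longrightarrow> i \<in> B"
  shows "string_sum f = finsum M (string_term f) B"
  unfolding string_sum_def
proof (rule M.finsum_superset)
  obtain \<rho> where \<rho>: "\<And>i. i \<in> I \<Longrightarrow> \<rho> i \<in> carrier R" "\<And>i. i \<in> I \<Longrightarrow> f i = m i +> \<rho> i"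
    "\<And>i. i \<in> I \<Longrightarrow> string_term f i = \<rho> i \<star> v i"
    using string_rep[OF f] by blast
  fix i assume "i \<in> B - {i \<in> I. f i \<noteq> m i}"
  then show "string_term f i = 0\<^sub>M"
    using \<rho>(1,2) \<rho>(3)[of i] string_max ract_eq_zero_iff[OF string_max v_W] coset_eq_self_iff
    by (cases "i \<in> I") (auto simp: string_term_def[of f i])
qed (use assms in auto)

lemma string_supp: "f \<in> string_carrier \<Longrightarrow> finite {i \<in> I. f i \<noteq> m i}"
  by (simp add: string_carrier_def quot_zero)

lemma string_carrierI:
  assumes "\<And>i. i \<in> I \<Longrightarrow> f i \<in> carrier (R Quot m i)" "f \<in> extensional I"
    "finite B" "\<And>i. i \<in> I \<Longrightarrow> f i \<noteq> m i \<Longrightarrow> i \<in> B"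
  shows "f \<in> string_carrier"
  using assms finite_subset[of "{i \<in> I. f i \<noteq> m i}" B]
  by (auto simp: string_carrier_def quot_zero PiE_iff)

lemma string_sum_closed [simp]: "f \<in> string_carrier \<Longrightarrow> string_sum f \<in> carrier M"
  unfolding string_sum_def by (intro M.finsum_closed) auto

lemma string_X_coset:
  assumes "i \<in> I" "i + 1 \<in> I" "r \<in> carrier R"
  shows "string_X R \<sigma> t (m (i + 1)) (m i +> r) = m (i + 1) +> \<sigma> (t \<otimes> r)"
  unfolding string_X_def
proof (rule the_elem_image_const)
  show "r \<in> m i +> r"
    using assms string_max max_zero by (simp add: mem_coset a_minus_def R.r_neg)
  fix s assume "s \<in> m i +> r"
  then have s: "s \<in> carrier R" "s \<ominus> r \<in> m i"
    using assms string_max by (auto simp: mem_coset)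
  then have "\<sigma> (s \<ominus> r) \<in> m (i + 1)"
    using assms string_pred mem_pred by auto
  then have "\<sigma> t \<otimes> (\<sigma> s \<ominus> \<sigma> r) \<in> m (i + 1)"
    using assms s string_max by (simp add: a_minus_def \<sigma>_add \<sigma>_minus max_mult)
  moreover have "\<sigma> t \<otimes> (\<sigma> s \<ominus> \<sigma> r) = \<sigma> (t \<otimes> s) \<ominus> \<sigma> (t \<otimes> r)"
    using s assms by (simp add: \<sigma>_mult a_minus_def R.r_distr R.r_minus)
  ultimately show "m (i + 1) +> \<sigma> (t \<otimes> s) = m (i + 1) +> \<sigma> (t \<otimes> r)"
    using assms s string_max by (simp add: coset_eq_iff)
qed

text \<open>Two choices of s have images under \<sigma> congruent modulo m (i + 1), so they are
  congruent modulo pred (m (i + 1)) = m i.\<close>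

lemma string_Y_coset:
  assumes "i \<in> I" "i + 1 \<in> I" "r \<in> carrier R" "s \<in> carrier R" "r \<ominus> \<sigma> s \<in> m (i + 1)"
  shows "string_Y R \<sigma> (m i) (m (i + 1) +> r) = m i +> s"
  unfolding string_Y_def
proof (rule the_elem_image_const)
  have eq: "m (i + 1) +> r = m (i + 1) +> \<sigma> s"
    using assms string_max by (simp add: coset_eq_iff)
  then show "s \<in> {s \<in> carrier R. \<sigma> s \<in> m (i + 1) +> r}"
    using assms string_max max_zero by (simp add: mem_coset a_minus_def R.r_neg)
  fix s' assume "s' \<in> {s \<in> carrier R. \<sigma> s \<in> m (i + 1) +> r}"
  then have s': "s' \<in> carrier R" "\<sigma> s' \<ominus> \<sigma> s \<in> m (i + 1)"
    using assms string_max unfolding eq by (auto simp: mem_coset)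
  then have "s' \<ominus> s \<in> m i"
    using assms string_pred by (simp add: mem_pred a_minus_def \<sigma>_add \<sigma>_minus)
  then show "m i +> s' = m i +> s"
    using assms s' string_max by (simp add: coset_eq_iff)
qed

lemma string_sum_add:
  assumes fg: "f \<in> string_carrier" "g \<in> string_carrier"
  defines "h \<equiv> \<lambda>i \<in> I. f i \<oplus>\<^bsub>R Quot m i\<^esub> g i"
  shows "h \<in> string_carrier \<and> string_sum h = string_sum f +\<^sub>M string_sum g"
proof -
  let ?B = "{i \<in> I. f i \<noteq> m i} \<union> {i \<in> I. g i \<noteq> m i}"
  have B: "finite ?B"
    using fg string_supp by simp
  obtain \<rho> where \<rho>: "\<And>i. i \<in> I \<Longrightarrow> \<rho> i \<in> carrier R" "\<And>i. i \<in> I \<Longrightarrow> f i = m i +> \<rho> i"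
    "\<And>i. i \<in> I \<Longrightarrow> string_term f i = \<rho> i \<star> v i"
    using string_rep[OF fg(1)] by blast
  obtain \<rho>' where \<rho>': "\<And>i. i \<in> I \<Longrightarrow> \<rho>' i \<in> carrier R" "\<And>i. i \<in> I \<Longrightarrow> g i = m i +> \<rho>' i"
    "\<And>i. i \<in> I \<Longrightarrow> string_term g i = \<rho>' i \<star> v i"
    using string_rep[OF fg(2)] by blast
  have h: "h i = m i +> (\<rho> i \<oplus> \<rho>' i)" if "i \<in> I" for i
    using that \<rho> \<rho>' string_max by (simp add: h_def quot_add)
  have h_supp: "i \<in> ?B" if "i \<in> I" "h i \<noteq> m i" for i
  proof (rule ccontr)
    assume "i \<notin> ?B"
    then have "\<rho> i \<in> m i" "\<rho>' i \<in> m i"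
      using that(1) \<rho> \<rho>' string_max coset_eq_self_iff by auto
    then show False
      using that h \<rho> \<rho>' string_max max_add coset_eq_self_iff by simp
  qed
  have mem: "h \<in> string_carrier"
    by (rule string_carrierI[OF _ _ B h_supp]) (use h \<rho> \<rho>' in \<open>auto simp: h_def\<close>)
  have "string_sum h = finsum M (string_term h) ?B"
    using B h_supp by (rule string_sum_superset[OF mem])
  also have "\<dots> = finsum M (\<lambda>i. string_term f i +\<^sub>M string_term g i) ?B"
  proof (rule M.finsum_cong')
    fix i assume "i \<in> ?B"
    then have i: "i \<in> I" by blast
    then show "string_term h i = string_term f i +\<^sub>M string_term g i"
      using h[OF i] \<rho> \<rho>' string_max v_W v_carrier[OF i]
      by (simp add: ract_add[symmetric]) (simp add: string_term_def kact_coset)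
  qed (use fg in auto)
  also have "\<dots> = finsum M (string_term f) ?B +\<^sub>M finsum M (string_term g) ?B"
    using fg by (intro M.finsum_addf) auto
  also have "\<dots> = string_sum f +\<^sub>M string_sum g"
    using fg B by (subst (1 2) string_sum_superset[of _ ?B]) auto
  finally show ?thesis
    using mem by simp
qed

lemma string_sum_ract:
  assumes f: "f \<in> string_carrier" and r: "r \<in> carrier R"
  defines "h \<equiv> \<lambda>i \<in> I. (m i +> r) \<otimes>\<^bsub>R Quot m i\<^esub> f i"
  shows "h \<in> string_carrier \<and> string_sum h = r \<star> string_sum f"
proof -
  let ?B = "{i \<in> I. f i \<noteq> m i}"
  have B: "finite ?B"
    using f string_supp by simp
  obtain \<rho> where \<rho>: "\<And>i. i \<in> I \<Longrightarrow> \<rho> i \<in> carrier R" "\<And>i. i \<in> I \<Longrightarrow> f i = m i +> \<rho> i"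
    "\<And>i. i \<in> I \<Longrightarrow> string_term f i = \<rho> i \<star> v i"
    using string_rep[OF f] by blast
  have h: "h i = m i +> (r \<otimes> \<rho> i)" if "i \<in> I" for i
    using that \<rho> r string_max by (simp add: h_def quot_mult)
  have h_supp: "i \<in> ?B" if "i \<in> I" "h i \<noteq> m i" for i
    using that \<rho> r h string_max max_mult coset_eq_self_iff by auto
  have mem: "h \<in> string_carrier"
    by (rule string_carrierI[OF _ _ B h_supp]) (use h \<rho> r in \<open>auto simp: h_def\<close>)
  have "string_sum h = finsum M (string_term h) ?B"
    using B h_supp by (rule string_sum_superset[OF mem])
  also have "\<dots> = finsum M (\<lambda>i. r \<star> string_term f i) ?B"
  proof (rule M.finsum_cong')
    fix i assume "i \<in> ?B"
    then have i: "i \<in> I" by blast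
    then show "string_term h i = r \<star> string_term f i"
      using h[OF i] \<rho> r string_max v_W v_carrier[OF i]
      by (simp add: ract_mult[symmetric]) (simp add: string_term_def kact_coset)
  qed (use f r in auto)
  also have "\<dots> = r \<star> finsum M (string_term f) ?B"
    using f r
    by (intro M.finsum_additive[symmetric, OF M.abelian_monoid_axioms]) (auto simp: tact_plus)
  finally show ?thesis
    using mem by (simp add: string_sum_def)
qed

text \<open>The common part of the two generators: X moves the support up by d = 1 and Y down by d =
  -1, and no support may be created from nothing.\<close>

lemma string_sum_shift:
  assumes f: "f \<in> string_carrier" and u: "u \<in> {GenX, GenY}"
    and h: "\<And>i. i \<in> I \<Longrightarrow> h i \<in> carrier (R Quot m i)" "h \<in> extensional I"
    and supp: "\<And>i. i \<in> I \<Longrightarrow> h i \<noteq> m i \<Longrightarrow> i - d \<in> I \<and> f (i - d) \<noteq> m (i - d)"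
    and shift: "\<And>i. string_term h (i + d) = tact u (string_term f i)"
  shows "h \<in> string_carrier \<and> string_sum h = tact u (string_sum f)"
proof -
  let ?B = "{i \<in> I. f i \<noteq> m i}"
  let ?B' = "(\<lambda>i. i + d) ` ?B"
  have u': "u \<in> wgwa_terms R"
    using u by auto
  have B: "finite ?B'"
    using f string_supp by simp
  have h_supp: "i \<in> ?B'" if "i \<in> I" "h i \<noteq> m i" for i
    using supp[OF that] by (intro image_eqI[of _ _ "i - d"]) auto
  have mem: "h \<in> string_carrier"
    using h B h_supp by (rule string_carrierI)
  have "string_sum h = finsum M (string_term h) ?B'"
    using B h_supp by (rule string_sum_superset[OF mem])
  also have "\<dots> = finsum M (\<lambda>i. string_term h (i + d)) ?B"
    using mem by (intro M.finsum_reindex) auto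
  also have "\<dots> = finsum M (\<lambda>i. tact u (string_term f i)) ?B"
    by (simp only: shift)
  also have "\<dots> = tact u (finsum M (string_term f) ?B)"
    using f u'
    by (intro M.finsum_additive[symmetric, OF M.abelian_monoid_axioms]) (auto simp: tact_plus)
  finally show ?thesis
    using mem by (simp add: string_sum_def)
qed

lemma string_sum_X:
  assumes f: "f \<in> string_carrier"
  defines "h \<equiv> \<lambda>i \<in> I. if i - 1 \<in> I then string_X R \<sigma> t (m i) (f (i - 1)) else \<zero>\<^bsub>R Quot m i\<^esub>"
  shows "h \<in> string_carrier \<and> string_sum h = X (string_sum f)"
proof -
  obtain \<rho> where \<rho>: "\<And>i. i \<in> I \<Longrightarrow> \<rho> i \<in> carrier R" "\<And>i. i \<in> I \<Longrightarrow> f i = m i +> \<rho> i"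
    "\<And>i. i \<in> I \<Longrightarrow> string_term f i = \<rho> i \<star> v i"
    using string_rep[OF f] by blast
  have h1: "h (i + 1) = m (i + 1) +> \<sigma> (t \<otimes> \<rho> i)" if "i \<in> I" "i + 1 \<in> I" for i
    using that \<rho> string_X_coset by (simp add: h_def)
  have h0: "h i = m i" if "i \<in> I" "i - 1 \<notin> I" for i
    using that by (simp add: h_def quot_zero)
  show ?thesis
  proof (rule string_sum_shift[OF f, of _ _ 1])
    show "h i \<in> carrier (R Quot m i)" if "i \<in> I" for i
      using that h0[of i] h1[of "i - 1"] \<rho> string_max
      by (cases "i - 1 \<in> I") auto
    show "i - 1 \<in> I \<and> f (i - 1) \<noteq> m (i - 1)" if "i \<in> I" "h i \<noteq> m i" for i
    proof (rule ccontr)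
      assume *: "\<not> ?thesis"
      have "i - 1 \<in> I"
        using that h0 by blast
      with * have "\<rho> (i - 1) \<in> m (i - 1)"
        using \<rho> string_max coset_eq_self_iff by auto
      then have "t \<otimes> \<rho> (i - 1) \<in> pred (m i)"
        using that(1) \<open>i - 1 \<in> I\<close> string_pred[of "i - 1"]
          max_mult[OF string_max[OF \<open>i - 1 \<in> I\<close>] _ t_closed] by simp
      then show False
        using that h1[of "i - 1"] \<open>i - 1 \<in> I\<close> \<rho> string_max coset_eq_self_iff by (simp add: mem_pred)
    qed
    show "string_term h (i + 1) = X (string_term f i)" for i
    proof -
      \<comment> \<open>The mixed cases are the ends of the string. Below the lower end nothing is
        shifted in; at the upper end X kills v i.\<close>
      consider "i \<notin> I" "i + 1 \<notin> I" | "i \<notin> I" "i + 1 \<in> I" | "i \<in> I" "i + 1 \<notin> I"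
        | "i \<in> I" "i + 1 \<in> I"
        by blast
      then show ?thesis
      proof cases
        case 2
        then have "kact (m (i + 1) +> \<zero>) (v (i + 1)) = 0\<^sub>M"
          using string_max v_W v_carrier by (subst kact_coset) auto
        with 2 show ?thesis
          using h0[of "i + 1"] string_max by (simp add: string_term_def)
      next
        case 3
        then show ?thesis
          using \<rho> X_v v_carrier by (simp add: Xr) (simp add: string_term_def)
      next
        case 4
        have "string_term h (i + 1) = \<sigma> (t \<otimes> \<rho> i) \<star> v (i + 1)"
          using 4 h1 \<rho> string_max v_W by (simp add: string_term_def kact_coset)
        also have "\<dots> = \<sigma> (\<rho> i) \<star> X (v i)"
          using 4 \<rho> v_carrier by (simp add: X_v' \<sigma>_mult R.m_comm flip: ract_mult)
        also have "\<dots> = X (string_term f i)"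
          using 4 \<rho> v_carrier by (simp add: Xr)
        finally show ?thesis .
      qed (simp add: string_term_def)
    qed
  qed (auto simp: h_def)
qed

lemma string_sum_Y:
  assumes f: "f \<in> string_carrier"
  defines "h \<equiv> \<lambda>i \<in> I. if i + 1 \<in> I then string_Y R \<sigma> (m i) (f (i + 1)) else \<zero>\<^bsub>R Quot m i\<^esub>"
  shows "h \<in> string_carrier \<and> string_sum h = Y (string_sum f)"
proof -
  obtain \<rho> where \<rho>: "\<And>i. i \<in> I \<Longrightarrow> \<rho> i \<in> carrier R" "\<And>i. i \<in> I \<Longrightarrow> f i = m i +> \<rho> i"
    "\<And>i. i \<in> I \<Longrightarrow> string_term f i = \<rho> i \<star> v i"
    using string_rep[OF f] by blast
  \<comment> \<open>Coefficients are replaced by representatives of the form \<sigma> (\<tau> i),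
    since these pass through Y: Y (\<sigma> (\<tau> i) v i) = \<tau> i Y (v i).\<close>
  have "\<exists>s. s \<in> carrier R \<and> \<rho> i \<ominus> \<sigma> s \<in> m i" if "i \<in> I" for i
    using ess_lift[OF string_max \<rho>(1)] that by blast
  then have "\<forall>i \<in> I. \<exists>s. s \<in> carrier R \<and> \<rho> i \<ominus> \<sigma> s \<in> m i"
    by blast
  from bchoice[OF this] obtain \<tau> where "\<forall>i \<in> I. \<tau> i \<in> carrier R \<and> \<rho> i \<ominus> \<sigma> (\<tau> i) \<in> m i"
    by blast
  then have \<tau>: "\<And>i. i \<in> I \<Longrightarrow> \<tau> i \<in> carrier R" "\<And>i. i \<in> I \<Longrightarrow> \<rho> i \<ominus> \<sigma> (\<tau> i) \<in> m i"
    by simp_all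
  have h1: "h i = m i +> \<tau> (i + 1)" if "i \<in> I" "i + 1 \<in> I" for i
    using that \<rho> \<tau> string_Y_coset by (simp add: h_def)
  have h0: "h i = m i" if "i \<in> I" "i + 1 \<notin> I" for i
    using that by (simp add: h_def quot_zero)
  show ?thesis
  proof (rule string_sum_shift[OF f, of _ _ "-1"])
    show "h i \<in> carrier (R Quot m i)" if "i \<in> I" for i
      using that h0[of i] h1[of i] \<tau> string_max
      by (cases "i + 1 \<in> I") auto
    show "i - - 1 \<in> I \<and> f (i - - 1) \<noteq> m (i - - 1)" if "i \<in> I" "h i \<noteq> m i" for i
    proof (rule ccontr)
      assume *: "\<not> ?thesis"
      have i1: "i + 1 \<in> I"
        using that h0 by blast
      with * have "\<rho> (i + 1) \<in> m (i + 1)"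
        using \<rho> string_max coset_eq_self_iff by auto
      then have "\<sigma> (\<tau> (i + 1)) \<in> m (i + 1)"
        using cong_mem_iff[OF string_max[OF i1] \<rho>(1)[OF i1] \<sigma>_closed[OF \<tau>(1)[OF i1]] \<tau>(2)[OF i1]]
        by simp
      then have "\<tau> (i + 1) \<in> m i"
        using \<tau>(1)[OF i1] string_pred[OF that(1) i1] by (simp add: mem_pred)
      then show False
        using that h1[of i] i1 \<tau> string_max coset_eq_self_iff by simp
    qed
    show "string_term h (i + - 1) = Y (string_term f i)" for i
    proof -
      consider "i \<notin> I" "i - 1 \<notin> I" | "i \<notin> I" "i - 1 \<in> I" | "i \<in> I" "i - 1 \<notin> I"
        | "i \<in> I" "i - 1 \<in> I"
        by blast
      then show ?thesis
      proof cases
        case 2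
        then have "kact (m (i - 1) +> \<zero>) (v (i - 1)) = 0\<^sub>M"
          using string_max v_W v_carrier by (subst kact_coset) auto
        with 2 show ?thesis
          using h0[of "i - 1"] string_max by (simp add: string_term_def)
      next
        case i: 3
        have "Y (string_term f i) = Y (\<sigma> (\<tau> i) \<star> v i)"
          using i \<rho> \<tau> string_max v_W ract_cong[of "m i" "v i" "\<rho> i" "\<sigma> (\<tau> i)"] by simp
        also have "\<dots> = \<tau> i \<star> Y (v i)"
          using i \<tau> v_carrier by (simp only: rY)
        finally show ?thesis
          using i Y_v \<tau> by (simp add: string_term_def)
      next
        case i: 4
        have "Y (string_term f i) = Y (\<sigma> (\<tau> i) \<star> v i)"
          using i \<rho> \<tau> string_max v_W ract_cong[of "m i" "v i" "\<rho> i" "\<sigma> (\<tau> i)"] by simp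
        also have "\<dots> = \<tau> i \<star> Y (v i)"
          using i \<tau> v_carrier by (simp only: rY)
        also have "\<dots> = \<tau> i \<star> v (i - 1)"
          using i Y_v by simp
        also have "\<dots> = string_term h (i - 1)"
          using i h1[of "i - 1"] \<tau> string_max v_W by (simp add: string_term_def kact_coset)
        finally show ?thesis by simp
      qed (simp add: string_term_def)
    qed
  qed (auto simp: h_def)
qed

text \<open>The differences D i of the two expansions sum to zero. On the finite set J of nonzero
  differences, a separating T isolates one D b and forces it to vanish, so J is empty.\<close>

lemma string_sum_inj: "inj_on string_sum string_carrier"
proof (rule inj_onI)
  fix f g assume fg: "f \<in> string_carrier" "g \<in> string_carrier" and eq: "string_sum f = string_sum g"
  let ?B = "{i \<in> I. f i \<noteq> m i} \<union> {i \<in> I. g i \<noteq> m i}"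
  have B: "finite ?B"
    using fg string_supp by simp
  obtain \<rho> where \<rho>: "\<And>i. i \<in> I \<Longrightarrow> \<rho> i \<in> carrier R" "\<And>i. i \<in> I \<Longrightarrow> f i = m i +> \<rho> i"
    "\<And>i. i \<in> I \<Longrightarrow> string_term f i = \<rho> i \<star> v i"
    using string_rep[OF fg(1)] by blast
  obtain \<rho>' where \<rho>': "\<And>i. i \<in> I \<Longrightarrow> \<rho>' i \<in> carrier R" "\<And>i. i \<in> I \<Longrightarrow> g i = m i +> \<rho>' i"
    "\<And>i. i \<in> I \<Longrightarrow> string_term g i = \<rho>' i \<star> v i"
    using string_rep[OF fg(2)] by blast
  define D where "D i = (\<rho> i \<ominus> \<rho>' i) \<star> v i" for i
  have D: "D i \<in> carrier M" "string_term f i = D i +\<^sub>M string_term g i" if "i \<in> I" for i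
    using that \<rho> \<rho>' v_carrier
    by (simp_all add: D_def a_minus_def R.a_assoc R.l_neg flip: ract_add)
  have "finsum M D ?B +\<^sub>M finsum M (string_term g) ?B = finsum M (string_term f) ?B"
  proof -
    have "finsum M (string_term f) ?B = finsum M (\<lambda>i. D i +\<^sub>M string_term g i) ?B"
      using D fg by (intro M.finsum_cong') auto
    also have "\<dots> = finsum M D ?B +\<^sub>M finsum M (string_term g) ?B"
      using D fg by (intro M.finsum_addf) auto
    finally show ?thesis by simp
  qed
  moreover have "finsum M (string_term f) ?B = string_sum f" "finsum M (string_term g) ?B = string_sum g"
    using fg B by (auto intro!: string_sum_superset[symmetric])
  moreover have DB: "finsum M D ?B \<in> carrier M"
    using D by (intro M.finsum_closed) auto
  ultimately have sum: "finsum M D ?B = 0\<^sub>M"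
    using eq fg M.add.r_cancel_one by simp
  define J where "J = {i \<in> ?B. D i \<noteq> 0\<^sub>M}"
  have J: "finite J" "J \<subseteq> I" "D \<in> J \<rightarrow> carrier M"
    using B D by (auto simp: J_def)
  have "finsum M D J = finsum M D ?B"
    using B D by (intro M.finsum_superset) (auto simp: J_def)
  with sum have sumJ: "finsum M D J = 0\<^sub>M"
    by simp
  have "J = {}"
  proof (rule ccontr)
    assume "J \<noteq> {}"
    then obtain b T where bT: "b \<in> J" "T \<in> carrier M \<rightarrow> carrier M"
      "\<forall>v \<in> carrier M. \<forall>w \<in> carrier M. T (v +\<^sub>M w) = T v +\<^sub>M T w"
      "\<forall>r \<in> carrier R. (\<forall>i \<in> J - {b}. T (r \<star> v i) = 0\<^sub>M) \<and> (T (r \<star> v b) = 0\<^sub>M \<longrightarrow> r \<star> v b = 0\<^sub>M)"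
      using independent[OF J(1) \<open>J \<noteq> {}\<close> J(2)] unfolding separates_def by blast
    have \<rho>\<rho>': "\<rho> i \<ominus> \<rho>' i \<in> carrier R" if "i \<in> J" for i
      using that J \<rho> \<rho>' by blast
    have "T (D b) = 0\<^sub>M"
      by (rule finsum_ract_eq_zeroD[OF J(1,3) sumJ bT(2) _ bT(1)])
        (use bT \<rho>\<rho>' in \<open>auto simp: D_def\<close>)
    then have "D b = 0\<^sub>M"
      using bT \<rho>\<rho>' by (simp add: D_def)
    then show False
      using bT(1) by (simp add: J_def)
  qed
  then have D0: "D i = 0\<^sub>M" if "i \<in> ?B" for i
    using that by (auto simp: J_def)
  show "f = g"
  proof (rule PiE_ext)
    show "f \<in> (\<Pi>\<^sub>E i \<in> I. carrier (R Quot m i))" "g \<in> (\<Pi>\<^sub>E i \<in> I. carrier (R Quot m i))"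
      using fg by (auto simp: string_carrier_def)
    fix i assume i: "i \<in> I"
    show "f i = g i"
    proof (cases "i \<in> ?B")
      case True
      then have "\<rho> i \<ominus> \<rho>' i \<in> m i"
        using D0[of i] i \<rho>(1)[OF i] \<rho>'(1)[OF i] v_nonzero
          ract_eq_zero_iff[OF string_max[OF i] v_W[OF i], of "\<rho> i \<ominus> \<rho>' i"] by (simp add: D_def)
      then show ?thesis
        using i \<rho> \<rho>' string_max by (simp add: coset_eq_iff)
    qed (use i in auto)
  qed
qed

text \<open>The multiples of the v i already span M: X and Y carry a multiple of v i to a multiple
  of its neighbour or to zero.\<close>

lemma string_sum_surj: "carrier M \<subseteq> string_sum ` string_carrier"
proof
  let ?G = "{r \<star> v i | r i. r \<in> carrier R \<and> i \<in> I}"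
  have G: "?G \<subseteq> carrier M"
    using v_carrier by auto
  have nonempty: "\<exists>i. i \<in> I"
    using fam by (force simp: string_family_def)
  have span: "spn ?G = carrier M"
  proof -
    obtain i where i: "i \<in> I"
      using nonempty by blast
    have "v i \<in> ?G"
      using i ract_one[of "v i"] v_carrier[OF i] by (metis (mono_tags, lifting) R.one_closed mem_Collect_eq)
    then show ?thesis
    proof (rule spn_submodule[OF G])
      show "r \<star> g \<in> ?G" if "r \<in> carrier R" "g \<in> ?G" for r g
      proof -
        obtain s i where "s \<in> carrier R" "i \<in> I" "g = s \<star> v i"
          using \<open>g \<in> ?G\<close> by blast
        then have "r \<otimes> s \<in> carrier R" "i \<in> I" "r \<star> g = (r \<otimes> s) \<star> v i"
          using that(1) v_carrier by (simp_all add: ract_mult)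
        then show ?thesis by blast
      qed
      show "X g \<in> spn ?G" if g: "g \<in> ?G" for g
      proof -
        obtain r i where ri: "r \<in> carrier R" "i \<in> I" "g = r \<star> v i"
          using g by blast
        show ?thesis
        proof (cases "i + 1 \<in> I")
          case True
          then have "X g = (\<sigma> r \<otimes> \<sigma> t) \<star> v (i + 1)"
            using ri v_carrier by (simp add: Xr X_v' ract_mult)
          moreover have "\<sigma> r \<otimes> \<sigma> t \<in> carrier R"
            using ri by simp
          ultimately have "X g \<in> ?G"
            using True by blast
          then show ?thesis
            using spn_base[OF G] by blast
        next
          case False
          then show ?thesis
            using ri v_carrier X_v by (simp add: Xr spn.zero)
        qed
      qed
      show "Y g \<in> spn ?G" if g: "g \<in> ?G" for g
      proof -
        obtain r i where ri: "r \<in> carrier R" "i \<in> I" "g = r \<star> v i"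
          using g by blast
        obtain s where s: "s \<in> carrier R" "Y g = s \<star> Y (v i)"
          using Y_pow_r[OF string_max v_W, of i r 1] ri by auto
        show ?thesis
        proof (cases "i - 1 \<in> I")
          case True
          then have "Y g = s \<star> v (i - 1)"
            using s ri Y_v by simp
          then have "Y g \<in> ?G"
            using True s by blast
          then show ?thesis
            using spn_base[OF G] by blast
        next
          case False
          then show ?thesis
            using s ri Y_v by (simp add: spn.zero)
        qed
      qed
    qed (use v_nonzero i in auto)
  qed
  fix w assume "w \<in> carrier M"
  then have "w \<in> spn ?G"
    using span by simp
  then show "w \<in> string_sum ` string_carrier"
  proof (rule spn_least)
    define z where "z = (\<lambda>i \<in> I. m i)"
    have z: "z \<in> string_carrier"
      by (rule string_carrierI[of _ "{}"]) (use string_max in \<open>auto simp: z_def\<close>)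
    have "string_sum z = 0\<^sub>M"
      using string_sum_superset[OF z, of "{}"] by (simp add: z_def)
    then show "0\<^sub>M \<in> string_sum ` string_carrier"
      using z by (metis imageI)
    show "x +\<^sub>M y \<in> string_sum ` string_carrier"
      if "x \<in> string_sum ` string_carrier" "y \<in> string_sum ` string_carrier" for x y
    proof -
      obtain f g where fg: "f \<in> string_carrier" "g \<in> string_carrier" "x = string_sum f" "y = string_sum g"
        using \<open>x \<in> _\<close> \<open>y \<in> _\<close> by blast
      define h where "h = (\<lambda>i \<in> I. f i \<oplus>\<^bsub>R Quot m i\<^esub> g i)"
      have "h \<in> string_carrier" "x +\<^sub>M y = string_sum h"
        using string_sum_add[OF fg(1,2)] by (simp_all add: h_def fg)
      then show ?thesis
        by blast
    qed
    show "?G \<subseteq> string_sum ` string_carrier"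
    proof
      fix g assume "g \<in> ?G"
      then obtain r j where rj: "r \<in> carrier R" "j \<in> I" "g = r \<star> v j"
        by blast
      define h where "h = (\<lambda>i \<in> I. if i = j then m i +> r else m i)"
      have h: "h \<in> string_carrier"
        by (rule string_carrierI[of _ "{j}"])
          (use string_max rj in \<open>auto simp: h_def split: if_splits\<close>)
      have "string_sum h = finsum M (string_term h) {j}"
        by (rule string_sum_superset[OF h]) (auto simp: h_def split: if_splits)
      also have "\<dots> = g"
        using rj h string_max v_W v_carrier string_term_closed[OF h, of j]
        by (simp add: string_term_def h_def kact_coset)
      finally show "g \<in> string_sum ` string_carrier"
        using h by blast
    qed
  qed
qed

lemma string_module_iso: "left_module_isomorphic A M (string_module R \<sigma> t I m)"
  unfolding string_module_def string_carrier_def[symmetric]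
proof (rule wgwa_module_iso[where \<psi> = string_sum])
  show "bij_betw string_sum string_carrier (carrier M)"
    using string_sum_inj string_sum_surj by (auto simp: bij_betw_def)
qed (use string_sum_add string_sum_ract string_sum_X string_sum_Y in auto)

end

end

section \<open>The string cases\<close>

context wgwa_simple_weight
begin

abbreviation is_string :: bool where
  "is_string \<equiv> \<exists>I m. string_family R \<sigma> t I m \<and>
    left_module_isomorphic A M (string_module R \<sigma> t I m)"

text \<open>The orbit must not return to p itself; it may still enter a cycle that avoids p.\<close>

abbreviation aperiodic :: "'r set \<Rightarrow> bool" where "aperiodic p \<equiv> \<forall>n > 0. (pred ^^ n) p \<noteq> p"

lemma X_Y_pow: "v \<in> carrier M \<Longrightarrow> X ((Y ^^ Suc n) v) = \<sigma> t \<star> (Y ^^ n) v"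
  by (simp add: XY)

lemma Y_pow_Y_pow: "(Y ^^ a) ((Y ^^ b) v) = (Y ^^ (a + b)) v"
  by (simp add: funpow_add)

lemma X_pow_X_pow: "(X ^^ a) ((X ^^ b) v) = (X ^^ (a + b)) v"
  by (simp add: funpow_add)

section \<open>Modules with a weight vector killed by X\<close>

lemma span_down:
  assumes p: "p \<in> Max_R" and u: "u \<in> W p" "u \<noteq> 0\<^sub>M" "X u = 0\<^sub>M"
  shows "spn {r \<star> (Y ^^ n) u | r n. r \<in> carrier R} = carrier M" (is "spn ?G = _")
proof -
  note uM = W_carrier[OF u(1)]
  have G: "?G \<subseteq> carrier M"
    using uM by auto
  have "u = \<one> \<star> (Y ^^ 0) u"
    using uM by simp
  then have "u \<in> ?G"
    by blast
  then show ?thesis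
  proof (rule spn_submodule[OF G])
    show "r \<star> g \<in> ?G" if r: "r \<in> carrier R" and "g \<in> ?G" for r g
    proof -
      obtain s n where s: "s \<in> carrier R" "g = s \<star> (Y ^^ n) u"
        using \<open>g \<in> ?G\<close> by blast
      then have "r \<star> g = (r \<otimes> s) \<star> (Y ^^ n) u" "r \<otimes> s \<in> carrier R"
        using r uM by (simp_all add: ract_mult)
      then show ?thesis by blast
    qed
    show "X g \<in> spn ?G" if "g \<in> ?G" for g
    proof -
      obtain s n where s: "s \<in> carrier R" "g = s \<star> (Y ^^ n) u"
        using \<open>g \<in> ?G\<close> by blast
      show ?thesis
      proof (cases n)
        case 0
        then show ?thesis
          using s u uM by (simp add: Xr spn.zero)
      next
        case (Suc k)
        then have "X g = (\<sigma> s \<otimes> \<sigma> t) \<star> (Y ^^ k) u" "\<sigma> s \<otimes> \<sigma> t \<in> carrier R"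
          using s uM by (simp_all add: Xr XY ract_mult)
        then show ?thesis
          using spn_base[OF G] by blast
      qed
    qed
    show "Y g \<in> spn ?G" if "g \<in> ?G" for g
    proof -
      obtain s n where s: "s \<in> carrier R" "g = s \<star> (Y ^^ n) u"
        using \<open>g \<in> ?G\<close> by blast
      obtain s' where "s' \<in> carrier R" "Y g = s' \<star> (Y ^^ Suc n) u"
        using Y_pow_r[OF pred_pow_max[OF p, of n] Y_pow_W[OF p u(1)] s(1), of 1] s(2) by auto
      then show ?thesis
        using spn_base[OF G] by blast
    qed
  qed (use u in simp)
qed

text \<open>All spanning vectors R Y^n u have weights on the downward orbit of p, so any other
  weight space is zero.\<close>

lemma weights_down:
  assumes p: "p \<in> Max_R" and u: "u \<in> W p" "u \<noteq> 0\<^sub>M" "X u = 0\<^sub>M"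
    and q: "q \<in> Max_R" "v \<in> W q" "v \<noteq> 0\<^sub>M"
  shows "\<exists>n. q = (pred ^^ n) p"
proof (rule ccontr)
  assume none: "\<not> ?thesis"
  let ?G = "{r \<star> (Y ^^ n) u | r n. r \<in> carrier R}"
  have G: "\<exists>n. g \<in> W ((pred ^^ n) p)" if "g \<in> ?G" for g
    using that W_ract[OF pred_pow_max[OF p] Y_pow_W[OF p u(1)]] by blast
  have "v \<in> {0\<^sub>M}"
  proof (rule spn_weight[OF _ span_down[OF p u] _ q(1) _ _ _ q(2)])
    show "?G \<subseteq> carrier M"
      using G W_carrier by blast
    show "\<exists>p \<in> Max_R. g \<in> W p" if "g \<in> ?G" for g
      using G[OF that] pred_pow_max[OF p] by blast
    show "g \<in> {0\<^sub>M}" if g: "g \<in> ?G" "g \<in> W q" "g \<noteq> 0\<^sub>M" for g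
      using G[OF g(1)] W_unique[OF q(1) pred_pow_max[OF p] g(2) _ g(3)] none by blast
  qed auto
  then show False
    using q by simp
qed

text \<open>Both end conditions come from the products of the generators: X Y = \<sigma> t at the
  last nonzero Y^n u, which Y kills, and Y X = t at u, which X kills.\<close>

lemma bounded_string:
  assumes p: "p \<in> Max_R" and u: "u \<in> W p" "u \<noteq> 0\<^sub>M" "X u = 0\<^sub>M" and "(Y ^^ N) u = 0\<^sub>M"
  shows is_string
proof -
  note uM = W_carrier[OF u(1)]
  obtain n where n: "(Y ^^ n) u \<noteq> 0\<^sub>M" "(Y ^^ Suc n) u = 0\<^sub>M"
  proof -
    define k where "k = (LEAST k. (Y ^^ k) u = 0\<^sub>M)"
    have k: "(Y ^^ k) u = 0\<^sub>M" "k \<noteq> 0"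
      using assms(5) u(2) LeastI[of "\<lambda>k. (Y ^^ k) u = 0\<^sub>M" N] unfolding k_def
      by (auto intro: gr0I simp del: neq0_conv)
    moreover have "(Y ^^ (k - 1)) u \<noteq> 0\<^sub>M"
      using k(2) not_less_Least[of "k - 1" "\<lambda>k. (Y ^^ k) u = 0\<^sub>M"] by (simp add: k_def)
    ultimately show ?thesis
      using that[of "k - 1"] by simp
  qed
  have zero: "(Y ^^ k) u = 0\<^sub>M" if "k > n" for k
    using Y_pow_Y_pow[of "k - Suc n" "Suc n" u] n(2) that by (simp del: funpow.simps)
  have nonzero: "(Y ^^ k) u \<noteq> 0\<^sub>M" if "k \<le> n" for k
    using Y_pow_Y_pow[of "n - k" k u] n(1) that by auto
  \<comment> \<open>The numbering runs against the powers of Y: index n carries u and index 0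
    carries the last nonzero vector. Outside {0..n} truncation repeats the end values, so v i is
    nonzero for every integer i.\<close>
  define m where "m i = (pred ^^ (n - nat i)) p" for i :: int
  define v where "v i = (Y ^^ (n - nat i)) u" for i :: int
  have m_max: "m i \<in> Max_R" for i
    unfolding m_def using p by (rule pred_pow_max)
  have v_W: "v i \<in> W (m i)" for i
    unfolding m_def v_def using p u(1) by (rule Y_pow_W)
  have step: "n - nat i = Suc (n - nat (i + 1))" if "0 \<le> i" "i + 1 \<le> int n" for i
    using that by linarith
  have "string_family R \<sigma> t {0..int n} m"
  proof -
    have "\<sigma> ` m i \<subseteq> m (i + 1)" if "i \<in> {0..int n} \<and> i + 1 \<in> {0..int n}" for i
      using that step m_max unfolding pred_subset_iff[OF m_max m_max] by (simp add: m_def)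
    moreover have "\<sigma> t \<star> v 0 = 0\<^sub>M"
      using X_Y_pow[OF uM, of n] n(2) by (simp add: v_def del: funpow.simps)
    then have "\<sigma> t \<in> m 0"
      using ract_eq_zero_iff[OF m_max[of 0] v_W[of 0], of "\<sigma> t"] n(1) by (simp add: v_def)
    moreover have "t \<star> u = 0\<^sub>M"
      using YX[OF uM] u by simp
    then have "t \<in> m (int n)"
      using ract_eq_zero_iff[OF p u(1)] u(2) by (simp add: m_def)
    ultimately show ?thesis
      unfolding string_family_def using m_max by (auto intro: exI[of _ "int n"])
  qed
  moreover from this have "left_module_isomorphic A M (string_module R \<sigma> t {0..int n} m)"
  proof (rule string_module_iso[of _ _ v])
    show "v i \<in> W (m i)" for i by (rule v_W)
    show "v i \<noteq> 0\<^sub>M" for i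
      by (simp add: v_def nonzero)
    show "Y (v i) = (if i - 1 \<in> {0..int n} then v (i - 1) else 0\<^sub>M)" if i: "i \<in> {0..int n}" for i
    proof (cases "i = 0")
      case True
      then show ?thesis
        using n(2) by (simp add: v_def)
    next
      case False
      then show ?thesis
        using i step[of "i - 1"] by (auto simp: v_def)
    qed
    show "X (v i) = 0\<^sub>M" if "i \<in> {0..int n}" "i + 1 \<notin> {0..int n}" for i
    proof -
      have "i = int n" using that by auto
      then show ?thesis
        using u by (simp add: v_def)
    qed
    fix J assume J: "finite J" "J \<noteq> {}" "J \<subseteq> {0..int n}"
    \<comment> \<open>Y^b takes v b to the last nonzero vector Y^n u and every lower v i beyond it,
      to zero.\<close>
    define b where "b = Max J"
    have b: "b \<in> J" "\<And>i. i \<in> J \<Longrightarrow> i \<le> b"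
      using J by (auto simp: b_def)
    have bn: "0 \<le> b" "b \<le> int n"
      using b J by auto
    show "\<exists>b \<in> J. \<exists>T. separates v J b T"
      unfolding separates_def
    proof (intro bexI[of _ b] exI[of _ "Y ^^ nat b"] conjI ballI impI)
      fix r i assume r: "r \<in> carrier R" and "i \<in> J - {b}"
      then have i: "0 \<le> i" "i < b"
        using b(2)[of i] J by auto
      obtain s where s: "s \<in> carrier R" "(Y ^^ nat b) (r \<star> v i) = s \<star> (Y ^^ nat b) (v i)"
        using Y_pow_r[OF m_max v_W r] by blast
      moreover have "(Y ^^ nat b) (v i) = 0\<^sub>M"
        unfolding v_def Y_pow_Y_pow using i bn by (intro zero) linarith
      ultimately show "(Y ^^ nat b) (r \<star> v i) = 0\<^sub>M"
        by simp
    next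
      fix r assume r: "r \<in> carrier R" and *: "(Y ^^ nat b) (r \<star> v b) = 0\<^sub>M"
      obtain s where s: "s \<in> carrier R" "s \<in> (pred ^^ nat b) (m b) \<longleftrightarrow> r \<in> m b"
        "(Y ^^ nat b) (r \<star> v b) = s \<star> (Y ^^ nat b) (v b)"
        using Y_pow_r[OF m_max v_W r] by blast
      have "(Y ^^ nat b) (v b) = (Y ^^ n) u"
        unfolding v_def Y_pow_Y_pow using bn by simp
      then have "(Y ^^ nat b) (v b) \<noteq> 0\<^sub>M"
        using n(1) by simp
      then have "r \<in> m b"
        using * s ract_eq_zero_iff[OF pred_pow_max[OF m_max] Y_pow_W[OF m_max v_W] s(1)] by simp
      then show "r \<star> v b = 0\<^sub>M"
        using v_W mem_W by blast
    qed (auto simp: b Y_pow_plus)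
  qed
  ultimately show ?thesis by blast
qed

text \<open>Since p does not recur, X undoes Y up to nonzero scalars all the way back to u. The
  lowest of finitely many v i then survives a power of X that pushes the others past u.\<close>

lemma left_infinite_string:
  assumes p: "p \<in> Max_R" and u: "u \<in> W p" "u \<noteq> 0\<^sub>M" "X u = 0\<^sub>M" and nz: "\<And>n. (Y ^^ n) u \<noteq> 0\<^sub>M"
    and ap: "aperiodic p"
  shows is_string
proof -
  note uM = W_carrier[OF u(1)]
  have t: "t \<notin> (pred ^^ Suc k) p" for k
  proof
    assume "t \<in> (pred ^^ Suc k) p"
    then have "\<sigma> t \<in> (pred ^^ k) p"
      by (simp add: mem_pred)
    then have "X ((Y ^^ Suc k) u) = 0\<^sub>M"
      unfolding X_Y_pow[OF uM] using Y_pow_W[OF p u(1)] mem_W by blast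
    \<comment> \<open>Y^(k+1) u would itself be a nonzero vector killed by X. Then all weights, p
      included, would lie on the downward orbit of its weight, which makes p periodic.\<close>
    then obtain n where "p = (pred ^^ n) ((pred ^^ Suc k) p)"
      using weights_down[OF pred_pow_max[OF p] Y_pow_W[OF p u(1)] nz _ p u(1,2), of "Suc k"] by blast
    then have "(pred ^^ (n + Suc k)) p = p"
      unfolding funpow_add by simp
    then show False
      using ap by blast
  qed
  \<comment> \<open>The scalar is the product of \<sigma> t, \<sigma>^2 t, ..., \<sigma>^a t. No
    factor lies in p by the previous fact, and p is prime.\<close>
  have XY: "\<exists>c \<in> carrier R. c \<notin> p \<and> (X ^^ a) ((Y ^^ a) u) = c \<star> u" for a
  proof (induction a)
    case 0
    then show ?case
      using uM max_one[OF p] by (intro bexI[of _ \<one>]) auto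
  next
    case (Suc a)
    then obtain c where c: "c \<in> carrier R" "c \<notin> p" "(X ^^ a) ((Y ^^ a) u) = c \<star> u"
      by blast
    have st: "(\<sigma> ^^ a) (\<sigma> t) \<in> carrier R" "(\<sigma> ^^ a) (\<sigma> t) \<notin> p"
      using t[of a] mem_pred_pow[of t "Suc a" p] by (simp_all add: funpow_swap1)
    have "(X ^^ Suc a) ((Y ^^ Suc a) u) = (X ^^ a) (\<sigma> t \<star> (Y ^^ a) u)"
      using X_Y_pow[OF uM, of a] by (simp add: funpow_swap1)
    also have "\<dots> = (\<sigma> ^^ a) (\<sigma> t) \<star> c \<star> u"
      using uM c by (simp add: X_pow_r)
    also have "\<dots> = ((\<sigma> ^^ a) (\<sigma> t) \<otimes> c) \<star> u"
      using uM c st by (simp add: ract_mult)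
    finally show ?case
      using c st max_prime[OF p st(1) c(1)] by (intro bexI[of _ "(\<sigma> ^^ a) (\<sigma> t) \<otimes> c"]) auto
  qed
  have XY0: "(X ^^ a) ((Y ^^ j) u) = 0\<^sub>M" if "j < a" for a j
  proof -
    obtain c where c: "c \<in> carrier R" "(X ^^ j) ((Y ^^ j) u) = c \<star> u"
      using XY by blast
    have "(X ^^ a) ((Y ^^ j) u) = (X ^^ (a - j - 1)) (X ((X ^^ j) ((Y ^^ j) u)))"
      using that X_pow_X_pow[of "a - j - 1" "Suc j"] by simp
    then show ?thesis
      using c uM u by (simp add: Xr)
  qed
  define m where "m i = (pred ^^ nat (- i)) p" for i :: int
  define v where "v i = (Y ^^ nat (- i)) u" for i :: int
  have m_max: "m i \<in> Max_R" for i
    unfolding m_def using p by (rule pred_pow_max)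
  have v_W: "v i \<in> W (m i)" for i
    unfolding m_def v_def using p u(1) by (rule Y_pow_W)
  have step: "nat (- i) = Suc (nat (- (i + 1)))" if "i + 1 \<le> 0" for i
    using that by linarith
  have "string_family R \<sigma> t {..0} m"
  proof -
    have "\<sigma> ` m i \<subseteq> m (i + 1)" if "i \<in> {..0} \<and> i + 1 \<in> {..0}" for i
      using that step m_max unfolding pred_subset_iff[OF m_max m_max] by (simp add: m_def)
    moreover have "t \<star> u = 0\<^sub>M"
      using YX[OF uM] u by simp
    then have "t \<in> m 0"
      using ract_eq_zero_iff[OF p u(1)] u(2) by (simp add: m_def)
    ultimately show ?thesis
      unfolding string_family_def using m_max by auto
  qed
  moreover from this have "left_module_isomorphic A M (string_module R \<sigma> t {..0} m)"
  proof (rule string_module_iso[of _ _ v])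
    show "v i \<in> W (m i)" for i by (rule v_W)
    show "v i \<noteq> 0\<^sub>M" for i
      by (simp add: v_def nz)
    show "Y (v i) = (if i - 1 \<in> {..0} then v (i - 1) else 0\<^sub>M)" if "i \<in> {..0}" for i
      using that step[of "i - 1"] by (simp add: v_def)
    show "X (v i) = 0\<^sub>M" if "i \<in> {..0}" "i + 1 \<notin> {..0}" for i
    proof -
      have "i = 0" using that by auto
      then show ?thesis
        using u by (simp add: v_def)
    qed
    fix J :: "int set" assume J: "finite J" "J \<noteq> {}" "J \<subseteq> {..0}"
    define b where "b = Min J"
    have b: "b \<in> J" "\<And>i. i \<in> J \<Longrightarrow> b \<le> i"
      using J by (auto simp: b_def)
    show "\<exists>b \<in> J. \<exists>T. separates v J b T"
      unfolding separates_def
    proof (intro bexI[of _ b] exI[of _ "X ^^ nat (- b)"] conjI ballI impI)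
      fix r i assume r: "r \<in> carrier R" and "i \<in> J - {b}"
      then have "nat (- i) < nat (- b)"
        using b(2)[of i] J by auto
      then show "(X ^^ nat (- b)) (r \<star> v i) = 0\<^sub>M"
        using r uM XY0 by (simp add: v_def X_pow_r)
    next
      let ?a = "nat (- b)"
      fix r assume r: "r \<in> carrier R" and *: "(X ^^ ?a) (r \<star> v b) = 0\<^sub>M"
      obtain c where c: "c \<in> carrier R" "c \<notin> p" "(X ^^ ?a) ((Y ^^ ?a) u) = c \<star> u"
        using XY by blast
      have "((\<sigma> ^^ ?a) r \<otimes> c) \<star> u = 0\<^sub>M"
        using * r c uM by (simp add: v_def X_pow_r ract_mult)
      then have "(\<sigma> ^^ ?a) r \<otimes> c \<in> p"
        using ract_eq_zero_iff[OF p u(1)] u(2) r c by simp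
      then have "(\<sigma> ^^ ?a) r \<in> p"
        using max_prime[OF p _ c(1)] r c by auto
      then have "r \<in> m b"
        using r by (simp add: m_def mem_pred_pow)
      then show "r \<star> v b = 0\<^sub>M"
        using v_W mem_W by blast
    qed (auto simp: b X_pow_plus)
  qed
  ultimately show ?thesis by blast
qed


section \<open>Spanning M from a single weight space\<close>

lemma span_up:
  assumes n: "n \<in> Max_R" and w: "w \<in> W n" "w \<noteq> 0\<^sub>M"
  shows "spn ({g. \<exists>p \<in> Max_R. (\<exists>i. (pred ^^ i) p = n) \<and> g \<in> W p} \<union>
      {(Y ^^ Suc j) w | j w. w \<in> W n}) = carrier M" (is "spn (?G1 \<union> ?G2) = _")
proof -
  \<comment> \<open>\<open>?G1\<close> holds the weight vectors at or above n, \<open>?G2\<close>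
    the images of W n below it. X keeps \<open>?G1\<close> above n whatever the branching, Y leads
    from W n into \<open>?G2\<close>, and X returns from there by X Y = \<sigma> t, the scalar being
    absorbed into W n.\<close>
  let ?G = "?G1 \<union> ?G2"
  have G1: "g \<in> ?G" if "p \<in> Max_R" "(pred ^^ i) p = n" "g \<in> W p" for g p i
    using that by blast
  have Yw: "(Y ^^ j) w \<in> ?G" if "w \<in> W n" for w j
  proof (cases j)
    case 0
    then show ?thesis
      using G1[of n 0 w] n that by simp
  qed (use that in auto)
  have G: "?G \<subseteq> carrier M"
    using W_carrier by auto
  have "w \<in> ?G"
    using Yw[OF w(1), of 0] by simp
  then show ?thesis
  proof (rule spn_submodule[OF G])
    fix r g assume r: "r \<in> carrier R" and g: "g \<in> ?G"
    from g show "r \<star> g \<in> ?G"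
    proof
      assume "g \<in> ?G1"
      then show ?thesis
        using W_ract r by blast
    next
      assume "g \<in> ?G2"
      then obtain j w where w: "w \<in> W n" "g = (Y ^^ Suc j) w"
        by blast
      then have "r \<star> g = (Y ^^ Suc j) ((\<sigma> ^^ Suc j) r \<star> w)"
        using r W_carrier[OF w(1)] by (simp only: r_Y_pow)
      then show ?thesis
        using W_ract[OF n w(1) \<sigma>_pow_closed[OF r]] by blast
    qed
  next
    fix g assume g: "g \<in> ?G"
    from g show "X g \<in> spn ?G"
    proof
      assume "g \<in> ?G1"
      then obtain p i where p: "p \<in> Max_R" "(pred ^^ i) p = n" "g \<in> W p"
        by blast
      show ?thesis
      proof (rule mem_spn_weights[OF _ G])
        fix q assume q: "q \<in> Max_R" "pr q (X g) \<noteq> 0\<^sub>M"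
        then have "p = pred q"
          using X_weight p by blast
        then have "pr q (X g) \<in> ?G"
          using p q W_carrier[OF p(3)] pr_W by (intro G1[of q "Suc i"]) (auto simp: funpow_swap1)
        then show "pr q (X g) \<in> spn ?G"
          by (rule spn_base[OF G])
      qed (use W_carrier[OF p(3)] in simp)
    next
      assume "g \<in> ?G2"
      then obtain j w where w: "w \<in> W n" "g = (Y ^^ Suc j) w"
        by blast
      then have "X g = \<sigma> t \<star> (Y ^^ j) w"
        using X_Y_pow W_carrier by blast
      also have "\<dots> = (Y ^^ j) ((\<sigma> ^^ j) (\<sigma> t) \<star> w)"
        using W_carrier[OF w(1)] by (simp add: r_Y_pow)
      finally have "X g \<in> ?G"
        using Yw W_ract[OF n w(1)] by simp
      then show ?thesis
        by (rule spn_base[OF G])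
    qed
    from g have "Y g \<in> ?G"
    proof
      assume "g \<in> ?G1"
      then obtain p i where p: "p \<in> Max_R" "(pred ^^ i) p = n" "g \<in> W p"
        by blast
      show ?thesis
      proof (cases i)
        case 0
        then show ?thesis
          using Yw[of g 1] p by simp
      next
        case (Suc j)
        then show ?thesis
          using G1[of "pred p" j "Y g"] p pred_max Y_W by (simp add: funpow_swap1)
      qed
    next
      assume "g \<in> ?G2"
      then obtain j w where w: "w \<in> W n" "g = (Y ^^ Suc j) w"
        by blast
      then show ?thesis
        using Yw[OF w(1), of "Suc (Suc j)"] by simp
    qed
    then show "Y g \<in> spn ?G"
      by (rule spn_base[OF G])
  qed (use w in simp)
qed

text \<open>A test for W q to lie in H: q can carry vectors only if it is above n or on the downward
  orbit of n, and in the second case they come from W n by powers of Y.\<close>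

lemma mem_W_up:
  assumes n: "n \<in> Max_R" and w: "w \<in> W n" "w \<noteq> 0\<^sub>M" and q: "q \<in> Max_R" and v: "v \<in> W q"
    and H: "0\<^sub>M \<in> H" "\<And>v w. v \<in> H \<Longrightarrow> w \<in> H \<Longrightarrow> v +\<^sub>M w \<in> H"
    and up: "\<And>g i. g \<in> W q \<Longrightarrow> (pred ^^ i) q = n \<Longrightarrow> g \<in> H"
    and down: "\<And>g j. g \<in> W n \<Longrightarrow> (pred ^^ Suc j) n = q \<Longrightarrow> (Y ^^ Suc j) g \<in> H"
  shows "v \<in> H"
proof (rule spn_weight[OF _ span_up[OF n w] _ q H _ v])
  show "\<exists>p \<in> Max_R. g \<in> W p"
    if "g \<in> {g. \<exists>p \<in> Max_R. (\<exists>i. (pred ^^ i) p = n) \<and> g \<in> W p} \<union> {(Y ^^ Suc j) w | j w. w \<in> W n}" for g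
    using that Y_pow_W[OF n] pred_pow_max[OF n] by blast
  then show "{g. \<exists>p \<in> Max_R. (\<exists>i. (pred ^^ i) p = n) \<and> g \<in> W p} \<union> {(Y ^^ Suc j) w | j w. w \<in> W n}
      \<subseteq> carrier M"
    using W_carrier by blast
  fix g assume g: "g \<in> {g. \<exists>p \<in> Max_R. (\<exists>i. (pred ^^ i) p = n) \<and> g \<in> W p} \<union>
      {(Y ^^ Suc j) w | j w. w \<in> W n}" "g \<in> W q" "g \<noteq> 0\<^sub>M"
  from g(1) show "g \<in> H"
  proof
    assume "g \<in> {g. \<exists>p \<in> Max_R. (\<exists>i. (pred ^^ i) p = n) \<and> g \<in> W p}"
    then obtain p i where "p \<in> Max_R" "(pred ^^ i) p = n" "g \<in> W p"
      by blast
    then show ?thesis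
      using W_unique[of p q g] q g(2,3) up[of g i] by blast
  next
    assume "g \<in> {(Y ^^ Suc j) w | j w. w \<in> W n}"
    then obtain j w where w: "w \<in> W n" "g = (Y ^^ Suc j) w"
      by blast
    then have "g \<in> W ((pred ^^ Suc j) n)"
      using Y_pow_W[OF n w(1), of "Suc j"] by (simp only:)
    then have "(pred ^^ Suc j) n = q"
      using W_unique[OF pred_pow_max[OF n] q _ g(2,3)] by blast
    then show ?thesis
      using down w by blast
  qed
qed

section \<open>X injective on weight spaces\<close>

context
  assumes X_inj: "\<And>p v. \<lbrakk>p \<in> Max_R; v \<in> W p; X v = 0\<^sub>M\<rbrakk> \<Longrightarrow> v = 0\<^sub>M"
begin

text \<open>Injectivity of X makes Y v = 0 equivalent to X Y v = \<sigma> t v = 0.\<close>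

lemma Y_eq_zero_iff:
  assumes q: "q \<in> Max_R" "v \<in> W q" "v \<noteq> 0\<^sub>M"
  shows "Y v = 0\<^sub>M \<longleftrightarrow> \<sigma> t \<in> q"
proof
  assume "Y v = 0\<^sub>M"
  then have "\<sigma> t \<star> v = 0\<^sub>M"
    using XY[OF W_carrier[OF q(2)]] by simp
  then show "\<sigma> t \<in> q"
    using ract_eq_zero_iff[OF q(1,2)] q(3) by simp
next
  assume "\<sigma> t \<in> q"
  then have "X (Y v) = 0\<^sub>M"
    using XY[OF W_carrier[OF q(2)]] q(2) mem_W by simp
  then show "Y v = 0\<^sub>M"
    using X_inj[OF pred_max[OF q(1)] Y_W[OF q(1,2)]] by simp
qed

text \<open>X v has a nonzero component at some q with pred q = n. Seen from q, the weight n is one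
  step down and occurs only there: reaching it in more steps, or lying above q, would make n
  periodic. So all of W n is Y (W q).\<close>

lemma aperiodic_succ:
  assumes n: "n \<in> Max_R" "v \<in> W n" "v \<noteq> 0\<^sub>M" "aperiodic n"
  obtains q w where "q \<in> Max_R" "n = pred q" "w \<in> W q" "w \<noteq> 0\<^sub>M" "Y w = v" "aperiodic q"
proof -
  note vM = W_carrier[OF n(2)]
  have "X v \<noteq> 0\<^sub>M"
    using X_inj n by blast
  then obtain q where q: "q \<in> Max_R" "pr q (X v) \<noteq> 0\<^sub>M"
    using eq_zero_weights[of "X v"] vM by auto
  then have nq: "n = pred q"
    using X_weight n by blast
  have pq: "pr q (X v) \<in> W q"
    using pr_W vM q by simp
  have "v \<in> Y ` W q"
  proof (rule mem_W_up[OF q(1) pq q(2) n(1,2)])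
    show "0\<^sub>M \<in> Y ` W q"
      using q by (intro image_eqI[of _ _ "0\<^sub>M"]) auto
    show "x +\<^sub>M y \<in> Y ` W q" if "x \<in> Y ` W q" "y \<in> Y ` W q" for x y
    proof -
      obtain x' y' where "x' \<in> W q" "y' \<in> W q" "x = Y x'" "y = Y y'"
        using \<open>x \<in> _\<close> \<open>y \<in> _\<close> by blast
      then show ?thesis
        using W_add[OF q(1), of x' y'] W_carrier tact_plus[of GenY x' y']
        by (intro image_eqI[of _ _ "x' +\<^sub>M y'"]) auto
    qed
    show "g \<in> Y ` W q" if "(pred ^^ i) n = q" for g i
    proof -
      have "(pred ^^ Suc i) n = n"
        using that nq by simp
      then show ?thesis
        using n(4) by blast
    qed
    show "(Y ^^ Suc j) g \<in> Y ` W q" if "g \<in> W q" "(pred ^^ Suc j) q = n" for g j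
    proof (cases j)
      case (Suc k)
      then have "(pred ^^ Suc k) n = n"
        using that nq by (simp add: funpow_swap1)
      then show ?thesis
        using n(4) by blast
    qed (use that in auto)
  qed
  then obtain w where w: "w \<in> W q" "v = Y w"
    by blast
  moreover have "w \<noteq> 0\<^sub>M"
    using w n(3) by auto
  moreover have "(pred ^^ k) q \<noteq> q" if "k > 0" for k
  proof
    assume "(pred ^^ k) q = q"
    then have "(pred ^^ k) n = n"
      unfolding nq by (simp add: funpow_swap1[symmetric])
    then show False
      using n(4) that by blast
  qed
  ultimately show ?thesis
    using that q nq by blast
qed

lemma aperiodic_string:
  assumes n: "n \<in> Max_R" "v \<in> W n" "v \<noteq> 0\<^sub>M" "aperiodic n"
  shows is_string
proof -
  have "\<exists>f. \<forall>i. (fst (f i) \<in> Max_R \<and> snd (f i) \<in> W (fst (f i)) \<and> snd (f i) \<noteq> 0\<^sub>M \<and> aperiodic (fst (f i))) \<and>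
      (fst (f i) = pred (fst (f (Suc i))) \<and> Y (snd (f (Suc i))) = snd (f i))"
  proof (rule dependent_nat_choice)
    show "\<exists>x. fst x \<in> Max_R \<and> snd x \<in> W (fst x) \<and> snd x \<noteq> 0\<^sub>M \<and> aperiodic (fst x)"
      using n by (intro exI[of _ "(n, v)"]) simp
  next
    fix x :: "'r set \<times> 'm" and i :: nat
    assume x: "fst x \<in> Max_R \<and> snd x \<in> W (fst x) \<and> snd x \<noteq> 0\<^sub>M \<and> aperiodic (fst x)"
    then obtain q w where "q \<in> Max_R" "fst x = pred q" "w \<in> W q" "w \<noteq> 0\<^sub>M" "Y w = snd x" "aperiodic q"
      using aperiodic_succ by blast
    then show "\<exists>y. (fst y \<in> Max_R \<and> snd y \<in> W (fst y) \<and> snd y \<noteq> 0\<^sub>M \<and> aperiodic (fst y)) \<and>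
        (fst x = pred (fst y) \<and> Y (snd y) = snd x)"
      by (intro exI[of _ "(q, w)"]) simp
  qed
  then obtain f where f: "\<And>i. fst (f i) \<in> Max_R" "\<And>i. snd (f i) \<in> W (fst (f i))"
    "\<And>i. snd (f i) \<noteq> 0\<^sub>M" "\<And>i. aperiodic (fst (f i))"
    "\<And>i. fst (f i) = pred (fst (f (Suc i)))" "\<And>i. Y (snd (f (Suc i))) = snd (f i)"
    by blast
  \<comment> \<open>Upward the vectors are the chosen ones, downward they are powers of Y applied to
    the start. Once \<open>V\<close> vanishes it vanishes at all lower indices.\<close>
  define m where "m i = (if i \<ge> 0 then fst (f (nat i)) else (pred ^^ nat (- i)) (fst (f 0)))" for i :: int
  define V where "V i = (if i \<ge> 0 then snd (f (nat i)) else (Y ^^ nat (- i)) (snd (f 0)))" for i :: int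
  have m_max: "m i \<in> Max_R" for i
    using f(1) pred_pow_max by (simp add: m_def)
  have V_W: "V i \<in> W (m i)" for i
    using f(1,2) Y_pow_W by (simp add: m_def V_def)
  note VM = W_carrier[OF V_W]
  have step: "m i = pred (m (i + 1)) \<and> V i = Y (V (i + 1))" for i
  proof -
    consider "i \<ge> 0" | "i = -1" | "i < -1"
      by linarith
    then show ?thesis
    proof cases
      case 1
      then show ?thesis
        using f(5,6)[of "nat i"] by (simp add: m_def V_def nat_add_distrib)
    next
      case 3
      then have "nat (- i) = Suc (nat (- (i + 1)))"
        by linarith
      then show ?thesis
        using 3 by (simp add: m_def V_def)
    qed (simp add: m_def V_def)
  qed
  have m_pow: "m (j - int k) = (pred ^^ k) (m j)" for j k
  proof (induction k)
    case (Suc k)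
    have "j - int (Suc k) + 1 = j - int k"
      by simp
    then show ?case
      using step[of "j - int (Suc k)"] Suc by simp
  qed simp
  \<comment> \<open>Aperiodicity is known at the chosen indices j \<ge> 0 only; below 0 the weights
    may run into a cycle.\<close>
  have m_distinct: "m i \<noteq> m j" if "i < j" "j \<ge> 0" for i j
  proof -
    have "m i = (pred ^^ nat (j - i)) (m j)"
      using m_pow[of j "nat (j - i)"] that by simp
    moreover have "aperiodic (m j)"
      using f(4) that by (simp add: m_def)
    ultimately show ?thesis
      using that by simp
  qed
  have V_up: "V (i + int k) \<noteq> 0\<^sub>M" if "V i \<noteq> 0\<^sub>M" for i k
  proof (induction k)
    case (Suc k)
    then show ?case
      using step[of "i + int k"] by (auto simp: algebra_simps)
  qed (use that in simp)
  \<comment> \<open>Above a nonzero V i all steps of Y are nonzero, so \<sigma> t avoids the weights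
    there. As X V j = \<sigma> t V (j + 1), X climbs with scalars whose residues stay
    nonzero.\<close>
  have X_pow: "\<exists>s \<in> carrier R. (s \<in> m (i + int k) \<longleftrightarrow> r \<in> m i) \<and> (X ^^ k) (r \<star> V i) = s \<star> V (i + int k)"
    if r: "r \<in> carrier R" and nz: "V i \<noteq> 0\<^sub>M" for r i k
  proof (induction k)
    case 0
    then show ?case
      using r by (intro bexI[of _ r]) auto
  next
    case (Suc k)
    let ?j = "i + int k"
    obtain s where s: "s \<in> carrier R" "s \<in> m ?j \<longleftrightarrow> r \<in> m i" "(X ^^ k) (r \<star> V i) = s \<star> V ?j"
      using Suc by blast
    have j: "i + int (Suc k) = ?j + 1"
      by simp
    have "Y (V (?j + 1)) \<noteq> 0\<^sub>M"
      using V_up[OF nz, of k] step[of ?j] by simp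
    then have "\<sigma> t \<notin> m (?j + 1)"
      using Y_eq_zero_iff[OF m_max V_W, of "?j + 1"] V_up[OF nz, of "Suc k", unfolded j] by simp
    then have "\<sigma> s \<otimes> \<sigma> t \<in> m (?j + 1) \<longleftrightarrow> \<sigma> s \<in> m (?j + 1)"
      using s(1) max_prime[OF m_max, of "\<sigma> s" "\<sigma> t" "?j + 1"] max_mult'[OF m_max] by auto
    also have "\<dots> \<longleftrightarrow> s \<in> m ?j"
      using s(1) step[of ?j] by (simp add: mem_pred)
    finally have "\<sigma> s \<otimes> \<sigma> t \<in> m (?j + 1) \<longleftrightarrow> r \<in> m i"
      using s(2) by simp
    moreover have "(X ^^ Suc k) (r \<star> V i) = (\<sigma> s \<otimes> \<sigma> t) \<star> V (?j + 1)"
      using s(1,3) VM step[of ?j] by (simp add: Xr XY ract_mult)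
    ultimately show ?case
      unfolding j using s(1) by (intro bexI[of _ "\<sigma> s \<otimes> \<sigma> t"]) auto
  qed
  \<comment> \<open>The shift e moves the start of the string to index 0: it is the lowest index
    with V nonzero in the right infinite case, and 0 in the double infinite one.\<close>
  have main: is_string
    if I: "I = UNIV \<or> I = {0..} \<and> V (e - 1) = 0\<^sub>M" and Ie: "\<And>i. i \<in> I \<Longrightarrow> V (i + e) \<noteq> 0\<^sub>M" for I e
  proof -
    define m' where "m' i = m (i + e)" for i
    define v where "v i = V (i + e)" for i
    have "string_family R \<sigma> t I m'"
    proof -
      have "\<sigma> ` m' i \<subseteq> m' (i + 1)" for i
        using step[of "i + e"] pred_subset_iff[OF m_max m_max, of "i + e" "i + e + 1"]
        by (simp add: m'_def add_ac)
      moreover have "\<sigma> t \<in> m' 0" if "I = {0..}" "V (e - 1) = 0\<^sub>M"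
      proof -
        have "Y (V e) = 0\<^sub>M"
          using that step[of "e - 1"] by simp
        then show ?thesis
          using Y_eq_zero_iff[OF m_max V_W, of e] Ie[of 0] that by (simp add: m'_def)
      qed
      ultimately show ?thesis
        using I m_max by (auto simp: string_family_def m'_def)
    qed
    moreover from this have "left_module_isomorphic A M (string_module R \<sigma> t I m')"
    proof (rule string_module_iso[of _ _ v])
      show "v i \<in> W (m' i)" for i
        by (simp add: v_def m'_def V_W)
      show "v i \<noteq> 0\<^sub>M" if "i \<in> I" for i
        using Ie that by (simp add: v_def)
      show "Y (v i) = (if i - 1 \<in> I then v (i - 1) else 0\<^sub>M)" if "i \<in> I" for i
      proof (cases "i - 1 \<in> I")
        case True
        then show ?thesis
          using step[of "i - 1 + e"] by (simp add: v_def algebra_simps)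
      next
        case False
        then have "i = 0" "V (e - 1) = 0\<^sub>M"
          using I that by auto
        then show ?thesis
          using step[of "e - 1"] False by (simp add: v_def)
      qed
      show "X (v i) = 0\<^sub>M" if "i \<in> I" "i + 1 \<notin> I" for i
        using I that by auto
      fix J assume J: "finite J" "J \<noteq> {}" "J \<subseteq> I"
      define b where "b = Max J"
      have b: "b \<in> J" "\<And>i. i \<in> J \<Longrightarrow> i \<le> b"
        using J by (auto simp: b_def)
      \<comment> \<open>X^k lifts the top index b + e of J to a nonnegative index, where its weight
        differs from all lower weights, so that \<open>pr q\<close> can single out its term.\<close>
      define k where "k = nat (- (b + e))"
      define q where "q = m (b + e + int k)"
      have bk: "b + e + int k \<ge> 0"
        by (simp add: k_def)
      have q: "q \<in> Max_R"
        by (simp add: q_def m_max)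
      show "\<exists>b \<in> J. \<exists>T. separates v J b T"
      unfolding separates_def
    proof (intro bexI[of _ b] exI[of _ "\<lambda>x. pr q ((X ^^ k) x)"] conjI ballI impI)
        fix r i assume r: "r \<in> carrier R" and i: "i \<in> J - {b}"
        then have ib: "i < b" "i \<in> I"
          using b(2)[of i] J by auto
        obtain s where s: "s \<in> carrier R" "(X ^^ k) (r \<star> v i) = s \<star> V (i + e + int k)"
          using X_pow[OF r Ie[OF ib(2)], of k] by (auto simp: v_def)
        moreover have "m (i + e + int k) \<noteq> q"
          unfolding q_def using ib bk by (intro m_distinct) auto
        ultimately show "pr q ((X ^^ k) (r \<star> v i)) = 0\<^sub>M"
          using pr_of_W[OF m_max q W_ract[OF m_max V_W s(1)], of "i + e + int k"] by simp
      next
        fix r assume r: "r \<in> carrier R" and *: "pr q ((X ^^ k) (r \<star> v b)) = 0\<^sub>M"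
        have bI: "b \<in> I" using b J by blast
        obtain s where s: "s \<in> carrier R" "s \<in> q \<longleftrightarrow> r \<in> m (b + e)" "(X ^^ k) (r \<star> v b) = s \<star> V (b + e + int k)"
          using X_pow[OF r Ie[OF bI], of k] by (auto simp: v_def q_def)
        have "V (b + e + int k) \<in> W q"
          by (simp add: q_def V_W)
        moreover from this have "s \<star> V (b + e + int k) = 0\<^sub>M"
          using * s(3) pr_of_W[OF q q W_ract[OF q _ s(1)], of "V (b + e + int k)"] by simp
        ultimately have "s \<in> q"
          using ract_eq_zero_iff[OF q _ s(1)] V_up[OF Ie[OF bI], of k] by blast
        then show "r \<star> v b = 0\<^sub>M"
          using s(2) V_W[of "b + e"] mem_W by (simp add: v_def)
      qed (auto simp: b X_pow_plus pr_add q)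
    qed
    ultimately show ?thesis by blast
  qed
  show ?thesis
  proof (cases "\<forall>i. V i \<noteq> 0\<^sub>M")
    case True
    then show ?thesis
      using main[of UNIV 0] by simp
  next
    case False
    then obtain i where i: "V i = 0\<^sub>M"
      by blast
    have ex: "\<exists>k. V (i + int k) \<noteq> 0\<^sub>M"
      using f(3) by (intro exI[of _ "nat (- i)"]) (simp add: V_def)
    \<comment> \<open>The first nonzero vector above a vanishing one; its index i + k becomes the
      start of the string.\<close>
    define k where "k = (LEAST k. V (i + int k) \<noteq> 0\<^sub>M)"
    have k: "V (i + int k) \<noteq> 0\<^sub>M"
      unfolding k_def using ex by (rule LeastI_ex)
    then have "k \<noteq> 0"
      using i by (metis add.right_neutral of_nat_0)
    then have "V (i + int (k - 1)) = 0\<^sub>M"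
      using not_less_Least[of "k - 1" "\<lambda>k. V (i + int k) \<noteq> 0\<^sub>M"] by (simp add: k_def)
    moreover have "i + int (k - 1) = i + int k - 1"
      using \<open>k \<noteq> 0\<close> by simp
    moreover have "V (j + (i + int k)) \<noteq> 0\<^sub>M" if "j \<ge> 0" for j
      using V_up[OF k, of "nat j"] that by (simp add: algebra_simps)
    ultimately show ?thesis
      using main[of "{0..}" "i + int k"] by (simp add: algebra_simps)
  qed
qed

end

end

section \<open>The band cases\<close>

lemma (in abelian_monoid) finsum_lessThan_Suc_shift:
  assumes "f \<in> {..<Suc n} \<rightarrow> carrier G"
  shows "finsum G f {..<Suc n} = (\<Oplus>i\<in>{..<n}. f (Suc i)) \<oplus> f 0"
proof (cases n)
  case 0
  then show ?thesis
    using assms by (simp add: lessThan_Suc)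
next
  case (Suc m)
  then show ?thesis
    using assms finsum_Suc2[of f m] by (simp add: lessThan_Suc_atMost)
qed

context wgwa_essential
begin

lemma \<sigma>_pow_minus: "r \<in> carrier R \<Longrightarrow> (\<sigma> ^^ n) (\<ominus> r) = \<ominus> (\<sigma> ^^ n) r"
  by (induction n) (auto simp: \<sigma>_minus)

lemma \<sigma>_pow_one [simp]: "(\<sigma> ^^ n) \<one> = \<one>"
  by (induction n) auto

section \<open>Residue fields along a double infinite family\<close>

context
  fixes m :: "int \<Rightarrow> 'a set"
  assumes m_max: "\<And>i. m i \<in> Max_R" and m_pred: "\<And>i. m i = pred (m (i + 1))"
begin

lemma m_pred_pow: "m i = (pred ^^ n) (m (i + int n))"
proof (induction n)
  case (Suc n)
  have "(pred ^^ Suc n) (m (i + int (Suc n))) = (pred ^^ n) (pred (m (i + int n + 1)))"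
    by (simp add: funpow_swap1 add_ac)
  then show ?case
    using Suc m_pred[of "i + int n"] by simp
qed simp

lemma band_tau_coset:
  assumes "r \<in> carrier R"
  shows "band_tau R \<sigma> m i (m 0 +> r) = m (int i) +> (\<sigma> ^^ i) r"
  unfolding band_tau_def
proof (rule the_elem_image_const)
  show "r \<in> m 0 +> r"
    using assms m_max max_zero by (simp add: mem_coset a_minus_def R.r_neg)
  fix s assume "s \<in> m 0 +> r"
  then have s: "s \<in> carrier R" "s \<ominus> r \<in> m 0"
    using assms m_max by (auto simp: mem_coset)
  then have "(\<sigma> ^^ i) (s \<ominus> r) \<in> m (int i)"
    using assms m_pred_pow[of 0 i] mem_pred_pow[of "s \<ominus> r" i "m (int i)"] by simp
  then have "(\<sigma> ^^ i) s \<ominus> (\<sigma> ^^ i) r \<in> m (int i)"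
    using assms s by (simp add: a_minus_def \<sigma>_pow_add \<sigma>_pow_minus)
  then show "m (int i) +> (\<sigma> ^^ i) s = m (int i) +> (\<sigma> ^^ i) r"
    using assms s m_max by (simp add: coset_eq_iff)
qed

text \<open>Injective because m 0 is the preimage of m i under \<sigma>^i, surjective by
  essentiality.\<close>

lemma band_tau_bij: "bij_betw (band_tau R \<sigma> m i) (carrier (R Quot m 0)) (carrier (R Quot m (int i)))"
proof (rule bij_betw_imageI)
  show "inj_on (band_tau R \<sigma> m i) (carrier (R Quot m 0))"
  proof (rule inj_onI)
    fix C D assume "C \<in> carrier (R Quot m 0)" "D \<in> carrier (R Quot m 0)"
      and eq: "band_tau R \<sigma> m i C = band_tau R \<sigma> m i D"
    then obtain r s where rs: "r \<in> carrier R" "C = m 0 +> r" "s \<in> carrier R" "D = m 0 +> s"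
      unfolding quot_carrier by blast
    then have "(\<sigma> ^^ i) r \<ominus> (\<sigma> ^^ i) s \<in> m (int i)"
      using eq m_max by (simp add: band_tau_coset coset_eq_iff)
    then have "(\<sigma> ^^ i) (r \<ominus> s) \<in> m (int i)"
      using rs by (simp add: a_minus_def \<sigma>_pow_add \<sigma>_pow_minus)
    then have "r \<ominus> s \<in> m 0"
      using rs m_pred_pow[of 0 i] mem_pred_pow[of "r \<ominus> s" i "m (int i)"] by simp
    then show "C = D"
      using rs m_max by (simp add: coset_eq_iff)
  qed
  show "band_tau R \<sigma> m i ` carrier (R Quot m 0) = carrier (R Quot m (int i))"
  proof safe
    fix C assume "C \<in> carrier (R Quot m 0)"
    then obtain r where "r \<in> carrier R" "C = m 0 +> r"
      unfolding quot_carrier by blast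
    then show "band_tau R \<sigma> m i C \<in> carrier (R Quot m (int i))"
      by (simp add: band_tau_coset)
  next
    fix C assume "C \<in> carrier (R Quot m (int i))"
    then obtain r where r: "r \<in> carrier R" "C = m (int i) +> r"
      unfolding quot_carrier by blast
    then obtain s where s: "s \<in> carrier R" "r \<ominus> (\<sigma> ^^ i) s \<in> m (int i)"
      using ess_lift_pow[OF m_max] by blast
    then have "C = band_tau R \<sigma> m i (m 0 +> s)"
      using r m_max by (simp add: band_tau_coset coset_eq_iff)
    then show "C \<in> band_tau R \<sigma> m i ` carrier (R Quot m 0)"
      using s by simp
  qed
qed

text \<open>This makes the R-action on N^f computable: on component i the scalar r acts as any s
  with \<sigma>^i s congruent to r modulo m i.\<close>

lemma inv_band_tau:
  assumes "r \<in> carrier R" "s \<in> carrier R" "r \<ominus> (\<sigma> ^^ i) s \<in> m (int i)"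
  shows "inv_into (carrier (R Quot m 0)) (band_tau R \<sigma> m i) (m (int i) +> r) = m 0 +> s"
proof -
  have "m (int i) +> r = band_tau R \<sigma> m i (m 0 +> s)"
    using assms m_max by (simp add: band_tau_coset coset_eq_iff)
  then show ?thesis
    using band_tau_bij[of i] assms by (simp add: bij_betw_def)
qed

lemma skew_field_band:
  assumes "m (int k) = m 0"
  shows "skew_field (R Quot m 0) (band_tau R \<sigma> m k)"
proof -
  interpret p: ideal "m 0" R
    using m_max by (rule max_ideal)
  interpret K: field "R Quot m 0"
    using maximalideal.quotient_is_field[OF max_maximalideal[OF m_max] R.is_cring] .
  show ?thesis
  proof (rule skew_field.intro[OF K.field_axioms], rule skew_field_axioms.intro)
    show "band_tau R \<sigma> m k \<in> ring_hom (R Quot m 0) (R Quot m 0)"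
    proof (rule ring_hom_memI)
      fix C assume C: "C \<in> carrier (R Quot m 0)"
      then show "band_tau R \<sigma> m k C \<in> carrier (R Quot m 0)"
        using band_tau_bij[of k] assms by (auto simp: bij_betw_def)
      fix D assume "D \<in> carrier (R Quot m 0)"
      then obtain r s where "r \<in> carrier R" "C = m 0 +> r" "s \<in> carrier R" "D = m 0 +> s"
        using C unfolding quot_carrier by blast
      then show "band_tau R \<sigma> m k (C \<otimes>\<^bsub>R Quot m 0\<^esub> D) =
          band_tau R \<sigma> m k C \<otimes>\<^bsub>R Quot m 0\<^esub> band_tau R \<sigma> m k D"
        "band_tau R \<sigma> m k (C \<oplus>\<^bsub>R Quot m 0\<^esub> D) =
          band_tau R \<sigma> m k C \<oplus>\<^bsub>R Quot m 0\<^esub> band_tau R \<sigma> m k D"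
        using m_max assms
        by (simp_all add: quot_add quot_mult band_tau_coset \<sigma>_pow_add \<sigma>_pow_mult)
    next
      show "band_tau R \<sigma> m k \<one>\<^bsub>R Quot m 0\<^esub> = \<one>\<^bsub>R Quot m 0\<^esub>"
        using assms by (simp add: FactRing_def band_tau_coset)
    qed
    show "bij_betw (band_tau R \<sigma> m k) (carrier (R Quot m 0)) (carrier (R Quot m 0))"
      using band_tau_bij[of k] assms by simp
  qed
qed

end

end

context wgwa_simple_weight
begin

lemma kact_closed: "p \<in> Max_R \<Longrightarrow> v \<in> W p \<Longrightarrow> C \<in> carrier (R Quot p) \<Longrightarrow> kact C v \<in> W p"
  unfolding quot_carrier using kact_coset W_ract by fastforce

end

text \<open>\<theta> identifies L_f with the weight space at m 0, with \<alpha> acting as \<Phi>. It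
  will be used with \<Phi> = X^k for N^f, and with the inverse of Y^k for M^f.\<close>

locale band_L_map = wgwa_simple_weight R \<sigma> t M
  for R :: "('r, 'a) ring_scheme" (structure) and \<sigma> t
    and M :: "('r wgwa_term set, 'm, 'b) module_scheme" +
  fixes m :: "int \<Rightarrow> 'r set" and k :: nat and \<Phi> :: "'m \<Rightarrow> 'm" and f :: "int \<Rightarrow> 'r set"
    and \<theta> :: "(int \<Rightarrow> 'r set) set \<Rightarrow> 'm" and K L
  defines "K \<equiv> R Quot m 0" and "L \<equiv> band_L R \<sigma> m k f"
  assumes irreducible: "irreducible_element (band_ring R \<sigma> m k) f"
    and \<theta>_bij: "bij_betw \<theta> (carrier L) (W (m 0))"
    and \<theta>_zero: "\<zero>\<^bsub>L\<^esub> \<in> carrier L" "\<theta> \<zero>\<^bsub>L\<^esub> = 0\<^sub>M"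
    and \<theta>_add: "\<And>C D. \<lbrakk>C \<in> carrier L; D \<in> carrier L\<rbrakk> \<Longrightarrow>
      C \<oplus>\<^bsub>L\<^esub> D \<in> carrier L \<and> \<theta> (C \<oplus>\<^bsub>L\<^esub> D) = \<theta> C +\<^sub>M \<theta> D"
    and \<theta>_coeff: "\<And>r C. \<lbrakk>r \<in> carrier R; C \<in> carrier L\<rbrakk> \<Longrightarrow>
      skew_monom K (m 0 +> r) 0 \<odot>\<^bsub>L\<^esub> C \<in> carrier L \<and>
      \<theta> (skew_monom K (m 0 +> r) 0 \<odot>\<^bsub>L\<^esub> C) = r \<star> \<theta> C"
    and \<theta>_alpha: "\<And>C. C \<in> carrier L \<Longrightarrow>
      skew_monom K \<one>\<^bsub>K\<^esub> 1 \<odot>\<^bsub>L\<^esub> C \<in> carrier L \<and>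
      \<theta> (skew_monom K \<one>\<^bsub>K\<^esub> 1 \<odot>\<^bsub>L\<^esub> C) = \<Phi> (\<theta> C)"
    and \<theta>_alpha_inv: "\<And>C. C \<in> carrier L \<Longrightarrow>
      skew_monom K \<one>\<^bsub>K\<^esub> (-1) \<odot>\<^bsub>L\<^esub> C \<in> carrier L \<and>
      \<theta> (skew_monom K \<one>\<^bsub>K\<^esub> (-1) \<odot>\<^bsub>L\<^esub> C) = inv_into (W (m 0)) \<Phi> (\<theta> C)"
begin

lemma \<theta>_W: "C \<in> carrier L \<Longrightarrow> \<theta> C \<in> W (m 0)"
  using \<theta>_bij by (auto simp: bij_betw_def)

end

context wgwa_simple_weight
begin

text \<open>Makes W (m 0) a simple P-module, K acting through residue classes and \<alpha> as
  \<Phi>. The polynomial f generates the annihilator of a nonzero vector v, and \<theta> is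
  evaluation at v.\<close>

lemma band_L_iso:
  fixes m :: "int \<Rightarrow> 'r set" and k :: nat and \<Phi> :: "'m \<Rightarrow> 'm"
  assumes m_max: "\<And>i. m i \<in> Max_R" and m_pred: "\<And>i. m i = pred (m (i + 1))"
    and m_per: "m (int k) = m 0"
    and bij: "bij_betw \<Phi> (W (m 0)) (W (m 0))"
    and add: "\<And>v w. v \<in> W (m 0) \<Longrightarrow> w \<in> W (m 0) \<Longrightarrow> \<Phi> (v +\<^sub>M w) = \<Phi> v +\<^sub>M \<Phi> w"
    and semilinear: "\<And>r v. r \<in> carrier R \<Longrightarrow> v \<in> W (m 0) \<Longrightarrow> \<Phi> (r \<star> v) = (\<sigma> ^^ k) r \<star> \<Phi> v"
    and nonzero: "W (m 0) \<noteq> {0\<^sub>M}"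
    and simp: "\<And>H. \<lbrakk>H \<subseteq> W (m 0); 0\<^sub>M \<in> H; \<And>v w. v \<in> H \<Longrightarrow> w \<in> H \<Longrightarrow> v +\<^sub>M w \<in> H;
        \<And>r v. r \<in> carrier R \<Longrightarrow> v \<in> H \<Longrightarrow> r \<star> v \<in> H; \<And>v. v \<in> H \<Longrightarrow> \<Phi> v \<in> H;
        \<And>v. v \<in> H \<Longrightarrow> inv_into (W (m 0)) \<Phi> v \<in> H; H \<noteq> {0\<^sub>M}\<rbrakk> \<Longrightarrow> H = W (m 0)"
  obtains f \<theta> where "band_L_map R \<sigma> t M m k \<Phi> f \<theta>"
proof -
  let ?p = "m 0" and ?V = "M\<lparr>carrier := W (m 0)\<rparr>"
  note p = m_max[of 0]
  note WM = W_carrier[of _ ?p]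
  have inv: "\<ominus>\<^bsub>M\<^esub> v \<in> W ?p" if "v \<in> W ?p" for v
    using W_ract[OF p that, of "\<ominus> \<one>"] ract_minus[of \<one> v] WM[OF that] by simp
  interpret V: abelian_group ?V
  proof (rule abelian_groupI)
    fix v assume v: "v \<in> carrier ?V"
    then show "\<exists>w \<in> carrier ?V. w \<oplus>\<^bsub>?V\<^esub> v = \<zero>\<^bsub>?V\<^esub>"
      using inv[of v] WM[of v] by (auto simp: M.l_neg intro!: bexI[of _ "\<ominus>\<^bsub>M\<^esub> v"])
  qed (use W_add[OF p] W_zero[OF p] WM in \<open>auto simp: M.a_ac\<close>)
  interpret skew_field "R Quot ?p" "band_tau R \<sigma> m k"
    using m_max m_pred m_per by (rule skew_field_band)
  interpret skew_rep "R Quot ?p" "band_tau R \<sigma> m k" ?V kact \<Phi>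
  proof unfold_locales
    fix C v assume C: "C \<in> carrier (R Quot ?p)" and v: "v \<in> carrier ?V"
    obtain r where r: "r \<in> carrier R" "C = ?p +> r"
      using C unfolding quot_carrier by blast
    show "kact C v \<in> carrier ?V"
      using kact_closed[OF p _ C] v by simp
    show "\<Phi> (kact C v) = kact (band_tau R \<sigma> m k C) (\<Phi> v)"
    proof -
      have "\<Phi> v \<in> W ?p"
        using v bij by (auto simp: bij_betw_def)
      then show ?thesis
        using r v semilinear band_tau_coset[of m r k, OF m_max m_pred r(1)] m_max m_per
        by (simp add: kact_coset)
    qed
    show "kact C (v \<oplus>\<^bsub>?V\<^esub> w) = kact C v \<oplus>\<^bsub>?V\<^esub> kact C w" if "w \<in> carrier ?V" for w
      using r v that W_add[OF p] WM by (simp add: kact_coset p tact_plus)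
    fix D assume D: "D \<in> carrier (R Quot ?p)"
    obtain s where s: "s \<in> carrier R" "D = ?p +> s"
      using D unfolding quot_carrier by blast
    show "kact (C \<oplus>\<^bsub>R Quot ?p\<^esub> D) v = kact C v \<oplus>\<^bsub>?V\<^esub> kact D v"
      using r s v WM by (simp add: quot_add kact_coset p ract_add)
    show "kact (C \<otimes>\<^bsub>R Quot ?p\<^esub> D) v = kact C (kact D v)"
      using r s v WM W_ract[OF p] by (simp add: quot_mult kact_coset p ract_mult)
  next
    fix v assume "v \<in> carrier ?V"
    then show "kact \<one>\<^bsub>R Quot ?p\<^esub> v = v"
      using WM by (simp add: FactRing_def kact_coset p)
  next
    fix H assume H: "additive_subgroup H ?V"
      and act: "\<And>C v. \<lbrakk>C \<in> carrier (R Quot ?p); v \<in> H\<rbrakk> \<Longrightarrow> kact C v \<in> H"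
      and iter: "\<And>v i. v \<in> H \<Longrightarrow> int_iter ?V \<Phi> i v \<in> H" and H0: "H \<noteq> {\<zero>\<^bsub>?V\<^esub>}"
    interpret H: additive_subgroup H ?V by fact
    have sub: "H \<subseteq> W ?p"
      using H.a_subset by simp
    have "H = W ?p"
    proof (rule simp[OF sub])
      show "r \<star> v \<in> H" if "r \<in> carrier R" "v \<in> H" for r v
        using act[of "?p +> r" v] that sub p by (simp add: kact_coset subset_iff)
      show "\<Phi> v \<in> H" "inv_into (W ?p) \<Phi> v \<in> H" if "v \<in> H" for v
        using iter[OF that, of 1] iter[OF that, of "-1"] by (simp_all add: int_iter_minus_one)
    qed (use H.zero_closed H.a_closed H0 in auto)
    then show "H = carrier ?V" by simp
  qed (use bij add nonzero in auto)
  obtain v where v: "v \<in> carrier ?V" "v \<noteq> \<zero>\<^bsub>?V\<^esub>"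
    using nontrivial V.zero_closed by blast
  obtain f where f: "f \<in> carrier P" "f \<noteq> \<zero>\<^bsub>P\<^esub>" "ann v = left_multiples P f"
    using ann_principal v by blast
  have irr: "irreducible_element (band_ring R \<sigma> m k) f"
    unfolding band_ring_def using v f by (rule generator_irreducible)
  have L: "left_quotient P f = band_L R \<sigma> m k f"
    by (simp add: band_L_def band_ring_def)
  define \<theta> where "\<theta> C = the_elem ((\<lambda>p. ev p v) ` C)" for C
  note iso = left_quotient_iso[OF v f(1,3), folded \<theta>_def, unfolded L]
  have \<theta>W: "\<theta> C \<in> W ?p" if "C \<in> carrier (band_L R \<sigma> m k f)" for C
    using iso(1) that by (auto simp: bij_betw_def)
  have "band_L_map R \<sigma> t M m k \<Phi> f \<theta>"
  proof (unfold_locales)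
    show "irreducible_element (band_ring R \<sigma> m k) f" by (rule irr)
    show "bij_betw \<theta> (carrier (band_L R \<sigma> m k f)) (W ?p)"
      using iso(1) by simp
    show "skew_monom (R Quot ?p) (?p +> r) 0 \<odot>\<^bsub>band_L R \<sigma> m k f\<^esub> C \<in> carrier (band_L R \<sigma> m k f) \<and>
      \<theta> (skew_monom (R Quot ?p) (?p +> r) 0 \<odot>\<^bsub>band_L R \<sigma> m k f\<^esub> C) = r \<star> \<theta> C"
      if "r \<in> carrier R" "C \<in> carrier (band_L R \<sigma> m k f)" for r C
      using iso(6,7)[of "?p +> r" C 0] that \<theta>W by (simp add: kact_coset p)
    show "skew_monom (R Quot ?p) \<one>\<^bsub>R Quot ?p\<^esub> 1 \<odot>\<^bsub>band_L R \<sigma> m k f\<^esub> C \<in> carrier (band_L R \<sigma> m k f) \<and>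
      \<theta> (skew_monom (R Quot ?p) \<one>\<^bsub>R Quot ?p\<^esub> 1 \<odot>\<^bsub>band_L R \<sigma> m k f\<^esub> C) = \<Phi> (\<theta> C)"
      if "C \<in> carrier (band_L R \<sigma> m k f)" for C
    proof -
      have "\<Phi> (\<theta> C) \<in> W ?p"
        using \<theta>W[OF that] bij by (auto simp: bij_betw_def)
      then show ?thesis
        using iso(6,7)[of "\<one>\<^bsub>R Quot ?p\<^esub>" C 1] that by simp
    qed
    show "skew_monom (R Quot ?p) \<one>\<^bsub>R Quot ?p\<^esub> (-1) \<odot>\<^bsub>band_L R \<sigma> m k f\<^esub> C \<in> carrier (band_L R \<sigma> m k f) \<and>
      \<theta> (skew_monom (R Quot ?p) \<one>\<^bsub>R Quot ?p\<^esub> (-1) \<odot>\<^bsub>band_L R \<sigma> m k f\<^esub> C) =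
        inv_into (W ?p) \<Phi> (\<theta> C)"
      if "C \<in> carrier (band_L R \<sigma> m k f)" for C
      using iso(6,7)[of "\<one>\<^bsub>R Quot ?p\<^esub>" C "-1"] that vw_closed[of "\<theta> C" "-1"] \<theta>W[OF that]
      by (simp add: int_iter_minus_one)
  qed (use iso(2,3,4,5) in simp_all)
  then show thesis by (rule that)
qed

end

text \<open>The two kinds of band modules are treated together: \<open>Z\<close> is the generator that acts bijectively,
  \<open>Z'\<close> is the other one.\<close>

locale band_frame = wgwa_simple_weight R \<sigma> t M
  for R :: "('r, 'a) ring_scheme" (structure) and \<sigma> t
    and M :: "('r wgwa_term set, 'm, 'b) module_scheme" +
  fixes k :: nat and mu :: "nat \<Rightarrow> 'r set" and \<zeta> \<zeta>' :: "'r wgwa_term" and c :: 'r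
  assumes k: "0 < k" and mu_max: "\<And>i. mu i \<in> Max_R"
    and mu_eq: "\<And>i j. mu i = mu j \<longleftrightarrow> i mod k = j mod k"
    and supp: "\<And>q v. \<lbrakk>q \<in> Max_R; v \<in> W q; v \<noteq> 0\<^sub>M\<rbrakk> \<Longrightarrow> \<exists>i. q = mu i"
    and zeta: "{\<zeta>, \<zeta>'} = {GenX, GenY}"
    and Z_bij: "\<And>i. bij_betw (tact \<zeta>) (W (mu i)) (W (mu (Suc i)))"
    and Z'Z: "\<And>v. v \<in> carrier M \<Longrightarrow> tact \<zeta>' (tact \<zeta> v) = c \<star> v" and c: "c \<in> carrier R"
    and r_Z_pow: "\<And>r i. r \<in> carrier R \<Longrightarrow>
      \<exists>s \<in> carrier R. \<forall>h \<in> W (mu 0). r \<star> (tact \<zeta> ^^ i) h = (tact \<zeta> ^^ i) (s \<star> h)"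
begin

abbreviation "Z \<equiv> tact \<zeta>"
abbreviation "Z' \<equiv> tact \<zeta>'"

lemma zeta_terms [simp]: "\<zeta> \<in> wgwa_terms R" "\<zeta>' \<in> wgwa_terms R"
  using zeta by (auto simp: doubleton_eq_iff)

lemma Z_pow_bij: "bij_betw (Z ^^ i) (W (mu j)) (W (mu (j + i)))"
proof (induction i)
  case (Suc i)
  then show ?case
    using bij_betw_trans[OF Suc Z_bij[of "j + i"]] by (simp add: comp_def)
qed (simp add: bij_betw_def)

lemma Z_pow_W: "h \<in> W (mu j) \<Longrightarrow> (Z ^^ i) h \<in> W (mu (j + i))"
  using Z_pow_bij by (auto simp: bij_betw_def)

lemma Z_pow_closed [simp]: "v \<in> carrier M \<Longrightarrow> (Z ^^ i) v \<in> carrier M"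
  by (induction i) auto

lemma Z_pow_zero [simp]: "(Z ^^ i) 0\<^sub>M = 0\<^sub>M"
  by (induction i) auto

lemma Z_pow_plus: "v \<in> carrier M \<Longrightarrow> w \<in> carrier M \<Longrightarrow> (Z ^^ i) (v +\<^sub>M w) = (Z ^^ i) v +\<^sub>M (Z ^^ i) w"
  by (induction i) (auto simp: tact_plus)

lemma Z_pow_k: "bij_betw (Z ^^ k) (W (mu 0)) (W (mu 0))"
  using Z_pow_bij[of k 0] mu_eq[of k 0] by simp

text \<open>Simplicity passes from M to W (mu 0): the Z^i H span M, and a nonzero Z^i h of weight mu
  0 has i divisible by k, so it lies in H already.\<close>

lemma weight_zero_simple:
  assumes H: "H \<subseteq> W (mu 0)" "0\<^sub>M \<in> H" "\<And>v w. v \<in> H \<Longrightarrow> w \<in> H \<Longrightarrow> v +\<^sub>M w \<in> H"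
    and ract: "\<And>r v. r \<in> carrier R \<Longrightarrow> v \<in> H \<Longrightarrow> r \<star> v \<in> H"
    and Zk: "\<And>h. h \<in> H \<Longrightarrow> (Z ^^ k) h \<in> H" and Zk': "\<And>h. h \<in> H \<Longrightarrow> \<exists>h' \<in> H. h = (Z ^^ k) h'"
    and nonzero: "H \<noteq> {0\<^sub>M}"
  shows "H = W (mu 0)"
proof -
  let ?G = "{(Z ^^ i) h | i h. h \<in> H}"
  have HM: "h \<in> carrier M" if "h \<in> H" for h
    using that H W_carrier by blast
  have G_W: "\<exists>p \<in> Max_R. g \<in> W p" if g: "g \<in> ?G" for g
  proof -
    obtain i h where "h \<in> H" "g = (Z ^^ i) h"
      using g by blast
    then show ?thesis
      using Z_pow_W[of h 0 i] H mu_max by (intro bexI[of _ "mu i"]) auto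
  qed
  then have G: "?G \<subseteq> carrier M"
    using W_carrier by blast
  have ZG: "Z g \<in> spn ?G" if g: "g \<in> ?G" for g
  proof -
    obtain i h where "h \<in> H" "g = (Z ^^ i) h"
      using g by blast
    then have "Z g = (Z ^^ Suc i) h" "h \<in> H"
      by simp_all
    then have "Z g \<in> ?G"
      by blast
    then show ?thesis
      by (rule spn_base[OF G])
  qed
  have rG: "r \<star> g \<in> ?G" if r: "r \<in> carrier R" and g: "g \<in> ?G" for r g
  proof -
    obtain i h where h: "h \<in> H" "g = (Z ^^ i) h"
      using g by blast
    then obtain s where "s \<in> carrier R" "r \<star> g = (Z ^^ i) (s \<star> h)"
      using r_Z_pow[OF r, of i] H by blast
    then show ?thesis
      using ract h by blast
  qed
  have Z'G: "Z' g \<in> spn ?G" if g: "g \<in> ?G" for g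
  proof -
    obtain i h where h: "h \<in> H" "g = (Z ^^ i) h"
      using g by blast
    \<comment> \<open>Z' is known only after a Z. For i = 0 the vector h is rewritten as Z^k h',
      which is where stability of H under the inverse of Z^k enters.\<close>
    obtain j h' where h': "h' \<in> H" "g = (Z ^^ Suc j) h'"
    proof (cases i)
      case 0
      obtain h' where "h' \<in> H" "h = (Z ^^ k) h'"
        using Zk' h by blast
      then show ?thesis
        using that[of h' "k - 1"] 0 k h by simp
    qed (use h that in blast)
    then have "Z' g = c \<star> (Z ^^ j) h'"
      using Z'Z HM by simp
    moreover have "(Z ^^ j) h' \<in> ?G"
      using h'(1) by blast
    ultimately have "Z' g \<in> ?G"
      using rG[OF c] by simp
    then show ?thesis
      by (rule spn_base[OF G])
  qed
  obtain h where h: "h \<in> H" "h \<noteq> 0\<^sub>M"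
    using nonzero H(2) by blast
  then have "(Z ^^ 0) h \<in> ?G"
    by blast
  then have "h \<in> ?G"
    by simp
  have XY: "X g \<in> spn ?G \<and> Y g \<in> spn ?G" if "g \<in> ?G" for g
    using ZG[OF that] Z'G[OF that] zeta by (auto simp: doubleton_eq_iff)
  have span: "spn ?G = carrier M"
    by (rule spn_submodule[OF G \<open>h \<in> ?G\<close> h(2) rG]) (use XY in auto)
  have "v \<in> H" if v: "v \<in> W (mu 0)" for v
  proof (rule spn_weight[OF G span G_W mu_max[of 0] H(2,3) _ v])
    fix g assume g: "g \<in> ?G" "g \<in> W (mu 0)" "g \<noteq> 0\<^sub>M"
    then obtain i h where h: "h \<in> H" "g = (Z ^^ i) h"
      by blast
    then have "g \<in> W (mu i)"
      using Z_pow_W[of h 0 i] H by auto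
    then have "mu i = mu 0"
      using W_unique[OF mu_max mu_max _ g(2,3)] by blast
    then have "k dvd i"
      using mu_eq[of i 0] by (simp add: mod_eq_0_iff_dvd)
    then obtain j where "i = k * j" ..
    then have "i = j * k"
      by simp
    moreover have "(Z ^^ (j * k)) h \<in> H" for j
      by (induction j) (use h Zk in \<open>auto simp: funpow_add\<close>)
    ultimately show "g \<in> H"
      using h by simp
  qed
  then show ?thesis
    using H by blast
qed

end

text \<open>What the two band modules share: \<rho>L i is the R-action on component i, and a closes
  the cycle, as \<alpha> for N^f and as its inverse for M^f. Component C at index i stands for Z^i
  (\<theta> C) in M.\<close>

locale band_frame_iso = band_frame R \<sigma> t M k mu \<zeta> \<zeta>' c
  for R :: "('r, 'a) ring_scheme" (structure) and \<sigma> t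
    and M :: "('r wgwa_term set, 'm, 'b) module_scheme"
    and k mu \<zeta> \<zeta>' c +
  fixes Lc :: "'l set" and plL :: "'l \<Rightarrow> 'l \<Rightarrow> 'l" and zL :: 'l and \<theta> :: "'l \<Rightarrow> 'm"
    and \<rho>L :: "nat \<Rightarrow> 'r \<Rightarrow> 'l \<Rightarrow> 'l" and a :: "'l \<Rightarrow> 'l"
  assumes \<theta>_bij: "bij_betw \<theta> Lc (W (mu 0))" and zL: "zL \<in> Lc" "\<theta> zL = 0\<^sub>M"
    and plL: "\<And>C D. \<lbrakk>C \<in> Lc; D \<in> Lc\<rbrakk> \<Longrightarrow> plL C D \<in> Lc \<and> \<theta> (plL C D) = \<theta> C +\<^sub>M \<theta> D"
    and \<rho>L: "\<And>i r C. \<lbrakk>r \<in> carrier R; C \<in> Lc\<rbrakk> \<Longrightarrow> \<rho>L i r C \<in> Lc \<and> (Z ^^ i) (\<theta> (\<rho>L i r C)) = r \<star> (Z ^^ i) (\<theta> C)"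
    and a: "\<And>C. C \<in> Lc \<Longrightarrow> a C \<in> Lc \<and> \<theta> (a C) = (Z ^^ k) (\<theta> C)"
begin

abbreviation "band_carrier \<equiv> \<Pi>\<^sub>E i \<in> {..<k}. Lc"

definition band_sum :: "(nat \<Rightarrow> 'l) \<Rightarrow> 'm"
  where "band_sum v = finsum M (\<lambda>i. (Z ^^ i) (\<theta> (v i))) {..<k}"

lemma \<theta>_W: "C \<in> Lc \<Longrightarrow> \<theta> C \<in> W (mu 0)"
  using \<theta>_bij by (auto simp: bij_betw_def)

lemma band_term_W: "C \<in> Lc \<Longrightarrow> (Z ^^ i) (\<theta> C) \<in> W (mu i)"
  using Z_pow_W[OF \<theta>_W, of C i] by simp

lemma band_term_closed [simp]: "C \<in> Lc \<Longrightarrow> (Z ^^ i) (\<theta> C) \<in> carrier M"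
  using band_term_W W_carrier by blast

lemma band_mem: "v \<in> band_carrier \<Longrightarrow> i < k \<Longrightarrow> v i \<in> Lc"
  by auto

lemma band_sum_closed: "v \<in> band_carrier \<Longrightarrow> band_sum v \<in> carrier M"
  unfolding band_sum_def by (intro M.finsum_closed Pi_I) (simp add: band_mem)

lemma band_sum_additive:
  assumes "v \<in> band_carrier" and h: "h \<in> carrier M \<rightarrow> carrier M"
    "\<And>x y. x \<in> carrier M \<Longrightarrow> y \<in> carrier M \<Longrightarrow> h (x +\<^sub>M y) = h x +\<^sub>M h y"
  shows "h (band_sum v) = finsum M (\<lambda>i. h ((Z ^^ i) (\<theta> (v i)))) {..<k}"
proof -
  have "h 0\<^sub>M = 0\<^sub>M"
    using h(2)[of "0\<^sub>M" "0\<^sub>M"] h(1) M.add.l_cancel_one'[of "h 0\<^sub>M" "h 0\<^sub>M"] by auto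
  then show ?thesis
    unfolding band_sum_def using assms
    by (intro M.finsum_additive[OF M.abelian_monoid_axioms]) (auto simp: band_mem)
qed

text \<open>Indices below k have distinct weights, so projections recover the components;
  injectivity of \<open>band_sum\<close> follows.\<close>

lemma pr_band_sum:
  assumes v: "v \<in> band_carrier" and i: "i < k"
  shows "pr (mu i) (band_sum v) = (Z ^^ i) (\<theta> (v i))"
proof -
  have summand: "pr (mu i) ((Z ^^ j) (\<theta> (v j))) = (if j = i then (Z ^^ i) (\<theta> (v i)) else 0\<^sub>M)" if "j < k" for j
    using pr_of_W[OF mu_max mu_max band_term_W[OF band_mem[OF v that]], of i j] mu_eq[of i j] i that
    by auto
  have "pr (mu i) (band_sum v) = finsum M (\<lambda>j. pr (mu i) ((Z ^^ j) (\<theta> (v j)))) {..<k}"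
    using v by (rule band_sum_additive) (auto simp: mu_max pr_add)
  also have "\<dots> = pr (mu i) ((Z ^^ i) (\<theta> (v i)))"
    using i summand by (intro M.finsum_single) (auto simp: mu_max band_mem[OF v])
  also have "\<dots> = (Z ^^ i) (\<theta> (v i))"
    using summand[OF i] by simp
  finally show ?thesis .
qed

lemma band_sum_plus:
  assumes vw: "v \<in> band_carrier" "w \<in> band_carrier"
  defines "u \<equiv> \<lambda>i \<in> {..<k}. plL (v i) (w i)"
  shows "u \<in> band_carrier \<and> band_sum u = band_sum v +\<^sub>M band_sum w"
proof -
  have "band_sum u = finsum M (\<lambda>i. (Z ^^ i) (\<theta> (v i)) +\<^sub>M (Z ^^ i) (\<theta> (w i))) {..<k}"
    unfolding band_sum_def
  proof (rule M.finsum_cong')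
    fix i assume "i \<in> {..<k}"
    then have "v i \<in> Lc" "w i \<in> Lc" "u i = plL (v i) (w i)"
      using band_mem[OF vw(1)] band_mem[OF vw(2)] by (simp_all add: u_def)
    then show "(Z ^^ i) (\<theta> (u i)) = (Z ^^ i) (\<theta> (v i)) +\<^sub>M (Z ^^ i) (\<theta> (w i))"
      using plL W_carrier[OF \<theta>_W] by (simp add: Z_pow_plus)
  qed (simp_all add: band_mem[OF vw(1)] band_mem[OF vw(2)])
  also have "\<dots> = band_sum v +\<^sub>M band_sum w"
    unfolding band_sum_def by (intro M.finsum_addf Pi_I) (simp_all add: band_mem[OF vw(1)] band_mem[OF vw(2)])
  finally show ?thesis
    using plL band_mem[OF vw(1)] band_mem[OF vw(2)] by (auto simp: u_def)
qed

lemma band_sum_ract: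
  assumes v: "v \<in> band_carrier" and r: "r \<in> carrier R"
  defines "u \<equiv> \<lambda>i \<in> {..<k}. \<rho>L i r (v i)"
  shows "u \<in> band_carrier \<and> band_sum u = r \<star> band_sum v"
proof -
  have "band_sum u = finsum M (\<lambda>i. r \<star> (Z ^^ i) (\<theta> (v i))) {..<k}"
    unfolding band_sum_def
  proof (rule M.finsum_cong')
    fix i assume "i \<in> {..<k}"
    then show "(Z ^^ i) (\<theta> (u i)) = r \<star> (Z ^^ i) (\<theta> (v i))"
      using \<rho>L[OF r, of "v i" i] band_mem[OF v] by (simp add: u_def)
  qed (simp_all add: band_mem[OF v] r)
  also have "\<dots> = r \<star> band_sum v"
    using v r by (intro band_sum_additive[symmetric]) (auto simp: tact_plus)
  finally show ?thesis
    using band_mem[OF v] \<rho>L[OF r] by (auto simp: u_def)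
qed

text \<open>Z sends summand i to summand i + 1. The last one becomes Z^k \<theta> (v (k - 1)), back
  at weight mu 0, where it is \<theta> of a (v (k - 1)).\<close>

lemma band_sum_shift:
  assumes v: "v \<in> band_carrier"
  shows "cyclic_shift k a v \<in> band_carrier \<and> band_sum (cyclic_shift k a v) = Z (band_sum v)"
proof -
  let ?u = "cyclic_shift k a v"
  obtain k' where k': "k = Suc k'"
    using k by (metis gr0_implies_Suc)
  have u0: "?u 0 = a (v k')" and uS: "\<And>i. i < k' \<Longrightarrow> ?u (Suc i) = v i"
    by (simp_all add: cyclic_shift_def k')
  have mem: "?u \<in> band_carrier"
    using band_mem[OF v] a k by (auto simp: cyclic_shift_def)
  have "band_sum ?u = finsum M (\<lambda>i. (Z ^^ i) (\<theta> (?u i))) {..<Suc k'}"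
    by (simp only: band_sum_def k'[symmetric])
  also have "\<dots> = finsum M (\<lambda>i. (Z ^^ Suc i) (\<theta> (?u (Suc i)))) {..<k'} +\<^sub>M (Z ^^ 0) (\<theta> (?u 0))"
    using band_mem[OF mem] k' by (intro M.finsum_lessThan_Suc_shift Pi_I) simp
  also have "\<dots> = finsum M (\<lambda>i. Z ((Z ^^ i) (\<theta> (v i)))) {..<k'} +\<^sub>M Z ((Z ^^ k') (\<theta> (v k')))"
  proof -
    have "(\<Oplus>\<^bsub>M\<^esub>i\<in>{..<k'}. (Z ^^ Suc i) (\<theta> (?u (Suc i)))) =
        (\<Oplus>\<^bsub>M\<^esub>i\<in>{..<k'}. Z ((Z ^^ i) (\<theta> (v i))))"
    proof (rule M.finsum_cong')
      fix i assume "i \<in> {..<k'}"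
      then show "(Z ^^ Suc i) (\<theta> (?u (Suc i))) = Z ((Z ^^ i) (\<theta> (v i)))"
        by (simp add: uS)
    qed (use band_mem[OF v] k' in auto)
    moreover have "v k' \<in> Lc"
      using band_mem[OF v, of k'] k' by simp
    then have "\<theta> (?u 0) = (Z ^^ Suc k') (\<theta> (v k'))"
      using a[of "v k'"] u0 by (simp only: k'[symmetric])
    ultimately show ?thesis
      by simp
  qed
  also have "\<dots> = finsum M (\<lambda>i. Z ((Z ^^ i) (\<theta> (v i)))) {..<k}"
    using band_mem[OF v] k' by (simp add: lessThan_Suc M.a_comm Pi_iff)
  also have "\<dots> = Z (band_sum v)"
    using v by (intro band_sum_additive[symmetric]) (auto simp: tact_plus)
  finally show ?thesis
    using mem by simp
qed

lemma band_sum_bij: "bij_betw band_sum band_carrier (carrier M)"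
proof (rule bij_betw_imageI)
  show "inj_on band_sum band_carrier"
  proof (rule inj_onI)
    fix v w assume vw: "v \<in> band_carrier" "w \<in> band_carrier" "band_sum v = band_sum w"
    show "v = w"
    proof (rule PiE_ext[OF vw(1,2)])
      fix i assume "i \<in> {..<k}"
      then have i: "i < k" by simp
      have "(Z ^^ i) (\<theta> (v i)) = (Z ^^ i) (\<theta> (w i))"
        using pr_band_sum[OF vw(1) i] pr_band_sum[OF vw(2) i] vw(3) by simp
      then have "\<theta> (v i) = \<theta> (w i)"
        using Z_pow_bij[of i 0] \<theta>_W[OF band_mem[OF vw(1) i]] \<theta>_W[OF band_mem[OF vw(2) i]]
        by (meson bij_betw_def inj_onD)
      then show "v i = w i"
        using \<theta>_bij band_mem[OF vw(1) i] band_mem[OF vw(2) i] by (meson bij_betw_def inj_onD)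
    qed
  qed
  have W_sub: "g \<in> band_sum ` band_carrier" if q: "q \<in> Max_R" and g: "g \<in> W q" "g \<noteq> 0\<^sub>M" for q g
  proof -
    obtain j where "q = mu j"
      using supp q g by blast
    define i where "i = j mod k"
    have i: "i < k" "q = mu i"
      using k \<open>q = mu j\<close> mu_eq by (simp_all add: i_def)
    then have "g \<in> (Z ^^ i) ` W (mu 0)"
      using Z_pow_bij[of i 0] g by (simp add: bij_betw_def)
    then obtain h where h: "h \<in> W (mu 0)" "(Z ^^ i) h = g"
      by blast
    have "h \<in> \<theta> ` Lc"
      using \<theta>_bij h by (simp add: bij_betw_def)
    then obtain C where C: "C \<in> Lc" "\<theta> C = h"
      by blast
    define v where "v = (\<lambda>j \<in> {..<k}. if j = i then C else zL)"
    have v: "v \<in> band_carrier"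
      using C zL by (auto simp: v_def)
    have "band_sum v = (Z ^^ i) (\<theta> (v i))"
      unfolding band_sum_def using i C zL by (intro M.finsum_single) (auto simp: v_def)
    then have "band_sum v = g"
      using i C h by (simp add: v_def)
    then show ?thesis
      using v by blast
  qed
  have zero: "0\<^sub>M \<in> band_sum ` band_carrier"
  proof -
    let ?z = "\<lambda>i \<in> {..<k}. zL"
    have "band_sum ?z = 0\<^sub>M"
      unfolding band_sum_def using zL by (intro M.add.finprod_one_eqI) auto
    moreover have "?z \<in> band_carrier"
      using zL by auto
    ultimately show ?thesis
      by (metis imageI)
  qed
  have "x \<in> band_sum ` band_carrier" if x: "x \<in> carrier M" for x
  proof -
    have "x \<in> spn {g. \<exists>q \<in> Max_R. g \<in> W q}"
    proof (rule mem_spn_weights[OF x])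
      show G: "{g. \<exists>q \<in> Max_R. g \<in> W q} \<subseteq> carrier M"
        using W_carrier by blast
      show "pr p x \<in> spn {g. \<exists>q \<in> Max_R. g \<in> W q}" if "p \<in> Max_R" for p
        using spn_base[OF G] pr_W[OF x that] that by blast
    qed
    then show ?thesis
    proof (rule spn_least)
      show "{g. \<exists>q \<in> Max_R. g \<in> W q} \<subseteq> band_sum ` band_carrier"
        using W_sub zero by blast
      fix y z assume "y \<in> band_sum ` band_carrier" "z \<in> band_sum ` band_carrier"
      then obtain v w where vw: "v \<in> band_carrier" "w \<in> band_carrier" "y = band_sum v" "z = band_sum w"
        by blast
      define u where "u = (\<lambda>i \<in> {..<k}. plL (v i) (w i))"
      have "u \<in> band_carrier" "y +\<^sub>M z = band_sum u"
        using band_sum_plus[OF vw(1,2)] by (simp_all add: u_def vw)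
      then show "y +\<^sub>M z \<in> band_sum ` band_carrier"
        by blast
    qed (rule zero)
  qed
  then show "band_sum ` band_carrier = carrier M"
    using band_sum_closed by blast
qed

text \<open>The second generator of a band module is a scalar after the inverse of the shift, so w
  must be shown to be a shift. Z is onto M, and injectivity of \<open>band_sum\<close> carries a
  preimage under Z over to one under the shift; then Z' Z = c applies.\<close>

lemma band_sum_back:
  assumes w: "w \<in> band_carrier"
  defines "u \<equiv> \<lambda>i \<in> {..<k}. \<rho>L i c (inv_into band_carrier (cyclic_shift k a) w i)"
  shows "u \<in> band_carrier \<and> band_sum u = Z' (band_sum w)"
proof -
  have "\<exists>x \<in> carrier M. Z x = band_sum w"
  proof -
    have "band_sum w \<in> spn {g. \<exists>q \<in> Max_R. g \<in> W q}"
    proof (rule mem_spn_weights[OF band_sum_closed[OF w]])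
      show G: "{g. \<exists>q \<in> Max_R. g \<in> W q} \<subseteq> carrier M"
        using W_carrier by blast
      show "pr p (band_sum w) \<in> spn {g. \<exists>q \<in> Max_R. g \<in> W q}" if "p \<in> Max_R" for p
        using spn_base[OF G] pr_W[OF band_sum_closed[OF w] that] that by blast
    qed
    then have "band_sum w \<in> Z ` carrier M"
    proof (rule spn_least)
      show "0\<^sub>M \<in> Z ` carrier M"
        by (intro image_eqI[of _ _ "0\<^sub>M"]) auto
      then show "{g. \<exists>q \<in> Max_R. g \<in> W q} \<subseteq> Z ` carrier M"
      proof (intro subsetI)
        fix g assume zero: "0\<^sub>M \<in> Z ` carrier M" and "g \<in> {g. \<exists>q \<in> Max_R. g \<in> W q}"
        then obtain q where q: "q \<in> Max_R" "g \<in> W q"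
          by blast
        show "g \<in> Z ` carrier M"
        proof (cases "g = 0\<^sub>M")
          case False
          then obtain i where "q = mu i"
            using supp q by blast
          \<comment> \<open>Adding k provides a predecessor also for the index 0.\<close>
          moreover have "mu i = mu (Suc (i + k - 1))"
            using k mu_eq[of i "Suc (i + k - 1)"] by simp
          ultimately have "g \<in> Z ` W (mu (i + k - 1))"
            using Z_bij[of "i + k - 1"] q(2) by (simp add: bij_betw_def)
          then show ?thesis
            using W_carrier by blast
        qed (use zero in simp)
      qed
      show "x +\<^sub>M y \<in> Z ` carrier M" if "x \<in> Z ` carrier M" "y \<in> Z ` carrier M" for x y
      proof -
        obtain x' y' where "x' \<in> carrier M" "y' \<in> carrier M" "x = Z x'" "y = Z y'"
          using \<open>x \<in> _\<close> \<open>y \<in> _\<close> by blast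
        then show ?thesis
          by (intro image_eqI[of _ _ "x' +\<^sub>M y'"]) (auto simp: tact_plus)
      qed
    qed
    then show ?thesis by auto
  qed
  then obtain x where x: "x \<in> carrier M" "Z x = band_sum w"
    by blast
  have "x \<in> band_sum ` band_carrier"
    using band_sum_bij x by (simp add: bij_betw_def)
  then obtain v where v: "v \<in> band_carrier" "band_sum v = x"
    by blast
  have "band_sum (cyclic_shift k a v) = band_sum w"
    using band_sum_shift[OF v(1)] v(2) x by simp
  then have sv: "cyclic_shift k a v = w"
    using band_sum_bij band_sum_shift[OF v(1)] w by (meson bij_betw_def inj_onD)
  define v' where "v' = inv_into band_carrier (cyclic_shift k a) w"
  have img: "w \<in> cyclic_shift k a ` band_carrier"
    using sv v(1) by blast
  have v': "v' \<in> band_carrier" "cyclic_shift k a v' = w"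
    unfolding v'_def by (rule inv_into_into[OF img], rule f_inv_into_f[OF img])
  have "u \<in> band_carrier \<and> band_sum u = c \<star> band_sum v'"
    unfolding u_def v'_def[symmetric] using v'(1) c by (rule band_sum_ract)
  moreover have "Z' (band_sum w) = c \<star> band_sum v'"
    using band_sum_shift[OF v'(1)] v'(2) Z'Z[OF band_sum_closed[OF v'(1)]] by simp
  ultimately show ?thesis
    by simp
qed

end

section \<open>Periodic weights\<close>

context wgwa_simple_weight
begin

text \<open>With k the least period, the index counts against \<open>pred\<close> and is read modulo
  k; this spreads the cycle of l over all integers, with coincidences exactly modulo k.\<close>

lemma periodic_index:
  assumes l: "l \<in> Max_R" and n: "n > 0" "(pred ^^ n) l = l"
  obtains k and m :: "int \<Rightarrow> 'r set" where "0 < k" "\<And>i. m i \<in> Max_R" "\<And>i. m i = pred (m (i + 1))"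
    "\<And>i j. m i = m j \<longleftrightarrow> i mod int k = j mod int k" "\<And>j. m (- int j) = (pred ^^ j) l"
proof -
  define k where "k = (LEAST k. 0 < k \<and> (pred ^^ k) l = l)"
  have k: "0 < k" "(pred ^^ k) l = l"
    using n LeastI[of "\<lambda>k. 0 < k \<and> (pred ^^ k) l = l" n] by (simp_all add: k_def)
  have least: "\<not> (0 < j \<and> (pred ^^ j) l = l)" if "j < k" for j
    using that unfolding k_def by (rule not_less_Least)
  define m where "m i = (pred ^^ nat ((- i) mod int k)) l" for i :: int
  have down: "m (- int j) = (pred ^^ j) l" for j
    using funpow_mod_eq[OF k(2), of j] by (simp add: m_def flip: zmod_int)
  have repr: "m i = m (- int (nat ((- i) mod int k)))" for i
    unfolding down by (simp add: m_def)
  have step: "m i = pred (m (i + 1))" for i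
  proof -
    define a where "a = nat ((- (i + 1)) mod int k)"
    have "int (Suc a) mod int k = (- i) mod int k"
      using k(1) mod_add_right_eq[of 1 "- (i + 1)" "int k"] by (simp add: a_def)
    then have "(- (- int (Suc a))) mod int k = (- i) mod int k"
      by (simp only: group_add_class.minus_minus)
    then have "m (- int (Suc a)) = m i"
      by (simp only: m_def)
    moreover have "m (- int (Suc a)) = pred (m (i + 1))"
      unfolding down by (simp add: m_def a_def)
    ultimately show ?thesis by simp
  qed
  \<comment> \<open>If the positions a < b of the cycle agreed, the orbit would return to l after k
    - b + a steps, fewer than k.\<close>
  have distinct: "(pred ^^ a) l \<noteq> (pred ^^ b) l" if "a < b" "b < k" for a b
  proof
    assume eq: "(pred ^^ a) l = (pred ^^ b) l"
    have "(pred ^^ (k - b + a)) l = (pred ^^ (k - b)) ((pred ^^ b) l)"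
      unfolding funpow_add by (simp add: eq)
    also have "\<dots> = (pred ^^ (k - b + b)) l"
      unfolding funpow_add by simp
    also have "\<dots> = l"
      using that k(2) by simp
    moreover have "0 < k - b + a" "k - b + a < k"
      using that by linarith+
    ultimately show False
      using least by blast
  qed
  have "m i = m j \<longleftrightarrow> i mod int k = j mod int k" for i j
  proof -
    let ?a = "nat ((- i) mod int k)" and ?b = "nat ((- j) mod int k)"
    have "?a < k" "?b < k"
      using k(1) by (simp_all add: nat_less_iff)
    then have "m i = m j \<longleftrightarrow> ?a = ?b"
      unfolding m_def using distinct by (metis linorder_neqE_nat)
    also have "\<dots> \<longleftrightarrow> (- i) mod int k = (- j) mod int k"
      using k(1) by (simp add: eq_nat_nat_iff)
    also have "\<dots> \<longleftrightarrow> i mod int k = j mod int k"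
      by (metis group_add_class.minus_minus mod_minus_cong)
    finally show ?thesis .
  qed
  then show ?thesis
    using that[OF k(1) _ step _ down] pred_pow_max[OF l] by (simp add: m_def)
qed

lemma inj_on_weight:
  assumes p: "p \<in> Max_R" and u: "u \<in> wgwa_terms R"
    and ker: "\<And>v. v \<in> W p \<Longrightarrow> tact u v = 0\<^sub>M \<Longrightarrow> v = 0\<^sub>M"
  shows "inj_on (tact u) (W p)"
proof (rule inj_onI)
  fix v w assume vw: "v \<in> W p" "w \<in> W p" "tact u v = tact u w"
  note c = W_carrier[OF vw(1)] W_carrier[OF vw(2)]
  have neg: "\<ominus>\<^bsub>M\<^esub> w \<in> W p"
    using W_ract[OF p vw(2), of "\<ominus> \<one>"] ract_minus[of \<one> w] c by simp
  have "tact u (v +\<^sub>M \<ominus>\<^bsub>M\<^esub> w) = tact u (w +\<^sub>M \<ominus>\<^bsub>M\<^esub> w)"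
    using vw(3) c u by (simp add: tact_plus del: M.r_neg)
  then have "v +\<^sub>M \<ominus>\<^bsub>M\<^esub> w = 0\<^sub>M"
    using ker[OF W_add[OF p vw(1) neg]] c u by (simp add: M.r_neg)
  then show "v = w"
    using c by (metis M.minus_equality M.minus_minus M.add.inv_closed)
qed

text \<open>Here Z is the action of \<zeta>, and Z' that of \<zeta>'. If d is not in q, then Z Z' =
  d is invertible on W q. Otherwise c lies in p and Z' Z vanishes on W p, so the vectors Z^(j+1) w
  with w in W p are closed under both generators and span M; those of weight q are images of W p
  under Z.\<close>

lemma weight_surj:
  assumes zeta: "{\<zeta>, \<zeta>'} = {GenX, GenY}" and p: "p \<in> Max_R" and q: "q \<in> Max_R"
    and Z: "\<And>v. v \<in> W p \<Longrightarrow> tact \<zeta> v \<in> W q" and Z': "\<And>v. v \<in> W q \<Longrightarrow> tact \<zeta>' v \<in> W p"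
    and Z'Z: "\<And>v. v \<in> carrier M \<Longrightarrow> tact \<zeta>' (tact \<zeta> v) = c \<star> v" "c \<in> carrier R"
    and ZZ': "\<And>v. v \<in> carrier M \<Longrightarrow> tact \<zeta> (tact \<zeta>' v) = d \<star> v" "d \<in> carrier R"
    and cd: "d \<in> q \<Longrightarrow> c \<in> p"
    and weights: "\<And>w j. w \<in> W p \<Longrightarrow>
      \<exists>q' \<in> Max_R. (tact \<zeta> ^^ Suc j) w \<in> W q' \<and> (q' = q \<longrightarrow> (tact \<zeta> ^^ j) w \<in> W p)"
    and r_Z: "\<And>r w j. \<lbrakk>r \<in> carrier R; w \<in> W p\<rbrakk> \<Longrightarrow>
      \<exists>s \<in> carrier R. r \<star> (tact \<zeta> ^^ Suc j) w = (tact \<zeta> ^^ Suc j) (s \<star> w)"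
    and w0: "w\<^sub>0 \<in> W p" "tact \<zeta> w\<^sub>0 \<noteq> 0\<^sub>M"
  shows "tact \<zeta> ` W p = W q"
proof -
  have zeta_terms: "\<zeta> \<in> wgwa_terms R"
    using zeta by (auto simp: doubleton_eq_iff)
  have "w \<in> tact \<zeta> ` W p" if w: "w \<in> W q" for w
  proof (cases "d \<in> q")
    case False
    then obtain s where s: "s \<in> carrier R" "d \<star> s \<star> w = w"
      using ract_invertible[OF q w ZZ'(2)] by blast
    then have "tact \<zeta> (tact \<zeta>' (s \<star> w)) = w"
      using ZZ'(1)[of "s \<star> w"] W_carrier[OF w] by simp
    then show ?thesis
      using Z'[OF W_ract[OF q w s(1)]] by (metis imageI)
  next
    case True
    let ?G = "{(tact \<zeta> ^^ Suc j) w | j w. w \<in> W p}"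
    have G_W: "\<exists>q' \<in> Max_R. g \<in> W q'" if g: "g \<in> ?G" for g
      using g weights by blast
    then have G: "?G \<subseteq> carrier M"
      using W_carrier by blast
    have rG: "r \<star> g \<in> ?G" if r: "r \<in> carrier R" and g: "g \<in> ?G" for r g
    proof -
      obtain j w where w: "w \<in> W p" "g = (tact \<zeta> ^^ Suc j) w"
        using g by blast
      then obtain s where "s \<in> carrier R" "r \<star> g = (tact \<zeta> ^^ Suc j) (s \<star> w)"
        using r_Z[OF r w(1), of j] by blast
      then show ?thesis
        using W_ract[OF p w(1)] by blast
    qed
    have ZG: "tact \<zeta> g \<in> spn ?G \<and> tact \<zeta>' g \<in> spn ?G" if g: "g \<in> ?G" for g
    proof -
      obtain j w where w: "w \<in> W p" "g = (tact \<zeta> ^^ Suc j) w"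
        using g by blast
      then have "tact \<zeta> g = (tact \<zeta> ^^ Suc (Suc j)) w"
        by simp
      then have "tact \<zeta> g \<in> ?G"
        using w(1) by blast
      moreover have "tact \<zeta>' g \<in> spn ?G"
      proof (cases j)
        case 0
        then have "tact \<zeta>' g = 0\<^sub>M"
          using Z'Z(1)[OF W_carrier[OF w(1)]] w cd[OF True] mem_W by simp
        then show ?thesis
          by (simp add: spn.zero)
      next
        case (Suc j')
        then have jG: "(tact \<zeta> ^^ j) w \<in> ?G"
          using w(1) by blast
        then have "(tact \<zeta> ^^ j) w \<in> carrier M"
          using G by blast
        then have "tact \<zeta>' g = c \<star> (tact \<zeta> ^^ j) w"
          using Z'Z(1) w(2) by simp
        then show ?thesis
          using spn_base[OF G rG[OF Z'Z(2) jG]] by simp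
      qed
      ultimately show ?thesis
        using spn_base[OF G] by blast
    qed
    have "(tact \<zeta> ^^ Suc 0) w\<^sub>0 \<in> ?G"
      using w0(1) by blast
    then have span: "spn ?G = carrier M"
    proof (rule spn_submodule[OF G _ _ rG])
      show "X g \<in> spn ?G" "Y g \<in> spn ?G" if "g \<in> ?G" for g
        using ZG[OF that] zeta by (auto simp: doubleton_eq_iff)
    qed (use w0 in simp)
    show ?thesis
    proof (rule spn_weight[OF G span G_W q _ _ _ w])
      show "0\<^sub>M \<in> tact \<zeta> ` W p"
        using W_zero[OF p] zeta_terms by (metis imageI tact_zero)
      show "x +\<^sub>M y \<in> tact \<zeta> ` W p" if xy: "x \<in> tact \<zeta> ` W p" "y \<in> tact \<zeta> ` W p" for x y
      proof -
        obtain x' y' where "x' \<in> W p" "y' \<in> W p" "x = tact \<zeta> x'" "y = tact \<zeta> y'"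
          using xy by blast
        then show ?thesis
          using W_add[OF p, of x' y'] W_carrier tact_plus[OF zeta_terms, of x' y']
          by (intro image_eqI[where x = "x' +\<^sub>M y'"]) auto
      qed
      fix g assume g: "g \<in> ?G" "g \<in> W q" "g \<noteq> 0\<^sub>M"
      then obtain j w where w: "w \<in> W p" "g = (tact \<zeta> ^^ Suc j) w"
        by blast
      then have "(tact \<zeta> ^^ j) w \<in> W p"
        using weights[OF w(1), of j] W_unique[OF _ q _ g(2,3)] by blast
      then show "g \<in> tact \<zeta> ` W p"
        using w(2) by simp
    qed
  qed
  then show ?thesis
    using Z by blast
qed

end

section \<open>Modules supported on a single cycle\<close>

locale cyclic_weight = wgwa_simple_weight R \<sigma> t M
  for R :: "('r, 'a) ring_scheme" (structure) and \<sigma> t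
    and M :: "('r wgwa_term set, 'm, 'b) module_scheme" +
  fixes k :: nat and m :: "int \<Rightarrow> 'r set"
  assumes k: "0 < k" and m_max: "\<And>i. m i \<in> Max_R" and m_pred: "\<And>i. m i = pred (m (i + 1))"
    and m_eq: "\<And>i j. m i = m j \<longleftrightarrow> i mod int k = j mod int k"
    and supp: "\<And>q v. \<lbrakk>q \<in> Max_R; v \<in> W q; v \<noteq> 0\<^sub>M\<rbrakk> \<Longrightarrow> \<exists>i. q = m i"
begin

lemma periodic: "periodic_family R \<sigma> t m k"
proof -
  have "\<sigma> ` m i \<subseteq> m (i + 1)" for i
    using m_pred[of i] pred_subset_iff[OF m_max m_max, of i "i + 1"] by blast
  moreover have "k \<le> l" if l: "0 < l" "\<forall>i. m (i + int l) = m i" for l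
  proof -
    have "int l mod int k = 0"
      using l(2)[rule_format, of 0] m_eq[of "int l" 0] by simp
    then have "k dvd l"
      by (simp add: mod_eq_0_iff_dvd)
    then show ?thesis
      using l(1) by (rule dvd_imp_le)
  qed
  ultimately show ?thesis
    using k m_max m_eq by (simp add: periodic_family_def string_family_def)
qed

text \<open>On one cycle \<open>pred\<close> is injective, so only one weight of the support lies
  above m i and X cannot branch.\<close>

lemma X_cyclic:
  assumes v: "v \<in> W (m i)"
  shows "X v \<in> W (m (i + 1))"
proof -
  note vM = W_carrier[OF v]
  have "X v \<in> spn (W (m (i + 1)))"
  proof (rule mem_spn_weights)
    show sub: "W (m (i + 1)) \<subseteq> carrier M"
      using W_carrier by blast
    fix q assume q: "q \<in> Max_R" "pr q (X v) \<noteq> 0\<^sub>M"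
    then obtain j where j: "q = m j"
      using supp pr_W vM by (metis tact_closed terms_simps(2))
    have "m i = pred (m j)"
      using X_weight[OF m_max q(1) v q(2)] j by simp
    also have "\<dots> = m (j - 1)"
      using m_pred[of "j - 1"] by simp
    finally have "i mod int k = (j - 1) mod int k"
      by (simp add: m_eq)
    then have "(i + 1) mod int k = (j - 1 + 1) mod int k"
      by (rule mod_add_cong) simp
    then have "q = m (i + 1)"
      by (simp add: j m_eq)
    then show "pr q (X v) \<in> spn (W (m (i + 1)))"
      using spn_base[OF sub] pr_W q vM by simp
  qed (use vM in simp)
  then show ?thesis
    by (rule spn_least) (use W_add[OF m_max] W_zero[OF m_max] in auto)
qed

lemma Y_cyclic: "v \<in> W (m i) \<Longrightarrow> Y v \<in> W (m (i - 1))"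
  using Y_W[OF m_max, of v i] m_pred[of "i - 1"] by simp

lemma X_pow_cyclic: "v \<in> W (m i) \<Longrightarrow> (X ^^ n) v \<in> W (m (i + int n))"
proof (induction n)
  case (Suc n)
  then show ?case
    using X_cyclic[of "(X ^^ n) v" "i + int n"] by (simp add: add_ac)
qed simp

lemma Y_pow_cyclic: "v \<in> W (m i) \<Longrightarrow> (Y ^^ n) v \<in> W (m (i - int n))"
proof (induction n)
  case (Suc n)
  then show ?case
    using Y_cyclic[of "(Y ^^ n) v" "i - int n"] by (simp add: algebra_simps)
qed simp

lemma r_X_pow:
  assumes r: "r \<in> carrier R"
  shows "\<exists>s \<in> carrier R. r \<ominus> (\<sigma> ^^ n) s \<in> m (i + int n) \<and>
    (\<forall>h \<in> W (m i). r \<star> (X ^^ n) h = (X ^^ n) (s \<star> h))"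
proof -
  obtain s where s: "s \<in> carrier R" "r \<ominus> (\<sigma> ^^ n) s \<in> m (i + int n)"
    using ess_lift_pow[OF m_max r] by blast
  have "r \<star> (X ^^ n) h = (X ^^ n) (s \<star> h)" if "h \<in> W (m i)" for h
    using ract_cong[OF m_max X_pow_cyclic[OF that] r _ s(2)] s(1) W_carrier[OF that]
    by (simp add: X_pow_r)
  then show ?thesis
    using s by blast
qed

lemma mod_shift: "m (i + int j) = m i \<Longrightarrow> int j mod int k = 0"
proof -
  assume "m (i + int j) = m i"
  then have "(i + int j) mod int k = i mod int k"
    by (simp add: m_eq)
  then have "(i + int j - i) mod int k = (i - i) mod int k"
    by (rule mod_diff_cong) simp
  then show ?thesis
    by simp
qed

lemma m_cong: "int j mod int k = 0 \<Longrightarrow> m (i + int j) = m i \<and> m (i - int j) = m i"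
  unfolding m_eq by (metis add.right_neutral diff_zero mod_add_right_eq mod_diff_right_eq)

lemma X_bij:
  assumes inj: "\<And>p v. \<lbrakk>p \<in> Max_R; v \<in> W p; X v = 0\<^sub>M\<rbrakk> \<Longrightarrow> v = 0\<^sub>M"
    and u: "u \<in> W (m 0)" "u \<noteq> 0\<^sub>M"
  shows "bij_betw X (W (m i)) (W (m (i + 1)))"
proof (rule bij_betw_imageI)
  show "inj_on X (W (m i))"
    using inj m_max by (intro inj_on_weight) auto
  \<comment> \<open>X^n moves u from m 0 to m i; by injectivity X^(n+1) u is nonzero, so X^n u can
    serve as the vector \<open>w\<^sub>0\<close> of \<open>weight_surj\<close>.\<close>
  define n where "n = nat (i mod int k)"
  have "m (int n) = m i"
    using k by (simp add: m_eq n_def)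
  then have Xnu: "(X ^^ n) u \<in> W (m i)"
    using X_pow_cyclic[OF u(1), of n] by simp
  have X_nz: "(X ^^ n) u \<noteq> 0\<^sub>M" for n
    using inj[OF m_max X_pow_cyclic[OF u(1)]] u(2) by (induction n) auto
  show "X ` W (m i) = W (m (i + 1))"
  proof (rule weight_surj[where \<zeta> = GenX and \<zeta>' = GenY and c = t and d = "\<sigma> t"])
    show "X v \<in> W (m (i + 1))" if "v \<in> W (m i)" for v
      using that by (rule X_cyclic)
    show "Y v \<in> W (m i)" if "v \<in> W (m (i + 1))" for v
      using Y_cyclic[OF that] by simp
    show "t \<in> m i" if "\<sigma> t \<in> m (i + 1)"
      using that m_pred[of i] by (simp add: mem_pred)
    show "\<exists>q \<in> Max_R. (X ^^ Suc j) w \<in> W q \<and> (q = m (i + 1) \<longrightarrow> (X ^^ j) w \<in> W (m i))"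
      if w: "w \<in> W (m i)" for w j
    proof (intro bexI[of _ "m (i + 1 + int j)"] conjI impI m_max)
      show "(X ^^ Suc j) w \<in> W (m (i + 1 + int j))"
        using X_pow_cyclic[OF w, of "Suc j"] by (simp add: add_ac)
      assume "m (i + 1 + int j) = m (i + 1)"
      then have "m (i + int j) = m i"
        using mod_shift m_cong by blast
      then show "(X ^^ j) w \<in> W (m i)"
        using X_pow_cyclic[OF w, of j] by simp
    qed
    show "\<exists>s \<in> carrier R. r \<star> (X ^^ Suc j) w = (X ^^ Suc j) (s \<star> w)"
      if "r \<in> carrier R" "w \<in> W (m i)" for r w j
      using r_X_pow[OF that(1), of "Suc j" i] that(2) by blast
    show "(X ^^ n) u \<in> W (m i)" by (rule Xnu)
    show "X ((X ^^ n) u) \<noteq> 0\<^sub>M"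
      using X_nz[of "Suc n"] by simp
  qed (simp_all add: m_max YX XY)
qed

text \<open>Weight vectors killed by some power of Y span a submodule: Y^(j+1) X g = Y^j (t g) shows
  stability under X. If it were nonzero it would be M and contain u.\<close>

lemma Y_kernel:
  assumes u: "u \<in> W (m 0)" "\<And>n. (Y ^^ n) u \<noteq> 0\<^sub>M" and v: "v \<in> W (m i)" "Y v = 0\<^sub>M"
  shows "v = 0\<^sub>M"
proof (rule ccontr)
  assume nz: "v \<noteq> 0\<^sub>M"
  let ?G = "{g. (\<exists>i. g \<in> W (m i)) \<and> (\<exists>j. (Y ^^ j) g = 0\<^sub>M)}"
  have G: "?G \<subseteq> carrier M"
    using W_carrier by blast
  have "v \<in> ?G"
    using v by (auto intro: exI[of _ 1])
  have r_kernel: "(Y ^^ j) (r \<star> g) = 0\<^sub>M" if "r \<in> carrier R" "g \<in> W (m i)" "(Y ^^ j) g = 0\<^sub>M" for r g i j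
    using Y_pow_r[OF m_max that(2,1), of j] that(3) by auto
  have span: "spn ?G = carrier M"
  proof (rule spn_submodule[OF G \<open>v \<in> ?G\<close> nz])
    show "r \<star> g \<in> ?G" if "r \<in> carrier R" "g \<in> ?G" for r g
      using that r_kernel W_ract[OF m_max] by blast
    fix g assume "g \<in> ?G"
    then obtain i j where g: "g \<in> W (m i)" "(Y ^^ j) g = 0\<^sub>M"
      by blast
    have "(Y ^^ j) (Y g) = Y ((Y ^^ j) g)"
      by (simp add: funpow_swap1)
    then have "Y g \<in> ?G"
      using Y_cyclic[OF g(1)] g(2) by auto
    then show "Y g \<in> spn ?G"
      by (rule spn_base[OF G])
    have "(Y ^^ Suc j) (X g) = (Y ^^ j) (t \<star> g)"
      using YX[OF W_carrier[OF g(1)]] by (simp add: funpow_swap1)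
    then have "(Y ^^ Suc j) (X g) = 0\<^sub>M"
      using r_kernel[OF t_closed g] by simp
    then have "X g \<in> ?G"
      using X_cyclic[OF g(1)] by blast
    then show "X g \<in> spn ?G"
      by (rule spn_base[OF G])
  qed
  have "u \<in> {g \<in> carrier M. \<exists>j. (Y ^^ j) g = 0\<^sub>M}"
  proof (rule spn_weight[OF G span _ m_max _ _ _ u(1)])
    show "\<exists>p \<in> Max_R. g \<in> W p" if "g \<in> ?G" for g
      using that m_max by blast
    show "0\<^sub>M \<in> {g \<in> carrier M. \<exists>j. (Y ^^ j) g = 0\<^sub>M}"
      by simp
    show "x +\<^sub>M y \<in> {g \<in> carrier M. \<exists>j. (Y ^^ j) g = 0\<^sub>M}"
      if xy: "x \<in> {g \<in> carrier M. \<exists>j. (Y ^^ j) g = 0\<^sub>M}" "y \<in> {g \<in> carrier M. \<exists>j. (Y ^^ j) g = 0\<^sub>M}" for x y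
    proof -
      obtain a b where ab: "(Y ^^ a) x = 0\<^sub>M" "(Y ^^ b) y = 0\<^sub>M"
        using xy by blast
      have "(Y ^^ (b + a)) x = 0\<^sub>M" "(Y ^^ (a + b)) y = 0\<^sub>M"
        using ab by (simp_all flip: Y_pow_Y_pow)
      then have "(Y ^^ (a + b)) (x +\<^sub>M y) = 0\<^sub>M"
        using xy by (simp add: Y_pow_plus add.commute)
      then show ?thesis
        using xy by blast
    qed
  qed (use G in blast)
  then show False
    using u(2) by blast
qed

lemma Y_bij:
  assumes u: "u \<in> W (m 0)" "\<And>n. (Y ^^ n) u \<noteq> 0\<^sub>M"
  shows "bij_betw Y (W (m (i + 1))) (W (m i))"
proof (rule bij_betw_imageI)
  show "inj_on Y (W (m (i + 1)))"
    using Y_kernel[OF u] m_max by (intro inj_on_weight) auto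
  \<comment> \<open>Y counts the cycle downwards, so n is chosen with -n congruent to i + 1 modulo
    k.\<close>
  define n where "n = nat ((- (i + 1)) mod int k)"
  have "int n = (- (i + 1)) mod int k"
    using k by (simp add: n_def)
  then have "(0 - int n) mod int k = (0 - (- (i + 1))) mod int k"
    by (simp only: mod_diff_right_eq)
  moreover have "0 - (- (i + 1)) = i + 1"
    by simp
  ultimately have "m (0 - int n) = m (i + 1)"
    unfolding m_eq by metis
  then have Ynu: "(Y ^^ n) u \<in> W (m (i + 1))"
    using Y_pow_cyclic[OF u(1), of n] by simp
  show "Y ` W (m (i + 1)) = W (m i)"
  proof (rule weight_surj[where \<zeta> = GenY and \<zeta>' = GenX and c = "\<sigma> t" and d = t])
    show "Y v \<in> W (m i)" if "v \<in> W (m (i + 1))" for v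
      using Y_cyclic[OF that] by simp
    show "X v \<in> W (m (i + 1))" if "v \<in> W (m i)" for v
      using that by (rule X_cyclic)
    show "\<sigma> t \<in> m (i + 1)" if "t \<in> m i"
      using that m_pred[of i] by (simp add: mem_pred)
    show "\<exists>q \<in> Max_R. (Y ^^ Suc j) w \<in> W q \<and> (q = m i \<longrightarrow> (Y ^^ j) w \<in> W (m (i + 1)))"
      if w: "w \<in> W (m (i + 1))" for w j
    proof (intro bexI[of _ "m (i - int j)"] conjI impI m_max)
      show "(Y ^^ Suc j) w \<in> W (m (i - int j))"
        using Y_pow_cyclic[OF w, of "Suc j"] by simp
      assume "m (i - int j) = m i"
      then have "m (i + 1 - int j) = m (i + 1)"
        using mod_shift[of "i - int j" j] m_cong by simp
      then show "(Y ^^ j) w \<in> W (m (i + 1))"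
        using Y_pow_cyclic[OF w, of j] by simp
    qed
    show "\<exists>s \<in> carrier R. r \<star> (Y ^^ Suc j) w = (Y ^^ Suc j) (s \<star> w)"
      if "r \<in> carrier R" "w \<in> W (m (i + 1))" for r w j
      using r_Y_pow[OF that(1) W_carrier[OF that(2)], of "Suc j"] that(1)
      by (intro bexI[of _ "(\<sigma> ^^ Suc j) r"]) auto
    show "(Y ^^ n) u \<in> W (m (i + 1))" by (rule Ynu)
    show "Y ((Y ^^ n) u) \<noteq> 0\<^sub>M"
      using u(2)[of "Suc n"] by simp
  qed (simp_all add: m_max YX XY insert_commute)
qed

lemma m_period: "m (int k) = m 0"
  by (simp add: m_eq)

text \<open>X^k is a \<sigma>^k-semilinear bijection of W (m 0) and plays the part of \<alpha>.
  Essentiality, through \<open>r_X_pow\<close>, supplies the scalar that represents r on component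
  i, in agreement with the inverse of \<tau>_i.\<close>

lemma band_N:
  assumes inj: "\<And>p v. \<lbrakk>p \<in> Max_R; v \<in> W p; X v = 0\<^sub>M\<rbrakk> \<Longrightarrow> v = 0\<^sub>M"
    and u: "u \<in> W (m 0)" "u \<noteq> 0\<^sub>M"
  shows "\<exists>f. irreducible_element (band_ring R \<sigma> m k) f \<and>
    left_module_isomorphic A M (band_module_N R \<sigma> t m k f)"
proof -
  define mu where "mu i = m (int i)" for i
  have frame: "\<And>i. mu i \<in> Max_R" "\<And>i j. mu i = mu j \<longleftrightarrow> i mod k = j mod k"
    "\<And>q v. \<lbrakk>q \<in> Max_R; v \<in> W q; v \<noteq> 0\<^sub>M\<rbrakk> \<Longrightarrow> \<exists>i. q = mu i"
    "{GenX, GenY :: 'r wgwa_term} = {GenX, GenY}"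
    "\<And>i. bij_betw X (W (mu i)) (W (mu (Suc i)))"
    "\<And>v. v \<in> carrier M \<Longrightarrow> Y (X v) = t \<star> v" "t \<in> carrier R"
    "\<And>r i. r \<in> carrier R \<Longrightarrow> \<exists>s \<in> carrier R. \<forall>h \<in> W (mu 0). r \<star> (X ^^ i) h = (X ^^ i) (s \<star> h)"
  proof -
    show "mu i = mu j \<longleftrightarrow> i mod k = j mod k" for i j
      by (simp add: mu_def m_eq flip: zmod_int)
    show "\<exists>i. q = mu i" if q: "q \<in> Max_R" "v \<in> W q" "v \<noteq> 0\<^sub>M" for q v
    proof -
      obtain i where "q = m i"
        using supp q by blast
      then have "q = mu (nat (i mod int k))"
        using k by (simp add: mu_def m_eq)
      then show ?thesis by blast
    qed
    show "bij_betw X (W (mu i)) (W (mu (Suc i)))" for i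
      using X_bij[OF inj u, where i = "int i"] by (simp add: mu_def add.commute)
    show "\<exists>s \<in> carrier R. \<forall>h \<in> W (mu 0). r \<star> (X ^^ i) h = (X ^^ i) (s \<star> h)" if "r \<in> carrier R" for r i
      using r_X_pow[OF that, of i 0] by (auto simp: mu_def)
  qed (auto simp: mu_def m_max YX)
  note band = k frame
  have mu0: "mu 0 = m 0"
    by (simp add: mu_def)
  interpret F: band_frame R \<sigma> t M k mu GenX GenY t
    by unfold_locales (fact band)+
  have Xk: "bij_betw (X ^^ k) (W (m 0)) (W (m 0))"
    using F.Z_pow_k by (simp add: mu0)
  obtain f \<theta> where map: "band_L_map R \<sigma> t M m k (X ^^ k) f \<theta>"
  proof (rule band_L_iso[of m k "X ^^ k", OF m_max m_pred m_period Xk])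
    show "(X ^^ k) (v +\<^sub>M w) = (X ^^ k) v +\<^sub>M (X ^^ k) w" if "v \<in> W (m 0)" "w \<in> W (m 0)" for v w
      using that W_carrier by (intro X_pow_plus) blast+
    show "(X ^^ k) (r \<star> v) = (\<sigma> ^^ k) r \<star> (X ^^ k) v" if "r \<in> carrier R" "v \<in> W (m 0)" for r v
      using that W_carrier by (intro X_pow_r) blast+
    show "W (m 0) \<noteq> {0\<^sub>M}"
      using u by blast
    show "H = W (m 0)"
      if H: "H \<subseteq> W (m 0)" "0\<^sub>M \<in> H" "\<And>v w. v \<in> H \<Longrightarrow> w \<in> H \<Longrightarrow> v +\<^sub>M w \<in> H"
        "\<And>r v. r \<in> carrier R \<Longrightarrow> v \<in> H \<Longrightarrow> r \<star> v \<in> H" "\<And>v. v \<in> H \<Longrightarrow> (X ^^ k) v \<in> H"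
        "\<And>v. v \<in> H \<Longrightarrow> inv_into (W (m 0)) (X ^^ k) v \<in> H" "H \<noteq> {0\<^sub>M}" for H
    proof -
      have ex: "\<exists>h' \<in> H. h = (X ^^ k) h'" if "h \<in> H" for h
        using H(6)[OF that] Xk H(1) that
        by (intro bexI[of _ "inv_into (W (m 0)) (X ^^ k) h"]) (auto simp: bij_betw_inv_into_right subset_iff)
      show ?thesis
        by (rule F.weight_zero_simple[of H, unfolded mu0, OF H(1-5) ex H(7)])
    qed
  qed
  define K where "K = R Quot m 0"
  define L where "L = band_L R \<sigma> m k f"
  interpret D: band_L_map R \<sigma> t M m k "X ^^ k" f \<theta> K L
    unfolding K_def L_def by (rule map)
  define \<rho>L where "\<rho>L i r C =
    skew_monom K (inv_into (carrier K) (band_tau R \<sigma> m i) (m (int i) +> r)) 0 \<odot>\<^bsub>L\<^esub> C" for i r C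
  have \<rho>L: "\<rho>L i r C \<in> carrier L \<and> (X ^^ i) (\<theta> (\<rho>L i r C)) = r \<star> (X ^^ i) (\<theta> C)"
    if r: "r \<in> carrier R" and C: "C \<in> carrier L" for i r C
  proof -
    obtain s where s: "s \<in> carrier R" "r \<ominus> (\<sigma> ^^ i) s \<in> m (int i)"
      "\<forall>h \<in> W (m 0). r \<star> (X ^^ i) h = (X ^^ i) (s \<star> h)"
      using r_X_pow[OF r, of i 0] by auto
    have "\<rho>L i r C = skew_monom K (m 0 +> s) 0 \<odot>\<^bsub>L\<^esub> C"
      using inv_band_tau[of m, OF m_max m_pred r s(1,2)] by (simp add: \<rho>L_def K_def)
    then show ?thesis
      using D.\<theta>_coeff[OF s(1) C] D.\<theta>_W[OF C] s(3) by simp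
  qed
  interpret B: band_frame_iso R \<sigma> t M k mu GenX GenY t "carrier L" "add L" "zero L" \<theta> \<rho>L
    "\<lambda>C. skew_monom K \<one>\<^bsub>K\<^esub> 1 \<odot>\<^bsub>L\<^esub> C"
    by unfold_locales (fact D.\<theta>_bij[folded mu0] D.\<theta>_zero D.\<theta>_add \<rho>L D.\<theta>_alpha)+
  have "left_module_isomorphic A M (band_module_N R \<sigma> t m k f)"
    unfolding band_module_N_def Let_def K_def[symmetric] L_def[symmetric] \<rho>L_def[symmetric]
    by (rule wgwa_module_iso[OF B.band_sum_bij])
      (rule B.band_sum_plus B.band_sum_ract B.band_sum_shift B.band_sum_back; assumption)+
  then show ?thesis
    using D.irreducible by blast
qed

text \<open>Y closes its cycle by the inverse of \<alpha>, so \<alpha> has to be the inverse of Y^k.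
  Its semilinearity has the right direction, because r Y^k w = Y^k (\<sigma>^k r w).\<close>

lemma band_M:
  assumes u: "u \<in> W (m 0)" "\<And>n. (Y ^^ n) u \<noteq> 0\<^sub>M"
  shows "\<exists>f. irreducible_element (band_ring R \<sigma> m k) f \<and>
    left_module_isomorphic A M (band_module_M R \<sigma> t m k f)"
proof -
  define mu where "mu i = m (- int i)" for i
  have frame: "\<And>i. mu i \<in> Max_R" "\<And>i j. mu i = mu j \<longleftrightarrow> i mod k = j mod k"
    "\<And>q v. \<lbrakk>q \<in> Max_R; v \<in> W q; v \<noteq> 0\<^sub>M\<rbrakk> \<Longrightarrow> \<exists>i. q = mu i"
    "{GenY, GenX :: 'r wgwa_term} = {GenX, GenY}"
    "\<And>i. bij_betw Y (W (mu i)) (W (mu (Suc i)))"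
    "\<And>v. v \<in> carrier M \<Longrightarrow> X (Y v) = \<sigma> t \<star> v" "\<sigma> t \<in> carrier R"
    "\<And>r i. r \<in> carrier R \<Longrightarrow> \<exists>s \<in> carrier R. \<forall>h \<in> W (mu 0). r \<star> (Y ^^ i) h = (Y ^^ i) (s \<star> h)"
  proof -
    have neg: "(- i) mod int k = (- j) mod int k \<longleftrightarrow> i mod int k = j mod int k" for i j
      by (metis group_add_class.minus_minus mod_minus_cong)
    show "mu i = mu j \<longleftrightarrow> i mod k = j mod k" for i j
      unfolding mu_def m_eq neg by (simp flip: zmod_int)
    show "\<exists>i. q = mu i" if q: "q \<in> Max_R" "v \<in> W q" "v \<noteq> 0\<^sub>M" for q v
    proof -
      obtain i where "q = m i"
        using supp q by blast
      moreover have "(- int (nat ((- i) mod int k))) mod int k = (- (- i)) mod int k"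
        using k neg[of "int (nat ((- i) mod int k))" "- i"] by simp
      ultimately have "q = mu (nat ((- i) mod int k))"
        by (simp add: mu_def m_eq)
      then show ?thesis by blast
    qed
    show "bij_betw Y (W (mu i)) (W (mu (Suc i)))" for i
      using Y_bij[OF u, of "- int (Suc i)"] by (simp add: mu_def)
    show "\<exists>s \<in> carrier R. \<forall>h \<in> W (mu 0). r \<star> (Y ^^ i) h = (Y ^^ i) (s \<star> h)" if "r \<in> carrier R" for r i
      using r_Y_pow[OF that W_carrier] that by (intro bexI[of _ "(\<sigma> ^^ i) r"]) auto
  qed (auto simp: mu_def m_max XY)
  note band = k frame
  have mu0: "mu 0 = m 0"
    by (simp add: mu_def)
  interpret F: band_frame R \<sigma> t M k mu GenY GenX "\<sigma> t"
    by unfold_locales (fact band)+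
  have Yk: "bij_betw (Y ^^ k) (W (m 0)) (W (m 0))"
    using F.Z_pow_k by (simp add: mu0)
  define \<Phi> where "\<Phi> = inv_into (W (m 0)) (Y ^^ k)"
  have \<Phi>: "bij_betw \<Phi> (W (m 0)) (W (m 0))"
    unfolding \<Phi>_def using Yk by (rule bij_betw_inv_into)
  have \<Phi>W: "\<Phi> v \<in> W (m 0)" "(Y ^^ k) (\<Phi> v) = v" if "v \<in> W (m 0)" for v
    using that \<Phi> Yk by (auto simp: \<Phi>_def bij_betw_inv_into_right bij_betw_apply)
  have \<Phi>_eq: "\<Phi> v = w" if "w \<in> W (m 0)" "(Y ^^ k) w = v" for v w
    using that Yk by (auto simp: \<Phi>_def bij_betw_def)
  have inv_\<Phi>: "inv_into (W (m 0)) \<Phi> v = (Y ^^ k) v" if "v \<in> W (m 0)" for v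
    unfolding \<Phi>_def by (rule inv_into_inv_into_eq[OF Yk that])
  obtain f \<theta> where map: "band_L_map R \<sigma> t M m k \<Phi> f \<theta>"
  proof (rule band_L_iso[of m k \<Phi>, OF m_max m_pred m_period \<Phi>])
    show "\<Phi> (v +\<^sub>M w) = \<Phi> v +\<^sub>M \<Phi> w" if "v \<in> W (m 0)" "w \<in> W (m 0)" for v w
      using \<Phi>W[OF that(1)] \<Phi>W[OF that(2)] W_add[OF m_max] W_carrier
      by (intro \<Phi>_eq) (auto simp: Y_pow_plus)
    show "\<Phi> (r \<star> v) = (\<sigma> ^^ k) r \<star> \<Phi> v" if "r \<in> carrier R" "v \<in> W (m 0)" for r v
    proof (rule \<Phi>_eq)
      show "(\<sigma> ^^ k) r \<star> \<Phi> v \<in> W (m 0)"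
        using \<Phi>W[OF that(2)] W_ract[OF m_max] that(1) by simp
      show "(Y ^^ k) ((\<sigma> ^^ k) r \<star> \<Phi> v) = r \<star> v"
        using r_Y_pow[OF that(1) W_carrier[OF \<Phi>W(1)[OF that(2)]], of k] \<Phi>W(2)[OF that(2)] by simp
    qed
    show "W (m 0) \<noteq> {0\<^sub>M}"
      using u(1) u(2)[of 0] by auto
    show "H = W (m 0)"
      if H: "H \<subseteq> W (m 0)" "0\<^sub>M \<in> H" "\<And>v w. v \<in> H \<Longrightarrow> w \<in> H \<Longrightarrow> v +\<^sub>M w \<in> H"
        "\<And>r v. r \<in> carrier R \<Longrightarrow> v \<in> H \<Longrightarrow> r \<star> v \<in> H" "\<And>v. v \<in> H \<Longrightarrow> \<Phi> v \<in> H"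
        "\<And>v. v \<in> H \<Longrightarrow> inv_into (W (m 0)) \<Phi> v \<in> H" "H \<noteq> {0\<^sub>M}" for H
    proof -
      have ex: "\<exists>h' \<in> H. h = (Y ^^ k) h'" if "h \<in> H" for h
        using H(1,5) \<Phi>W(2) that by (metis subsetD)
      have Yk: "(Y ^^ k) h \<in> H" if "h \<in> H" for h
        using H(1) H(6)[OF that] inv_\<Phi> that by auto
      show ?thesis
        by (rule F.weight_zero_simple[of H, unfolded mu0, OF H(1-4) Yk ex H(7)])
    qed
  qed
  define K where "K = R Quot m 0"
  define L where "L = band_L R \<sigma> m k f"
  interpret D: band_L_map R \<sigma> t M m k \<Phi> f \<theta> K L
    unfolding K_def L_def by (rule map)
  define \<rho>L where "\<rho>L i r C = skew_monom K (m 0 +> (\<sigma> ^^ i) r) 0 \<odot>\<^bsub>L\<^esub> C" for i r C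
  have \<rho>L: "\<rho>L i r C \<in> carrier L \<and> (Y ^^ i) (\<theta> (\<rho>L i r C)) = r \<star> (Y ^^ i) (\<theta> C)"
    if r: "r \<in> carrier R" and C: "C \<in> carrier L" for i r C
    using D.\<theta>_coeff[of "(\<sigma> ^^ i) r" C] r C r_Y_pow[OF r W_carrier[OF D.\<theta>_W[OF C]], of i]
    by (simp add: \<rho>L_def)
  have alpha': "skew_monom K \<one>\<^bsub>K\<^esub> (-1) \<odot>\<^bsub>L\<^esub> C \<in> carrier L \<and>
      \<theta> (skew_monom K \<one>\<^bsub>K\<^esub> (-1) \<odot>\<^bsub>L\<^esub> C) = (Y ^^ k) (\<theta> C)" if "C \<in> carrier L" for C
    using D.\<theta>_alpha_inv[OF that] inv_\<Phi>[OF D.\<theta>_W[OF that]] by simp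
  interpret B: band_frame_iso R \<sigma> t M k mu GenY GenX "\<sigma> t" "carrier L" "add L" "zero L" \<theta> \<rho>L
    "\<lambda>C. skew_monom K \<one>\<^bsub>K\<^esub> (-1) \<odot>\<^bsub>L\<^esub> C"
    by unfold_locales (fact D.\<theta>_bij[folded mu0] D.\<theta>_zero D.\<theta>_add \<rho>L alpha')+
  have "left_module_isomorphic A M (band_module_M R \<sigma> t m k f)"
    unfolding band_module_M_def Let_def K_def[symmetric] L_def[symmetric] \<rho>L_def[symmetric]
    by (rule wgwa_module_iso[OF B.band_sum_bij])
      (rule B.band_sum_plus B.band_sum_ract B.band_sum_shift B.band_sum_back; assumption)+
  then show ?thesis
    using D.irreducible by blast
qed

end

theorem (in wgwa_simple_weight) string_or_band:
  "is_string \<or> (\<exists>m k f. periodic_family R \<sigma> t m k \<and> irreducible_element (band_ring R \<sigma> m k) f \<and>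
    (left_module_isomorphic A M (band_module_M R \<sigma> t m k f) \<or>
     left_module_isomorphic A M (band_module_N R \<sigma> t m k f)))"
proof (cases "\<exists>p u. p \<in> Max_R \<and> u \<in> W p \<and> u \<noteq> 0\<^sub>M \<and> X u = 0\<^sub>M")
  case True
  then obtain p u where u: "p \<in> Max_R" "u \<in> W p" "u \<noteq> 0\<^sub>M" "X u = 0\<^sub>M"
    by blast
  \<comment> \<open>In the band case no power of Y kills u either; through \<open>Y_kernel\<close>
    this makes Y injective on every weight space.\<close>
  consider (bounded) N where "(Y ^^ N) u = 0\<^sub>M"
    | (infinite) "\<And>n. (Y ^^ n) u \<noteq> 0\<^sub>M" "aperiodic p"
    | (band) n where "\<And>n. (Y ^^ n) u \<noteq> 0\<^sub>M" "n > 0" "(pred ^^ n) p = p"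
    by blast
  then show ?thesis
  proof cases
    case bounded
    then show ?thesis
      using bounded_string[OF u] by blast
  next
    case infinite
    then show ?thesis
      using left_infinite_string[OF u] by blast
  next
    case band
    obtain k and m :: "int \<Rightarrow> 'r set" where m: "0 < k" "\<And>i. m i \<in> Max_R" "\<And>i. m i = pred (m (i + 1))"
      "\<And>i j. m i = m j \<longleftrightarrow> i mod int k = j mod int k" "\<And>j. m (- int j) = (pred ^^ j) p"
      by (rule periodic_index[OF u(1) band(2,3)], rule that)
    have supp: "\<exists>i. q = m i" if "q \<in> Max_R" "v \<in> W q" "v \<noteq> 0\<^sub>M" for q v
      using weights_down[OF u that] m(5) by metis
    have "u \<in> W (m 0)"
      using u(2) m(5)[of 0] by simp
    interpret C: cyclic_weight R \<sigma> t M k m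
      by unfold_locales (fact m(1-4) supp)+
    show ?thesis
      using C.periodic C.band_M[OF \<open>u \<in> W (m 0)\<close> band(1)] by blast
  qed
next
  case False
  then have inj: "v = 0\<^sub>M" if "p \<in> Max_R" "v \<in> W p" "X v = 0\<^sub>M" for p v
    using that by blast
  show ?thesis
  proof (cases "\<exists>p v. p \<in> Max_R \<and> v \<in> W p \<and> v \<noteq> 0\<^sub>M \<and> aperiodic p")
    case True
    then obtain p v where p: "p \<in> Max_R" "v \<in> W p" "v \<noteq> 0\<^sub>M" "aperiodic p"
      by blast
    have is_string
      by (rule aperiodic_string[OF _ p]) (fact inj)
    then show ?thesis ..
  next
    case periodic: False
    obtain p u where u: "p \<in> Max_R" "u \<in> W p" "u \<noteq> 0\<^sub>M"
      by (rule nontrivial_weight)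
    then obtain n where n: "n > 0" "(pred ^^ n) p = p"
      using periodic by blast
    obtain k and m :: "int \<Rightarrow> 'r set" where m: "0 < k" "\<And>i. m i \<in> Max_R" "\<And>i. m i = pred (m (i + 1))"
      "\<And>i j. m i = m j \<longleftrightarrow> i mod int k = j mod int k" "\<And>j. m (- int j) = (pred ^^ j) p"
      by (rule periodic_index[OF u(1) n], rule that)
    \<comment> \<open>Seen from p, a weight q lies below or above. Below, it is on the cycle by
      construction; above, q is periodic as well and so lies on the downward orbit of p.\<close>
    have supp: "\<exists>i. q = m i" if q: "q \<in> Max_R" "v \<in> W q" "v \<noteq> 0\<^sub>M" for q v
    proof (rule ccontr)
      assume none: "\<nexists>i. q = m i"
      have "v \<in> {0\<^sub>M}"
      proof (rule mem_W_up[OF u q(1,2)])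
        show "g \<in> {0\<^sub>M}" if i: "(pred ^^ i) q = p" for g i
        proof -
          obtain a where a: "a > 0" "(pred ^^ a) q = q"
            using periodic q by blast
          \<comment> \<open>Running i times through the period a of q takes a i steps back to q. The
            initial i of them lead to p, and the other a i - i lead from p to q.\<close>
          have "(pred ^^ (a * i)) q = q"
            by (induction i) (use a(2) in \<open>simp_all add: funpow_add\<close>)
          moreover have "a * i = (a * i - i) + i"
            using a(1) by simp
          ultimately have "q = (pred ^^ (a * i - i)) ((pred ^^ i) q)"
            by (metis comp_apply funpow_add)
          then have "q = m (- int (a * i - i))"
            unfolding i m(5) .
          then show ?thesis
            using none by blast
        qed
        show "(Y ^^ Suc j) g \<in> {0\<^sub>M}" if "(pred ^^ Suc j) p = q" for g j
          using none m(5)[of "Suc j"] that by metis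
      qed auto
      then show False
        using q by simp
    qed
    have "u \<in> W (m 0)"
      using u(2) m(5)[of 0] by simp
    interpret C: cyclic_weight R \<sigma> t M k m
      by unfold_locales (fact m(1-4) supp)+
    have "\<exists>f. irreducible_element (band_ring R \<sigma> m k) f \<and>
        left_module_isomorphic A M (band_module_N R \<sigma> t m k f)"
      by (rule C.band_N, fact inj, fact \<open>u \<in> W (m 0)\<close>, fact u(3))
    then show ?thesis
      using C.periodic by blast
  qed
qed

theorem theorem27:
  fixes R :: "('r, 'a) ring_scheme"
    and \<sigma> :: "'r \<Rightarrow> 'r"
    and t :: 'r
    and M :: "('r wgwa_term set, 'm, 'b) module_scheme"
  assumes "cring R"
    and "\<sigma> \<in> ring_hom R R"
    and "essential_endo R \<sigma>"
    and "t \<in> carrier R"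
    and "simple_left_module (wgwa R \<sigma> t) M"
    and "weight_module R \<sigma> t M"
  shows
    "(\<exists>I m. string_family R \<sigma> t I m \<and>
        left_module_isomorphic (wgwa R \<sigma> t) M (string_module R \<sigma> t I m)) \<or>
     (\<exists>m k f. periodic_family R \<sigma> t m k \<and> irreducible_element (band_ring R \<sigma> m k) f \<and>
        (left_module_isomorphic (wgwa R \<sigma> t) M (band_module_M R \<sigma> t m k f) \<or>
         left_module_isomorphic (wgwa R \<sigma> t) M (band_module_N R \<sigma> t m k f)))"
proof -
  interpret R: cring R by fact
  interpret M: left_module "wgwa R \<sigma> t" M
    using assms(5) by (simp add: simple_left_module_def)
  interpret wgwa_simple_weight R \<sigma> t M
    by unfold_locales (use assms in auto)
  show ?thesis
    by (rule string_or_band)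
qed

end
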